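(* Let $c\in\{0,1,2\}$ and let $G$ be a $c$-cyclic graph on $n$ vertices. Then for each $k\in\{1,2,\dots,n-1\}$, $$s_k(G)\le e(G)+\binom{k+1}{2}.$$ Moreover, equality holds if and only if one of the following occurs: $c=0$, $k=1$ and $G\cong S_n$; or $c=1$, $k=2$ and $G\cong G(n-3,1)$; or $c=2$, $k=2$ and $G\cong G(n-4,2)$.
   Context: All graphs are finite, simple and undirected; $e(G)$ is the number of edges. A $c$-cyclic graph is a connected graph with $e(G)=n+c-1$ (trees for $c=0$, unicyclic graphs for $c=1$, bicyclic for $c=2$). For a graph $G$ on $n$ vertices, $L(G)=D(G)-A(G)$ is its Laplacian matrix with eigenvalues $\mu_1(G)\ge\dots\ge\mu_n(G)$, and $s_k(G)=\sum_{i=1}^k\mu_i(G)$. $S_n$ is the star on $n$ vertices. For $0\le s\le n-3$, $G(s,n-2-s)$ is the graph on $n$ vertices consisting of an edge $uv$, $n-2-s$ further vertices each adjacent to both $u$ and $v$, and $s$ further vertices each adjacent only to $u$. Thus $G(n-3,1)$ is a triangle with $n-3$ pendant vertices attached to one vertex, and $G(n-4,2)$ is $K_4$ minus an edge with $n-4$ pendant vertices attached to one of its two vertices of degree $3$. *)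

theory Defs
  imports
    "Graph_Theory.Graph_Theory"
    "Jordan_Normal_Form.Char_Poly"
    "HOL-Library.Multiset"
begin

text \<open>
  A finite simple undirected graph is a \<open>pair_graph\<close>: a finite, loop-free, symmetric set of
  arcs, each undirected edge being represented by its two opposite arcs.  Connectedness is written
  \<open>Digraph_Component.connected\<close>, since the unqualified name also denotes topological
  connectedness; it includes that the vertex set is nonempty.
\<close>

definition num_edges :: "'a pair_pre_digraph \<Rightarrow> nat" where
  "num_edges G = card {{u, v} | u v. (u, v) \<in> parcs G}"

text \<open>The edge count \<open>e(G) = n + c - 1\<close> is stated without truncated subtraction.\<close>

definition c_cyclic :: "nat \<Rightarrow> 'a pair_pre_digraph \<Rightarrow> bool" where
  "c_cyclic c G \<longleftrightarrow> pair_graph G \<and> Digraph_Component.connected (with_proj G) \<and>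
     num_edges G + 1 = card (pverts G) + c"

text \<open>
  Matrices are indexed by \<open>0, ..., n - 1\<close>, so the vertices are listed in some order.  The
  order is irrelevant for the spectrum, see \<open>char_poly_laplacian_mat_indep\<close> below.
\<close>

definition degree_mat :: "'a pair_pre_digraph \<Rightarrow> 'a list \<Rightarrow> real mat" where
  "degree_mat G vs = mat (length vs) (length vs)
     (\<lambda>(i, j). if i = j then real (out_degree (with_proj G) (vs ! i)) else 0)"

definition adjacency_mat :: "'a pair_pre_digraph \<Rightarrow> 'a list \<Rightarrow> real mat" where
  "adjacency_mat G vs = mat (length vs) (length vs)
     (\<lambda>(i, j). if (vs ! i, vs ! j) \<in> parcs G then 1 else 0)"

definition laplacian_mat :: "'a pair_pre_digraph \<Rightarrow> 'a list \<Rightarrow> real mat" where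
  "laplacian_mat G vs = degree_mat G vs - adjacency_mat G vs"

definition vertex_list :: "'a pair_pre_digraph \<Rightarrow> 'a list" where
  "vertex_list G = (SOME vs. distinct vs \<and> set vs = pverts G)"

text \<open>
  The roots of the characteristic polynomial with multiplicity, in non-increasing order.  As the
  Laplacian matrix is real symmetric, all its eigenvalues are real and the list has length
  \<open>card (pverts G)\<close>.
\<close>

definition laplacian_spectrum :: "'a pair_pre_digraph \<Rightarrow> real list" where
  "laplacian_spectrum G =
     rev (sorted_list_of_multiset (proots (char_poly (laplacian_mat G (vertex_list G)))))"

definition laplacian_eigenvalue :: "'a pair_pre_digraph \<Rightarrow> nat \<Rightarrow> real" where
  "laplacian_eigenvalue G i = laplacian_spectrum G ! (i - 1)" \<comment> \<open>for \<open>1 \<le> i \<le> n\<close>\<close>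

definition laplacian_sum :: "nat \<Rightarrow> 'a pair_pre_digraph \<Rightarrow> real" where
  "laplacian_sum k G = (\<Sum>i = 1..k. laplacian_eigenvalue G i)"

definition star_graph :: "nat \<Rightarrow> nat pair_pre_digraph" where
  "star_graph n = (let E = {0} \<times> {1..<n} in \<lparr> pverts = {..<n}, parcs = E \<union> E\<inverse> \<rparr>)"

text \<open>
  The graph \<open>G(s, t)\<close> on \<open>s + t + 2\<close> vertices: \<open>u = 0\<close>, \<open>v = 1\<close>, the common neighbours of
  \<open>u\<close> and \<open>v\<close> are \<open>2, ..., t + 1\<close>, and \<open>t + 2, ..., s + t + 1\<close> are adjacent to \<open>u\<close> only.
\<close>

definition G_graph :: "nat \<Rightarrow> nat \<Rightarrow> nat pair_pre_digraph" where
  "G_graph s t =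
     (let E = {(0, 1)} \<union> {0, 1} \<times> {2..<t + 2} \<union> {0} \<times> {t + 2..<s + t + 2}
      in \<lparr> pverts = {..<s + t + 2}, parcs = E \<union> E\<inverse> \<rparr>)"

lemma vertex_list:
  assumes "finite (pverts G)"
  shows "distinct (vertex_list G)" "set (vertex_list G) = pverts G"
proof -
  have "\<exists>vs. distinct vs \<and> set vs = pverts G"
    using finite_distinct_list[OF assms] by blast
  from someI_ex[OF this] show "distinct (vertex_list G)" "set (vertex_list G) = pverts G"
    unfolding vertex_list_def by simp_all
qed

lemma char_poly_laplacian_mat_indep:
  assumes vs: "distinct vs" and ws: "distinct ws" and eq: "set vs = set ws"
  shows "char_poly (laplacian_mat G vs) = char_poly (laplacian_mat G ws)"
proof -
  let ?n = "length ws"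
  have len: "length vs = ?n"
    using distinct_card[OF vs] distinct_card[OF ws] eq by simp
  obtain p where p: "p permutes {..<?n}" and pw: "permute_list p ws = vs"
    by (rule mset_eq_permutation[of vs ws])
      (use assms in \<open>simp add: set_eq_iff_mset_eq_distinct\<close>)
  have nth: "vs ! i = ws ! p i" if "i < ?n" for i
    using pw permute_list_nth[OF p that] by simp
  have lt: "p i < ?n" if "i < ?n" for i
    using permutes_in_image[OF p, of i] that by simp
  have inj: "p i = p j \<longleftrightarrow> i = j" for i j
    using permutes_inj[OF p] by (simp add: inj_eq)
  have p0: "p permutes {0..<?n}" using p by (simp add: atLeast0LessThan)
  have car: "laplacian_mat G xs \<in> carrier_mat (length xs) (length xs)" for xs
    by (auto simp: laplacian_mat_def degree_mat_def adjacency_mat_def)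
  define A where "A = char_poly_matrix (laplacian_mat G ws)"
  have A: "A \<in> carrier_mat ?n ?n"
    unfolding A_def by (rule char_poly_matrix_closed[OF car])
  define R where "R = mat ?n ?n (\<lambda>(i, j). A $$ (p i, j))"
  have R: "R \<in> carrier_mat ?n ?n" by (simp add: R_def)
  have "char_poly_matrix (laplacian_mat G vs) = mat ?n ?n (\<lambda>(i, j). A $$ (p i, p j))"
    by (rule eq_matI)
      (auto simp: A_def char_poly_matrix_def laplacian_mat_def degree_mat_def adjacency_mat_def
        len nth lt inj)
  also have "\<dots> = transpose_mat (mat ?n ?n (\<lambda>(i, j). transpose_mat R $$ (p i, j)))"
    by (rule eq_matI) (use A lt in \<open>auto simp: R_def\<close>)
  also have "det \<dots> = det (mat ?n ?n (\<lambda>(i, j). transpose_mat R $$ (p i, j)))"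
    by (rule det_transpose[of _ ?n]) simp
  also have "\<dots> = signof p * det (transpose_mat R)"
    by (rule det_permute_rows[OF _ p0]) (use R in simp)
  also have "det (transpose_mat R) = det R" by (rule det_transpose[OF R])
  also have "det R = signof p * det A"
    unfolding R_def by (rule det_permute_rows[OF A p0])
  also have "signof p * (signof p * det A) = det A"
    by (simp add: sign_def)
  finally show ?thesis by (simp add: char_poly_def A_def)
qed

end

theory Submission
  imports Defs "HOL-Analysis.Function_Topology"
begin

text \<open>
  Let \<open>c\<close> be the Gram matrix of the first \<open>k\<close> eigenvectors, a projection of rank \<open>k\<close> that annihilates the
  constants.  Then \<open>s_k - e(G)\<close> is the sum of \<open>c u u + c v v - 1 - 2 * c u v\<close> over the edges, which
  is to be compared with \<open>k * (k + 1) / 2\<close>.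

  For \<open>k = 1\<close> the bound is \<open>\<mu>_1 \<le> n\<close>.  For \<open>k \<ge> 2\<close> a Cauchy-Schwarz argument in the eigenvalue
  equations gives \<open>s_k < 2 * k + 2 * e(G) - n\<close>, which settles all cases except \<open>(c, k) = (2, 3)\<close>,
  \<open>(1, 2)\<close> and \<open>(2, 2)\<close>.  There, decompose \<open>G\<close> into a core of minimum degree at least 2 and a forest
  attached to it, and bound the terms \<open>- 2 * c u v\<close> by choosing for each edge one or two of its ends
  as centres; a centre \<open>u\<close> has only \<open>\<Sum>v\<noteq>u. (c u v)\<^sup>2 = c u u * (1 - c u u)\<close> at its disposal.  This settles
  \<open>k = 3\<close>.  For \<open>k = 2\<close>, a nontrivial tree hanging off the core is cut off at a bridge by induction, so
  that only pendant vertices remain; large cores are covered by the choice of centres, and a triangle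
  or \<open>K\<^sub>4\<close> minus an edge with pendant vertices is compared with a clique with pendant vertices, whose two
  largest eigenvalues solve an explicit equation.
\<close>

section \<open>Spectral theorem and Ky Fan inequality\<close>

text \<open>For \<open>k \<ge> 2\<close> the incidence bound \<open>2 * k + 2 * e(G) - n\<close>
  equals e(G) + 2k + c - 1 and stays below the target exactly when 2c \<le> (k - 1)(k - 2); this is
  where the three exceptional pairs come from.

  For \<open>k = 2\<close> the bound is attained, so no estimate with slack can cover the cores of
  the extremal graphs. There the two largest eigenvalues are compared through an exact cubic
  equation, and the inequalities are kept in a form whose equality case can be read off. Every
  further core vertex brings a gain of 1/2, so coarse weights suffice for larger cores.

  Graphs are compared by changing a few edges while \<open>c\<close> stays the same: the excess is a
  sum over edges, and by Ky Fan any orthonormal family bounds the eigenvalue sum of the changed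
  graph from below. This is why the excess is taken at general projections.

  The strict inequality \<open>c u u < 1\<close>, due to eigenvectors being orthogonal to the
  constants, permits the division by \<open>1 - c u u\<close> that turns a row sum into a price for
  a centre.\<close>

definition ip :: "'a set \<Rightarrow> ('a \<Rightarrow> real) \<Rightarrow> ('a \<Rightarrow> real) \<Rightarrow> real" where
  "ip V x y = (\<Sum>v\<in>V. x v * y v)"

definition app :: "'a set \<Rightarrow> ('a \<Rightarrow> 'a \<Rightarrow> real) \<Rightarrow> ('a \<Rightarrow> real) \<Rightarrow> 'a \<Rightarrow> real" where
  "app V a x v = (\<Sum>u\<in>V. a v u * x u)"

definition orthonormal :: "'a set \<Rightarrow> nat \<Rightarrow> (nat \<Rightarrow> 'a \<Rightarrow> real) \<Rightarrow> bool" where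
  "orthonormal V k x \<longleftrightarrow> (\<forall>i<k. \<forall>j<k. ip V (x i) (x j) = (if i = j then 1 else 0))"

definition eigenbasis ::
    "'a set \<Rightarrow> ('a \<Rightarrow> 'a \<Rightarrow> real) \<Rightarrow> (nat \<Rightarrow> 'a \<Rightarrow> real) \<Rightarrow> (nat \<Rightarrow> real) \<Rightarrow> bool" where
  "eigenbasis V a x \<mu> \<longleftrightarrow> orthonormal V (card V) x \<and>
     (\<forall>i<card V. \<forall>v\<in>V. app V a (x i) v = \<mu> i * x i v) \<and>
     (\<forall>i j. i \<le> j \<longrightarrow> j < card V \<longrightarrow> \<mu> j \<le> \<mu> i)"

lemma ip_commute: "ip V x y = ip V y x"
  by (simp add: ip_def mult.commute)

lemma ip_add_right: "ip V x (\<lambda>v. y v + z v) = ip V x y + ip V x z"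
  by (simp add: ip_def algebra_simps sum.distrib)

lemma ip_diff_right: "ip V x (\<lambda>v. y v - z v) = ip V x y - ip V x z"
  by (simp add: ip_def algebra_simps sum_subtractf)

lemma ip_scale_right: "ip V x (\<lambda>v. c * y v) = c * ip V x y"
  by (simp add: ip_def sum_distrib_left algebra_simps)

lemma ip_add_left: "ip V (\<lambda>v. x v + y v) z = ip V x z + ip V y z"
  by (simp add: ip_def algebra_simps sum.distrib)

lemma ip_scale_left: "ip V (\<lambda>v. c * x v) y = c * ip V x y"
  by (simp add: ip_def sum_distrib_left algebra_simps)

lemma ip_sum_right: "ip V x (\<lambda>v. \<Sum>i\<in>I. y i v) = (\<Sum>i\<in>I. ip V x (y i))"
  unfolding ip_def sum_distrib_left by (rule sum.swap)

lemma ip_cong: "(\<And>v. v \<in> V \<Longrightarrow> x v = x' v) \<Longrightarrow> (\<And>v. v \<in> V \<Longrightarrow> y v = y' v) \<Longrightarrow> ip V x y = ip V x' y'"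
  by (simp add: ip_def)

lemma ip_nonneg: "0 \<le> ip V x x"
  by (simp add: ip_def sum_nonneg)

lemma ip_eq_0_iff: "finite V \<Longrightarrow> ip V x x = 0 \<longleftrightarrow> (\<forall>v\<in>V. x v = 0)"
  by (simp add: ip_def sum_nonneg_eq_0_iff)

lemma app_add: "app V a (\<lambda>v. x v + y v) v = app V a x v + app V a y v"
  by (simp add: app_def algebra_simps sum.distrib)

lemma app_scale: "app V a (\<lambda>v. c * x v) v = c * app V a x v"
  by (simp add: app_def sum_distrib_left algebra_simps)

lemma app_sum: "app V a (\<lambda>v. \<Sum>i\<in>I. x i v) v = (\<Sum>i\<in>I. app V a (x i) v)"
  unfolding app_def sum_distrib_left by (rule sum.swap)

lemma app_cong: "(\<And>v. v \<in> V \<Longrightarrow> x v = y v) \<Longrightarrow> app V a x v = app V a y v"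
  by (simp add: app_def)

lemma app_symmetric:
  assumes "\<And>u v. u \<in> V \<Longrightarrow> v \<in> V \<Longrightarrow> a u v = a v u"
  shows "ip V x (app V a y) = ip V y (app V a x)"
proof -
  have "ip V x (app V a y) = (\<Sum>v\<in>V. \<Sum>u\<in>V. x v * (a v u * y u))"
    by (simp add: ip_def app_def sum_distrib_left)
  also have "\<dots> = (\<Sum>u\<in>V. \<Sum>v\<in>V. x v * (a v u * y u))" by (rule sum.swap)
  also have "\<dots> = (\<Sum>u\<in>V. \<Sum>v\<in>V. y u * (a u v * x v))"
    by (intro sum.cong refl) (simp add: assms)
  finally show ?thesis by (simp add: ip_def app_def sum_distrib_left)
qed

lemma ip_point:
  assumes "finite V" "w \<in> V"
  shows "ip V x (\<lambda>v. if v = w then 1 else 0) = x w"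
  unfolding ip_def using assms by (simp add: if_distrib[of "\<lambda>t. _ * t"] cong: if_cong)

lemma ip_project_out:
  assumes "orthonormal V k x" "j < k"
  shows "ip V (x j) (\<lambda>v. y v - (\<Sum>i<k. ip V (x i) y * x i v)) = 0"
proof -
  have "ip V (x j) (\<lambda>v. \<Sum>i<k. ip V (x i) y * x i v) = (\<Sum>i<k. ip V (x i) y * ip V (x j) (x i))"
    by (simp add: ip_sum_right ip_scale_right)
  also have "\<dots> = (\<Sum>i<k. if i = j then ip V (x i) y else 0)"
    using assms by (intro sum.cong refl) (auto simp: orthonormal_def)
  finally show ?thesis using assms(2) by (simp add: ip_diff_right)
qed

lemma bessel_remainder:
  fixes y :: "'a \<Rightarrow> real"
  assumes "orthonormal V k x"
  defines "z \<equiv> \<lambda>v. y v - (\<Sum>i<k. ip V (x i) y * x i v)"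
  shows "ip V z z = ip V y y - (\<Sum>i<k. (ip V (x i) y)\<^sup>2)"
proof -
  have z: "ip V (x i) z = 0" if "i < k" for i
    unfolding z_def by (rule ip_project_out[OF assms(1) that])
  have "ip V z z = ip V z y - ip V z (\<lambda>v. \<Sum>i<k. ip V (x i) y * x i v)"
    unfolding z_def by (simp only: ip_diff_right[symmetric])
  also have "ip V z (\<lambda>v. \<Sum>i<k. ip V (x i) y * x i v) = 0"
    by (simp add: ip_sum_right ip_scale_right z ip_commute[of V z "x _"])
  also have "ip V z y = ip V y y - (\<Sum>i<k. ip V (x i) y * ip V y (x i))"
    unfolding ip_commute[of V z] by (simp add: z_def ip_diff_right ip_sum_right ip_scale_right)
  finally show ?thesis by (simp add: power2_eq_square ip_commute)
qed

lemma bessel: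
  assumes "orthonormal V k x"
  shows "(\<Sum>i<k. (ip V (x i) y)\<^sup>2) \<le> ip V y y"
proof -
  let ?z = "\<lambda>v. y v - (\<Sum>i<k. ip V (x i) y * x i v)"
  have "0 \<le> ip V ?z ?z" by (rule ip_nonneg)
  then show ?thesis by (simp add: bessel_remainder[OF assms])
qed

text \<open>Averaging replaces a dimension count: the projections of the unit vectors onto the span
  have squared lengths with sum \<open>k\<close>, so one of the \<open>card V\<close> unit vectors
  leaves a nonzero remainder, which can be normalised.\<close>

lemma exists_orthogonal:
  assumes V: "finite V" and x: "orthonormal V k x" and k: "k < card V"
  shows "\<exists>y. ip V y y = 1 \<and> (\<forall>i<k. ip V (x i) y = 0)"
proof -
  have "(\<Sum>w\<in>V. \<Sum>i<k. (x i w)\<^sup>2) = (\<Sum>i<k. ip V (x i) (x i))"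
    unfolding ip_def power2_eq_square by (rule sum.swap)
  also have "\<dots> = real k" using x by (simp add: orthonormal_def)
  also have "\<dots> < (\<Sum>w\<in>V. 1)" using k by simp
  finally obtain w where w: "w \<in> V" "(\<Sum>i<k. (x i w)\<^sup>2) < 1"
    using sum_mono[of V "\<lambda>_. 1" "\<lambda>w. \<Sum>i<k. (x i w)\<^sup>2"] by (meson not_le)
  define e :: "'a \<Rightarrow> real" where "e = (\<lambda>v. if v = w then 1 else 0)"
  have e: "ip V u e = u w" for u unfolding e_def by (rule ip_point[OF V w(1)])
  define z where "z = (\<lambda>v. e v - (\<Sum>i<k. ip V (x i) e * x i v))"
  have "ip V z z = ip V e e - (\<Sum>i<k. (ip V (x i) e)\<^sup>2)"
    unfolding z_def by (rule bessel_remainder[OF x])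
  then have pos: "0 < ip V z z" using w(2) by (simp add: e) (simp add: e_def)
  have z: "ip V (x i) z = 0" if "i < k" for i
    unfolding z_def by (rule ip_project_out[OF x that])
  let ?c = "1 / sqrt (ip V z z)"
  have "ip V (\<lambda>v. ?c * z v) (\<lambda>v. ?c * z v) = ?c * (?c * ip V z z)"
    by (simp only: ip_scale_right ip_scale_left)
  also have "\<dots> = 1" using pos by (simp add: field_simps)
  finally show ?thesis using z by (intro exI[of _ "\<lambda>v. ?c * z v"]) (simp only: ip_scale_right, simp)
qed

text \<open>In the product topology this is Tychonoff's theorem; fixing the values outside
  \<open>V\<close> makes the set compact even over an infinite type.\<close>

lemma compact_box:
  "compact {x :: 'a \<Rightarrow> real. (\<forall>v\<in>V. \<bar>x v\<bar> \<le> 1) \<and> (\<forall>v. v \<notin> V \<longrightarrow> x v = 0)}"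
proof -
  have "compactin (product_topology (\<lambda>_. euclidean) UNIV)
      (PiE UNIV (\<lambda>v::'a. if v \<in> V then {-1..1::real} else {0}))"
    unfolding compactin_PiE by auto
  moreover have "PiE UNIV (\<lambda>v::'a. if v \<in> V then {-1..1::real} else {0})
      = {x. (\<forall>v\<in>V. \<bar>x v\<bar> \<le> 1) \<and> (\<forall>v. v \<notin> V \<longrightarrow> x v = 0)}"
    by (auto simp: PiE_def Pi_def abs_le_iff split: if_splits)
  ultimately show ?thesis by (simp add: euclidean_product_topology)
qed

text \<open>First-order condition at a maximum: for small \<open>t\<close> the linear term
  dominates. The denominator \<open>\<bar>c\<bar> + 1\<close> makes \<open>t\<close> small enough
  and is never 0.\<close>

lemma nonpos_parabola:
  fixes b c :: real
  assumes "\<And>t. 2 * t * b + t\<^sup>2 * c \<le> 0"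
  shows "b = 0"
proof (rule ccontr)
  assume b: "b \<noteq> 0"
  define t where "t = b / (\<bar>c\<bar> + 1)"
  have "t\<^sup>2 * - c \<le> t\<^sup>2 * \<bar>c\<bar>" by (intro mult_left_mono) auto
  then have "2 * t * b \<le> t\<^sup>2 * \<bar>c\<bar>" using assms[of t] by simp
  also have "\<dots> \<le> t\<^sup>2 * (\<bar>c\<bar> + 1)" by (intro mult_left_mono) auto
  also have "\<dots> = t * b" by (simp add: t_def power2_eq_square)
  finally have "t * b \<le> 0" by (simp add: mult.commute)
  moreover have "0 < t * b"
  proof -
    have "0 < b * b" using b by (metis not_real_square_gt_zero)
    then show ?thesis by (simp add: t_def)
  qed
  ultimately show False by simp
qed

text \<open>Rayleigh's principle: a maximiser of the quadratic form on the unit sphere of the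
  orthogonal complement is an eigenvector. The maximality is part of the conclusion because it later
  yields the order of the eigenvalues.\<close>

lemma next_eigenvector:
  assumes V: "finite V" and a: "\<And>u v. u \<in> V \<Longrightarrow> v \<in> V \<Longrightarrow> a u v = a v u"
    and x: "orthonormal V k x" and k: "k < card V"
    and eig: "\<And>i v. i < k \<Longrightarrow> v \<in> V \<Longrightarrow> app V a (x i) v = \<mu> i * x i v"
  shows "\<exists>y \<nu>. ip V y y = 1 \<and> (\<forall>i<k. ip V (x i) y = 0) \<and> (\<forall>v\<in>V. app V a y v = \<nu> * y v) \<and>
    (\<forall>z. (\<forall>i<k. ip V (x i) z = 0) \<longrightarrow> ip V z (app V a z) \<le> \<nu> * ip V z z)"
proof -
  define B where "B = {z :: 'a \<Rightarrow> real. (\<forall>v\<in>V. \<bar>z v\<bar> \<le> 1) \<and> (\<forall>v. v \<notin> V \<longrightarrow> z v = 0)}"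
  define S where "S = B \<inter> ({z. ip V z z = 1} \<inter> (\<Inter>i<k. {z. ip V (x i) z = 0}))"
  have cont: "continuous_on UNIV (\<lambda>z. ip V z z)" "continuous_on UNIV (\<lambda>z. ip V (x i) z)"
    "continuous_on UNIV (\<lambda>z. ip V z (app V a z))" for i
    unfolding ip_def app_def by (intro continuous_intros continuous_on_product_coordinates)+
  have "closed {z. ip V z z = 1}" "closed {z. ip V (x i) z = 0}" for i
    by (intro closed_Collect_eq cont continuous_on_const)+
  then have "compact S"
    unfolding S_def B_def by (intro compact_Int_closed compact_box closed_Int closed_INT) auto
  \<comment> \<open>\<open>ip\<close> and \<open>app\<close> see only the values on
    \<open>V\<close>, while the compact set asks for zeros elsewhere; \<open>ext\<close> mediates
    between the two.\<close>
  define ext where "ext = (\<lambda>z v. if v \<in> V then z v else 0 :: real)"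
  have ext_ip: "ip V u (ext z) = ip V u z" "ip V (ext z) u = ip V z u" for u z
    by (auto simp: ext_def intro!: ip_cong)
  have ext_app: "app V a (ext z) v = app V a z v" for z v
    by (rule app_cong) (simp add: ext_def)
  have extS: "ext z \<in> S" if "ip V z z = 1" "\<forall>i<k. ip V (x i) z = 0" for z
  proof -
    have "\<bar>z v\<bar> \<le> 1" if v: "v \<in> V" for v
    proof -
      have "(z v)\<^sup>2 \<le> ip V z z" unfolding ip_def power2_eq_square
        by (rule member_le_sum[OF v]) (use V in auto)
      then show ?thesis using \<open>ip V z z = 1\<close> by (simp add: abs_square_le_1)
    qed
    then show ?thesis using that unfolding S_def B_def by (auto simp: ext_ip) (auto simp: ext_def)
  qed
  obtain y0 where "ip V y0 y0 = 1" "\<forall>i<k. ip V (x i) y0 = 0"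
    using exists_orthogonal[OF V x k] by blast
  then have "S \<noteq> {}" using extS by blast
  then obtain y where y: "y \<in> S" and ymax: "\<And>z. z \<in> S \<Longrightarrow> ip V z (app V a z) \<le> ip V y (app V a y)"
    using continuous_attains_sup[OF \<open>compact S\<close>, of "\<lambda>z. ip V z (app V a z)"]
      continuous_on_subset[OF cont(3)] by blast
  define \<nu> where "\<nu> = ip V y (app V a y)"
  have y1: "ip V y y = 1" and yx: "\<And>i. i < k \<Longrightarrow> ip V (x i) y = 0" using y unfolding S_def by auto
  have max: "ip V z (app V a z) \<le> \<nu> * ip V z z" if z: "\<forall>i<k. ip V (x i) z = 0" for z
  proof (cases "ip V z z = 0")
    case True
    then have "ip V z (app V a z) = 0" using V by (simp add: ip_eq_0_iff) (simp add: ip_def)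
    then show ?thesis using True by simp
  next
    case False
    then have pos: "0 < ip V z z" using ip_nonneg[of V z] by simp
    define c where "c = 1 / sqrt (ip V z z)"
    have c2: "c * c = 1 / ip V z z" using pos by (simp add: c_def)
    have sc: "ip V (\<lambda>v. c * z v) (\<lambda>v. c * u v) = c * c * ip V z u" for u
      by (simp add: ip_scale_right ip_scale_left)
    have "ext (\<lambda>v. c * z v) \<in> S"
      by (rule extS) (use z pos in \<open>auto simp: sc c2, auto simp: ip_scale_right\<close>)
    from ymax[OF this] have "ip V (\<lambda>v. c * z v) (app V a (\<lambda>v. c * z v)) \<le> \<nu>"
      unfolding \<nu>_def ext_ip(2) by (simp only: ext_app[abs_def])
    then have "c * c * ip V z (app V a z) \<le> \<nu>"
      by (simp only: app_scale[abs_def] sc)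
    then show ?thesis using pos by (simp add: c2 field_simps)
  qed
  have ortho: "ip V z (app V a y) = \<nu> * ip V z y" if z: "\<forall>i<k. ip V (x i) z = 0" for z
  proof -
    have "ip V z (app V a y) - \<nu> * ip V z y = 0"
    proof (rule nonpos_parabola)
      fix t :: real
      let ?w = "\<lambda>v. y v + t * z v"
      have "ip V ?w (app V a ?w) \<le> \<nu> * ip V ?w ?w"
        by (rule max) (use z yx in \<open>simp add: ip_add_right ip_scale_right\<close>)
      moreover have "ip V ?w (app V a ?w) = \<nu> + 2 * t * ip V z (app V a y) + t\<^sup>2 * ip V z (app V a z)"
      proof -
        have l: "ip V ?w u = ip V y u + t * ip V z u" for u
          by (simp only: ip_add_left ip_scale_left)
        have e: "app V a ?w = (\<lambda>v. app V a y v + t * app V a z v)"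
          by (rule ext) (simp add: app_add app_scale)
        show ?thesis
          unfolding e l by (simp add: ip_add_right ip_scale_right \<nu>_def power2_eq_square
              app_symmetric[OF a, where x = y and y = z] algebra_simps)
      qed
      moreover have "ip V ?w ?w = 1 + 2 * t * ip V z y + t\<^sup>2 * ip V z z"
      proof -
        have l: "ip V ?w u = ip V y u + t * ip V z u" for u
          by (simp only: ip_add_left ip_scale_left)
        show ?thesis unfolding l by (simp add: ip_add_right ip_scale_right y1 power2_eq_square
              ip_commute[of V y z] algebra_simps)
      qed
      ultimately show "2 * t * (ip V z (app V a y) - \<nu> * ip V z y)
          + t\<^sup>2 * (ip V z (app V a z) - \<nu> * ip V z z) \<le> 0"
        by (simp add: algebra_simps)
    qed
    then show ?thesis by simp
  qed
  \<comment> \<open>\<open>ortho\<close> speaks about vectors of the complement only. The residual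
    \<open>w\<close> lies there because \<open>app\<close> is symmetric and the \<open>x i\<close>
    are eigenvectors, so it can be tested against itself.\<close>
  define w where "w = (\<lambda>v. app V a y v - \<nu> * y v)"
  have wx: "ip V (x i) w = 0" if i: "i < k" for i
  proof -
    have "ip V (x i) (app V a y) = ip V y (app V a (x i))" by (rule app_symmetric[OF a])
    also have "\<dots> = ip V y (\<lambda>v. \<mu> i * x i v)" by (rule ip_cong) (simp_all add: eig i)
    also have "\<dots> = 0" using yx[OF i] by (simp add: ip_scale_right ip_commute)
    finally show ?thesis using yx[OF i] by (simp add: w_def ip_diff_right ip_scale_right)
  qed
  have "ip V w w = ip V w (app V a y) - \<nu> * ip V w y"
    unfolding w_def by (simp only: ip_diff_right ip_scale_right)
  also have "\<dots> = 0" using ortho[of w] wx by simp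
  finally have "\<forall>v\<in>V. w v = 0" using V by (simp add: ip_eq_0_iff)
  then have "\<forall>v\<in>V. app V a y v = \<nu> * y v" by (simp add: w_def)
  then show ?thesis using y1 yx max by blast
qed

theorem eigenbasis_exists:
  assumes V: "finite V" and a: "\<And>u v. u \<in> V \<Longrightarrow> v \<in> V \<Longrightarrow> a u v = a v u"
  shows "\<exists>x \<mu>. eigenbasis V a x \<mu>"
proof -
  have "k \<le> card V \<Longrightarrow> \<exists>x \<mu>. orthonormal V k x \<and> (\<forall>i<k. \<forall>v\<in>V. app V a (x i) v = \<mu> i * x i v) \<and>
      (\<forall>i<k. \<forall>z. (\<forall>j<i. ip V (x j) z = 0) \<longrightarrow> ip V z (app V a z) \<le> \<mu> i * ip V z z)" for k
  proof (induction k)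
    case 0
    then show ?case by (simp add: orthonormal_def)
  next
    case (Suc k)
    then obtain x \<mu> where x: "orthonormal V k x"
      and eig: "\<forall>i<k. \<forall>v\<in>V. app V a (x i) v = \<mu> i * x i v"
      and mx: "\<forall>i<k. \<forall>z. (\<forall>j<i. ip V (x j) z = 0) \<longrightarrow> ip V z (app V a z) \<le> \<mu> i * ip V z z"
      using Suc_leD[OF Suc.prems] by blast
    have "k < card V" using Suc.prems by simp
    from next_eigenvector[where a = a and \<mu> = \<mu>, OF V a x this] eig
    obtain y \<nu> where y: "ip V y y = 1" "\<forall>i<k. ip V (x i) y = 0" "\<forall>v\<in>V. app V a y v = \<nu> * y v"
      "\<forall>z. (\<forall>i<k. ip V (x i) z = 0) \<longrightarrow> ip V z (app V a z) \<le> \<nu> * ip V z z"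
      by blast
    let ?x = "x(k := y)" and ?m = "\<mu>(k := \<nu>)"
    have "orthonormal V (Suc k) ?x"
      using x y(1,2) by (auto simp: orthonormal_def less_Suc_eq ip_commute)
    moreover have "\<forall>i<Suc k. \<forall>v\<in>V. app V a (?x i) v = ?m i * ?x i v"
      using eig y(3) by (auto simp: less_Suc_eq)
    moreover have "\<forall>i<Suc k. \<forall>z. (\<forall>j<i. ip V (?x j) z = 0) \<longrightarrow> ip V z (app V a z) \<le> ?m i * ip V z z"
      using mx y(4) by (auto simp: less_Suc_eq)
    ultimately show ?case by blast
  qed
  from this[OF order_refl] obtain x \<mu> where x: "orthonormal V (card V) x"
    and eig: "\<forall>i<card V. \<forall>v\<in>V. app V a (x i) v = \<mu> i * x i v"
    and mx: "\<forall>i<card V. \<forall>z. (\<forall>j<i. ip V (x j) z = 0) \<longrightarrow> ip V z (app V a z) \<le> \<mu> i * ip V z z"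
    by blast
  have "\<mu> j \<le> \<mu> i" if ij: "i \<le> j" "j < card V" for i j
  proof -
    have "ip V (x j) (app V a (x j)) = ip V (x j) (\<lambda>v. \<mu> j * x j v)"
      by (rule ip_cong) (simp_all add: eig ij)
    also have "\<dots> = \<mu> j" using x ij by (simp add: ip_scale_right orthonormal_def)
    finally show ?thesis using mx[rule_format, of i "x j"] x ij by (auto simp: orthonormal_def)
  qed
  then have "eigenbasis V a x \<mu>" using x eig by (simp add: eigenbasis_def)
  then show ?thesis by blast
qed

lemma orthonormal_subset:
  "orthonormal V k x \<Longrightarrow> j \<le> k \<Longrightarrow> orthonormal V j x"
  by (simp add: orthonormal_def)

lemma orthonormal_le_card:
  assumes V: "finite V" and x: "orthonormal V k x"
  shows "k \<le> card V"
proof -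
  have "real k = (\<Sum>i<k. ip V (x i) (x i))" using x by (simp add: orthonormal_def)
  also have "\<dots> = (\<Sum>w\<in>V. \<Sum>i<k. (x i w)\<^sup>2)"
    unfolding ip_def power2_eq_square by (rule sum.swap)
  also have "\<dots> \<le> (\<Sum>w\<in>V. 1)"
  proof (rule sum_mono)
    fix w assume w: "w \<in> V"
    let ?e = "\<lambda>v. if v = w then 1 else 0 :: real"
    have "(\<Sum>i<k. (ip V (x i) ?e)\<^sup>2) \<le> ip V ?e ?e" by (rule bessel[OF x])
    then show "(\<Sum>i<k. (x i w)\<^sup>2) \<le> 1" by (simp only: ip_point[OF V w] if_True simp_thms)
  qed
  finally show ?thesis by simp
qed

text \<open>A nonzero remainder, normalised, would extend the family to \<open>card V + 1\<close>
  orthonormal vectors.\<close>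

lemma orthonormal_basis_expand:
  assumes V: "finite V" and x: "orthonormal V (card V) x" and v: "v \<in> V"
  shows "y v = (\<Sum>i<card V. ip V (x i) y * x i v)"
proof -
  let ?n = "card V"
  define z where "z = (\<lambda>v. y v - (\<Sum>i<?n. ip V (x i) y * x i v))"
  have z: "ip V (x i) z = 0" if "i < ?n" for i
    unfolding z_def by (rule ip_project_out[OF x that])
  have "ip V z z = 0"
  proof (rule ccontr)
    assume "ip V z z \<noteq> 0"
    then have pos: "0 < ip V z z" using ip_nonneg[of V z] by simp
    define c where "c = 1 / sqrt (ip V z z)"
    have cz: "ip V (\<lambda>v. c * z v) (\<lambda>v. c * z v) = 1"
    proof -
      have "ip V (\<lambda>v. c * z v) (\<lambda>v. c * z v) = c * (c * ip V z z)"
        by (simp only: ip_scale_left ip_scale_right)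
      then show ?thesis using pos by (simp add: c_def)
    qed
    have "orthonormal V (Suc ?n) (x(?n := \<lambda>v. c * z v))"
      using x z cz by (auto simp: orthonormal_def less_Suc_eq ip_scale_left ip_scale_right ip_commute[of V z "x _"])
    from orthonormal_le_card[OF V this] show False by simp
  qed
  then show ?thesis using V v by (simp add: ip_eq_0_iff z_def)
qed

lemma parseval:
  assumes V: "finite V" and x: "orthonormal V (card V) x"
  shows "ip V y y = (\<Sum>i<card V. (ip V (x i) y)\<^sup>2)"
proof -
  have "ip V y y = ip V y (\<lambda>v. \<Sum>i<card V. ip V (x i) y * x i v)"
    by (rule ip_cong) (simp_all add: orthonormal_basis_expand[OF V x, symmetric])
  then show ?thesis
    by (simp add: ip_sum_right ip_scale_right power2_eq_square ip_commute[of V y "x _"])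
qed

lemma eigenbasis_form:
  assumes V: "finite V" and E: "eigenbasis V a x \<mu>"
  shows "ip V y (app V a y) = (\<Sum>i<card V. \<mu> i * (ip V (x i) y)\<^sup>2)"
proof -
  have x: "orthonormal V (card V) x" using E by (simp add: eigenbasis_def)
  have "app V a y v = (\<Sum>i<card V. ip V (x i) y * (\<mu> i * x i v))" if v: "v \<in> V" for v
  proof -
    have "app V a y v = app V a (\<lambda>v. \<Sum>i<card V. ip V (x i) y * x i v) v"
      by (rule app_cong) (rule orthonormal_basis_expand[OF V x])
    also have "\<dots> = (\<Sum>i<card V. ip V (x i) y * app V a (x i) v)"
      by (simp add: app_sum app_scale)
    also have "\<dots> = (\<Sum>i<card V. ip V (x i) y * (\<mu> i * x i v))"
      using E v by (intro sum.cong refl) (simp add: eigenbasis_def)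
    finally show ?thesis .
  qed
  then have "ip V y (app V a y) = ip V y (\<lambda>v. \<Sum>i<card V. ip V (x i) y * (\<mu> i * x i v))"
    by (intro ip_cong) simp_all
  then show ?thesis
    by (simp add: ip_sum_right ip_scale_right power2_eq_square ip_commute[of V y "x _"]) (simp add: mult_ac)
qed

lemma eigenbasis_value:
  assumes E: "eigenbasis V a x \<mu>" and i: "i < card V"
  shows "ip V (x i) (app V a (x i)) = \<mu> i"
proof -
  have "ip V (x i) (app V a (x i)) = ip V (x i) (\<lambda>v. \<mu> i * x i v)"
    by (rule ip_cong) (use E i in \<open>auto simp: eigenbasis_def\<close>)
  then show ?thesis using E i by (simp add: ip_scale_right eigenbasis_def orthonormal_def)
qed

text \<open>In the eigenbasis the left side is a weighted sum of the \<mu> j with weights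
  \<open>w j\<close> in [0, 1] of total \<open>k\<close>; it is largest when the first
  \<open>k\<close> indices carry all the weight.\<close>

lemma ky_fan:
  assumes V: "finite V" and E: "eigenbasis V a x \<mu>" and y: "orthonormal V k y"
  shows "(\<Sum>i<k. ip V (y i) (app V a (y i))) \<le> (\<Sum>i<k. \<mu> i)"
proof (cases k)
  case (Suc k')
  let ?n = "card V"
  have kn: "k \<le> ?n" by (rule orthonormal_le_card[OF V y])
  have x: "orthonormal V ?n x" and dec: "\<And>i j. i \<le> j \<Longrightarrow> j < ?n \<Longrightarrow> \<mu> j \<le> \<mu> i"
    using E by (auto simp: eigenbasis_def)
  define w where "w j = (\<Sum>i<k. (ip V (x j) (y i))\<^sup>2)" for j
  have w0: "0 \<le> w j" for j by (simp add: w_def sum_nonneg)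
  have w1: "w j \<le> 1" if "j < ?n" for j
    using bessel[OF y, of "x j"] x that unfolding w_def by (simp add: ip_commute[of V "y _" "x j"] orthonormal_def)
  have "(\<Sum>j<?n. w j) = (\<Sum>i<k. ip V (y i) (y i))"
    unfolding w_def by (subst sum.swap) (simp add: parseval[OF V x])
  also have "\<dots> = k" using y by (simp add: orthonormal_def)
  finally have ws: "(\<Sum>j<?n. w j) = k" .
  define t where "t = \<mu> k'"
  have "(\<Sum>i<k. ip V (y i) (app V a (y i))) = (\<Sum>j<?n. \<mu> j * w j)"
    unfolding w_def sum_distrib_left by (subst sum.swap) (simp add: eigenbasis_form[OF V E])
  also have "\<dots> \<le> (\<Sum>j<?n. (if j < k then \<mu> j - t else 0) + t * w j)"
  proof (rule sum_mono)
    fix j assume j: "j \<in> {..<?n}"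
    show "\<mu> j * w j \<le> (if j < k then \<mu> j - t else 0) + t * w j"
    proof (cases "j < k")
      case True
      have "(\<mu> j - t) * w j \<le> (\<mu> j - t) * 1"
        by (rule mult_left_mono) (use True Suc kn dec[of j k'] w1[of j] in \<open>auto simp: t_def\<close>)
      then show ?thesis using True by (simp add: algebra_simps)
    next
      case False
      then show ?thesis using Suc dec[of k' j] w0[of j] j by (auto simp: t_def intro!: mult_right_mono)
    qed
  qed
  also have "\<dots> = (\<Sum>j<?n. if j < k then \<mu> j - t else 0) + t * k"
    by (simp only: sum.distrib sum_distrib_left[symmetric] ws)
  also have "(\<Sum>j<?n. if j < k then \<mu> j - t else 0) = (\<Sum>j<k. \<mu> j - t)"
    using kn by (intro sum.mono_neutral_cong_right) auto
  also have "(\<Sum>j<k. \<mu> j - t) + t * k = (\<Sum>j<k. \<mu> j)" by (simp add: sum_subtractf)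
  finally show ?thesis .
qed simp

section \<open>The spectrum as the roots of the characteristic polynomial\<close>

text \<open>The eigenvectors written along \<open>vs\<close> form an orthogonal matrix
  \<open>U\<close> with \<open>A = U * D * transpose_mat U\<close>, so the roots with multiplicity
  are the diagonal entries of \<open>D\<close>.\<close>

lemma proots_char_poly_eigenbasis:
  assumes vs: "distinct vs" "set vs = V" and E: "eigenbasis V a x \<mu>"
  shows "proots (char_poly (mat (length vs) (length vs) (\<lambda>(i, j). a (vs ! i) (vs ! j))))
    = mset (map \<mu> [0..<card V])"
proof -
  let ?n = "length vs"
  have n: "card V = ?n" using distinct_card[OF vs(1)] vs(2) by simp
  have tr: "(\<Sum>v\<in>V. f v) = (\<Sum>i<?n. f (vs ! i))" for f :: "'a \<Rightarrow> real"
    using sum.reindex_bij_betw[OF bij_betw_nth[OF vs(1) refl vs(2)[symmetric]]] by metis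
  define A where "A = mat ?n ?n (\<lambda>(i, j). a (vs ! i) (vs ! j))"
  define U where "U = mat ?n ?n (\<lambda>(i, j). x j (vs ! i))"
  define D where "D = mat ?n ?n (\<lambda>(i, j). if i = j then \<mu> i else 0)"
  have c[simp]: "A \<in> carrier_mat ?n ?n" "U \<in> carrier_mat ?n ?n" "D \<in> carrier_mat ?n ?n"
    by (auto simp: A_def U_def D_def)
  have UU: "transpose_mat U * U = 1\<^sub>m ?n"
  proof (rule eq_matI)
    fix i j assume "i < dim_row (1\<^sub>m ?n :: real mat)" "j < dim_col (1\<^sub>m ?n :: real mat)"
    then have ij: "i < ?n" "j < ?n" by auto
    then have "(transpose_mat U * U) $$ (i, j) = ip V (x i) (x j)"
      by (simp add: U_def scalar_prod_def ip_def tr atLeast0LessThan)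
    then show "(transpose_mat U * U) $$ (i, j) = 1\<^sub>m ?n $$ (i, j)"
      using E ij n by (simp add: eigenbasis_def orthonormal_def)
  qed (auto simp: U_def)
  have UU': "U * transpose_mat U = 1\<^sub>m ?n"
    by (rule mat_mult_left_right_inverse[OF _ _ UU]) auto
  have AU: "A * U = U * D"
  proof (rule eq_matI)
    fix i j assume "i < dim_row (U * D)" "j < dim_col (U * D)"
    then have ij: "i < ?n" "j < ?n" by (auto simp: U_def D_def)
    have "(A * U) $$ (i, j) = app V a (x j) (vs ! i)"
      using ij by (simp add: A_def U_def scalar_prod_def app_def tr atLeast0LessThan)
    also have "\<dots> = \<mu> j * x j (vs ! i)" using E ij n vs by (auto simp: eigenbasis_def)
    also have "\<dots> = (U * D) $$ (i, j)"
      using ij by (simp add: D_def U_def scalar_prod_def if_distrib[of "\<lambda>t. _ * t"] cong: if_cong)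
    finally show "(A * U) $$ (i, j) = (U * D) $$ (i, j)" .
  qed (auto simp: A_def U_def D_def)
  have "A = A * (U * transpose_mat U)" unfolding UU' by (rule right_mult_one_mat[symmetric, OF c(1)])
  also have "\<dots> = U * D * transpose_mat U"
    unfolding AU[symmetric] by (rule assoc_mult_mat[symmetric, of _ ?n ?n _ ?n _ ?n]) auto
  finally have AUD: "A = U * D * transpose_mat U" .
  have "similar_mat A D"
    by (rule similar_matI[OF _ UU' UU AUD]) (simp add: c)
  then have "char_poly A = char_poly D" by (rule char_poly_similar)
  also have "\<dots> = (\<Prod>e\<leftarrow>diag_mat D. [:- e, 1:])"
    by (rule char_poly_upper_triangular[of _ ?n]) (auto simp: D_def)
  also have "diag_mat D = map \<mu> [0..<?n]" by (auto simp: diag_mat_def D_def intro: nth_equalityI)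
  also have "proots (\<Prod>e\<leftarrow>map \<mu> [0..<?n]. [:- e, 1:]) = mset (map \<mu> [0..<?n])"
  proof -
    have "proots (\<Prod>e\<leftarrow>xs. [:- e, 1:]) = mset xs" for xs :: "real list"
    proof (induction xs)
      case (Cons e xs)
      have "(\<Prod>e\<leftarrow>xs. [:- e, 1:]) \<noteq> (0 :: real poly)" by (auto simp: prod_list_zero_iff)
      then show ?case using Cons by (simp add: proots_mult del: mult_pCons_left)
    qed simp
    then show ?thesis .
  qed
  finally show ?thesis by (simp add: n A_def)
qed

lemma rev_sorted_list_of_antimono:
  fixes \<mu> :: "nat \<Rightarrow> real"
  assumes "\<And>i j. i \<le> j \<Longrightarrow> j < n \<Longrightarrow> \<mu> j \<le> \<mu> i"
  shows "rev (sorted_list_of_multiset (mset (map \<mu> [0..<n]))) = map \<mu> [0..<n]"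
proof -
  have "sorted (rev (map \<mu> [0..<n]))"
    unfolding sorted_rev_iff_nth_mono using assms by auto
  then have "sort (map \<mu> [0..<n]) = rev (map \<mu> [0..<n])"
    by (intro properties_for_sort) auto
  then show ?thesis by (simp only: sorted_list_of_multiset_mset rev_rev_ident)
qed

section \<open>Laplacians and projections\<close>

definition lapl :: "('a \<times> 'a) set \<Rightarrow> 'a \<Rightarrow> 'a \<Rightarrow> real" where
  "lapl E u v = (if u = v then real (card (E `` {u})) else if (u, v) \<in> E then - 1 else 0)"

lemma laplacian_sum_eigenbasis:
  assumes G: "pair_graph G" and k: "k \<le> card (pverts G)"
    and E: "eigenbasis (pverts G) (lapl (parcs G)) x \<mu>"
  shows "laplacian_sum k G = (\<Sum>i<k. \<mu> i)"
proof -
  interpret pair_graph G by (rule G)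
  let ?vs = "vertex_list G"
  have vs: "distinct ?vs" "set ?vs = pverts G" using vertex_list[OF pair_finite_verts] by auto
  have "out_degree (with_proj G) u = card (parcs G `` {u})" for u
  proof -
    have "parcs G `` {u} = snd ` out_arcs (with_proj G) u"
      by (force simp: out_arcs_def image_iff)
    moreover have "inj_on snd (out_arcs (with_proj G) u)"
      by (auto simp: inj_on_def out_arcs_def prod_eq_iff)
    ultimately show ?thesis by (simp add: out_degree_def card_image)
  qed
  then have "laplacian_mat G ?vs
      = mat (length ?vs) (length ?vs) (\<lambda>(i, j). lapl (parcs G) (?vs ! i) (?vs ! j))"
    unfolding laplacian_mat_def degree_mat_def adjacency_mat_def using vs(1) no_loops'
    by (intro eq_matI) (auto simp: lapl_def nth_eq_iff_index_eq)
  then have "proots (char_poly (laplacian_mat G ?vs)) = mset (map \<mu> [0..<card (pverts G)])"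
    using proots_char_poly_eigenbasis[OF vs E] by simp
  moreover have "\<And>i j. i \<le> j \<Longrightarrow> j < card (pverts G) \<Longrightarrow> \<mu> j \<le> \<mu> i"
    using E by (auto simp: eigenbasis_def)
  ultimately have "laplacian_spectrum G = map \<mu> [0..<card (pverts G)]"
    unfolding laplacian_spectrum_def by (simp only: rev_sorted_list_of_antimono)
  then have "laplacian_eigenvalue G (Suc i) = \<mu> i" if "i < k" for i
    using that k by (simp add: laplacian_eigenvalue_def)
  moreover have "laplacian_sum k G = (\<Sum>i<k. laplacian_eigenvalue G (Suc i))"
    unfolding laplacian_sum_def by (simp add: sum.atLeast1_atMost_eq)
  ultimately show ?thesis by simp
qed

text \<open>
  In the sequel \<open>E\<close> contains both orientations of every edge, so \<open>card E\<close> is twice the number of edges.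
\<close>

definition conn :: "'a set \<Rightarrow> ('a \<times> 'a) set \<Rightarrow> bool" where
  "conn V E \<longleftrightarrow> (\<forall>S\<subseteq>V. S \<noteq> {} \<longrightarrow> S \<noteq> V \<longrightarrow> (\<exists>u\<in>S. \<exists>v\<in>V - S. (u, v) \<in> E))"

lemma conn_closed:
  assumes "conn V E" "w \<in> V" "P w" "\<And>u v. u \<in> V \<Longrightarrow> v \<in> V \<Longrightarrow> (u, v) \<in> E \<Longrightarrow> P u \<Longrightarrow> P v" "v \<in> V"
  shows "P v"
proof (rule ccontr)
  assume "\<not> P v"
  let ?S = "{v \<in> V. P v}"
  have "?S \<subseteq> V" "?S \<noteq> {}" "?S \<noteq> V" using assms \<open>\<not> P v\<close> by auto
  then obtain a b where "a \<in> ?S" "b \<in> V - ?S" "(a, b) \<in> E"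
    using assms(1) unfolding conn_def by meson
  then show False using assms(4) by auto
qed

definition excess :: "('a \<times> 'a) set \<Rightarrow> ('a \<Rightarrow> 'a \<Rightarrow> real) \<Rightarrow> real" where
  "excess E c = (\<Sum>(u, v)\<in>E. c u u + c v v - 1 - 2 * c u v) / 2"

definition gram :: "nat \<Rightarrow> (nat \<Rightarrow> 'a \<Rightarrow> real) \<Rightarrow> 'a \<Rightarrow> 'a \<Rightarrow> real" where
  "gram k x u v = (\<Sum>i<k. x i u * x i v)"

text \<open>Only these properties of the Gram matrix enter the estimates, and they hold for every
  orthonormal family; so vectors belonging to one graph can be used in another.\<close>

locale projection =
  fixes V :: "'a set" and k :: nat and c :: "'a \<Rightarrow> 'a \<Rightarrow> real"
  assumes finV: "finite V"
    and c_sym: "c u v = c v u"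
    and c_idem: "u \<in> V \<Longrightarrow> w \<in> V \<Longrightarrow> (\<Sum>v\<in>V. c u v * c v w) = c u w"
    and c_trace: "(\<Sum>v\<in>V. c v v) = real k"
begin

lemma c_row: "u \<in> V \<Longrightarrow> (\<Sum>v\<in>V. (c u v)\<^sup>2) = c u u"
  unfolding c_idem[of u u, symmetric] power2_eq_square
  by (intro sum.cong refl arg_cong2[where f = times] c_sym)

lemma c_diag_nonneg: "u \<in> V \<Longrightarrow> 0 \<le> c u u"
  using c_row[of u] sum_nonneg[of V "\<lambda>v. (c u v)\<^sup>2"] by simp

lemma c_row_subset:
  assumes "u \<in> V" "S \<subseteq> V" "u \<notin> S"
  shows "(\<Sum>v\<in>S. (c u v)\<^sup>2) \<le> c u u * (1 - c u u)"
proof -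
  have "(\<Sum>v\<in>insert u S. (c u v)\<^sup>2) \<le> (\<Sum>v\<in>V. (c u v)\<^sup>2)"
    using assms finV by (intro sum_mono2) auto
  then have "(c u u)\<^sup>2 + (\<Sum>v\<in>S. (c u v)\<^sup>2) \<le> c u u"
    using assms finite_subset[OF assms(2) finV] by (simp add: c_row)
  then show ?thesis by (simp add: power2_eq_square algebra_simps)
qed

lemma c_diag_le_1:
  assumes "u \<in> V"
  shows "c u u \<le> 1"
proof (rule ccontr)
  assume "\<not> c u u \<le> 1"
  then have "c u u * (1 - c u u) < 0" by (intro mult_pos_neg) auto
  then show False using c_row_subset[OF assms, of "{}"] by simp
qed

text \<open>The expression is the squared length of the projection of e_u + t e_v, where e_u is the
  unit vector at \<open>u\<close>.\<close>

lemma c_polar: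
  assumes "u \<in> V" "v \<in> V"
  shows "0 \<le> c u u + t\<^sup>2 * c v v + 2 * t * c u v"
proof -
  have "(\<Sum>w\<in>V. (c u w + t * c v w)\<^sup>2)
    = (\<Sum>w\<in>V. (c u w)\<^sup>2) + t\<^sup>2 * (\<Sum>w\<in>V. (c v w)\<^sup>2) + 2 * t * (\<Sum>w\<in>V. c u w * c w v)"
    by (simp add: power2_sum power_mult_distrib sum.distrib sum_distrib_left c_sym[of _ v] algebra_simps)
  also have "\<dots> = c u u + t\<^sup>2 * c v v + 2 * t * c u v"
    using assms by (simp add: c_row c_idem)
  finally show ?thesis using sum_nonneg[of V "\<lambda>w. (c u w + t * c v w)\<^sup>2"] by simp
qed

lemma c_ge: "u \<in> V \<Longrightarrow> v \<in> V \<Longrightarrow> - 2 * c u v \<le> c u u + c v v"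
  using c_polar[of u v 1] by simp

lemma c_cauchy:
  assumes "u \<in> V" "v \<in> V"
  shows "(c u v)\<^sup>2 \<le> c u u * c v v"
proof (cases "c v v = 0")
  case True
  have "(c v u)\<^sup>2 \<le> (\<Sum>w\<in>V. (c v w)\<^sup>2)" using assms finV by (intro member_le_sum) auto
  then show ?thesis using assms True by (simp add: c_row c_sym[of u v])
next
  case False
  then have pos: "0 < c v v" using c_diag_nonneg[OF assms(2)] by simp
  have "0 \<le> c v v * (c u u + (- c u v / c v v)\<^sup>2 * c v v + 2 * (- c u v / c v v) * c u v)"
    by (intro mult_nonneg_nonneg c_polar assms) (use pos in simp)
  also have "\<dots> = c u u * c v v - (c u v)\<^sup>2" using pos by (simp add: field_simps power2_eq_square)
  finally show ?thesis by simp
qed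

lemma c_eq_0: "u \<in> V \<Longrightarrow> v \<in> V \<Longrightarrow> c v v = 0 \<Longrightarrow> c u v = 0"
  using c_cauchy[of u v] by simp

lemma sum_diag_le: "S \<subseteq> V \<Longrightarrow> (\<Sum>v\<in>S. c v v) \<le> real k"
  using sum_mono2[OF finV, of S "\<lambda>v. c v v"] c_diag_nonneg c_trace by auto

end

lemma projection_gram:
  assumes V: "finite V" and x: "orthonormal V k x"
  shows "projection V k (gram k x)"
proof
  show "finite V" by (rule V)
  show "gram k x u v = gram k x v u" for u v by (simp add: gram_def mult.commute)
  show "(\<Sum>v\<in>V. gram k x u v * gram k x v w) = gram k x u w" if "u \<in> V" "w \<in> V" for u w
  proof -
    have "(\<Sum>v\<in>V. gram k x u v * gram k x v w)
      = (\<Sum>v\<in>V. \<Sum>i<k. \<Sum>j<k. x i u * x i v * (x j v * x j w))"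
      by (simp add: gram_def sum_product)
    also have "\<dots> = (\<Sum>i<k. \<Sum>v\<in>V. \<Sum>j<k. x i u * x i v * (x j v * x j w))" by (rule sum.swap)
    also have "\<dots> = (\<Sum>i<k. \<Sum>j<k. \<Sum>v\<in>V. x i u * x i v * (x j v * x j w))"
      by (intro sum.cong refl sum.swap)
    also have "\<dots> = (\<Sum>i<k. \<Sum>j<k. x i u * x j w * ip V (x i) (x j))"
      by (simp add: ip_def sum_distrib_left algebra_simps)
    also have "\<dots> = (\<Sum>i<k. \<Sum>j<k. if j = i then x i u * x i w else 0)"
      using x by (intro sum.cong refl) (auto simp: orthonormal_def)
    also have "\<dots> = gram k x u w" by (simp add: gram_def)
    finally show ?thesis .
  qed
  have "(\<Sum>v\<in>V. gram k x v v) = (\<Sum>i<k. ip V (x i) (x i))"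
    unfolding gram_def ip_def by (rule sum.swap)
  then show "(\<Sum>v\<in>V. gram k x v v) = real k" using x by (simp add: orthonormal_def)
qed

section \<open>Graphs as symmetric arc sets and their quadratic form\<close>

locale sgraph =
  fixes V :: "'a set" and E :: "('a \<times> 'a) set"
  assumes finite_V: "finite V" and E_sub: "E \<subseteq> V \<times> V" and E_sym: "sym E" and E_irrefl: "irrefl E"
begin

abbreviation "N v \<equiv> E `` {v}"
abbreviation "deg v \<equiv> card (N v)"

lemma finite_E: "finite E" using finite_subset[OF E_sub] finite_V by simp
lemma N_sub: "N v \<subseteq> V" using E_sub by auto
lemma finite_N: "finite (N v)" using finite_subset[OF N_sub finite_V] .
lemma E_commute: "(u, v) \<in> E \<Longrightarrow> (v, u) \<in> E" using E_sym by (rule symD)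
lemma not_self: "(v, v) \<notin> E" using E_irrefl by (simp add: irrefl_def)
lemma E_in: "(u, v) \<in> E \<Longrightarrow> u \<in> V" "(u, v) \<in> E \<Longrightarrow> v \<in> V" using E_sub by auto

lemma sum_E: "(\<Sum>(u, v)\<in>E. f u v) = (\<Sum>u\<in>V. \<Sum>v\<in>N u. f u v)"
proof -
  have "E = Sigma V N" using E_sub by auto
  then show ?thesis using sum.Sigma[of V N f] finite_V finite_N by simp
qed

lemma sum_E_swap: "(\<Sum>(u, v)\<in>E. f u v) = (\<Sum>(u, v)\<in>E. f v u)"
  by (rule sum.reindex_bij_witness[of _ "\<lambda>(u, v). (v, u)" "\<lambda>(u, v). (v, u)"]) (auto intro: E_commute)

lemma card_E: "card E = (\<Sum>v\<in>V. deg v)"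
proof -
  have "real (card E) = (\<Sum>(u, v)\<in>E. 1)" by simp
  also have "\<dots> = real (\<Sum>v\<in>V. deg v)" unfolding sum_E by simp
  finally show ?thesis by (simp only: of_nat_eq_iff)
qed

lemma app_lapl:
  assumes "v \<in> V"
  shows "app V (lapl E) x v = (\<Sum>u\<in>N v. x v - x u)"
proof -
  have "app V (lapl E) x v = lapl E v v * x v + (\<Sum>u\<in>V - {v}. lapl E v u * x u)"
    unfolding app_def using assms finite_V by (rule sum.remove[rotated])
  also have "(\<Sum>u\<in>V - {v}. lapl E v u * x u) = (\<Sum>u\<in>N v. - x u)"
    using N_sub[of v] finite_V not_self by (intro sum.mono_neutral_cong_right) (auto simp: lapl_def)
  also have "lapl E v v = real (deg v)" by (simp add: lapl_def)
  finally show ?thesis by (simp add: sum_subtractf sum_negf)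
qed

lemma lapl_sym: "lapl E u v = lapl E v u"
  using E_commute by (auto simp: lapl_def)

lemma form_lapl: "ip V x (app V (lapl E) y) = (\<Sum>(u, v)\<in>E. (x u - x v) * (y u - y v)) / 2"
proof -
  have "ip V x (app V (lapl E) y) = (\<Sum>u\<in>V. \<Sum>v\<in>N u. x u * (y u - y v))"
    by (simp add: ip_def app_lapl sum_distrib_left)
  then have 1: "ip V x (app V (lapl E) y) = (\<Sum>(u, v)\<in>E. x u * (y u - y v))" by (simp add: sum_E)
  also have "\<dots> = (\<Sum>(u, v)\<in>E. x v * (y v - y u))" by (rule sum_E_swap)
  finally have "2 * ip V x (app V (lapl E) y) = (\<Sum>(u, v)\<in>E. x u * (y u - y v)) + (\<Sum>(u, v)\<in>E. x v * (y v - y u))"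
    using 1 by simp
  also have "\<dots> = (\<Sum>(u, v)\<in>E. (x u - x v) * (y u - y v))"
    by (simp add: sum.distrib[symmetric] split_def algebra_simps)
  finally show ?thesis by simp
qed

lemma energy: "ip V x (app V (lapl E) x) = (\<Sum>(u, v)\<in>E. (x u - x v)\<^sup>2) / 2"
  by (simp add: form_lapl power2_eq_square)

lemma energy_nonneg: "0 \<le> ip V x (app V (lapl E) x)"
  by (auto simp: energy intro!: sum_nonneg)

text \<open>Every edge contributes its term of \<open>excess\<close> plus 1, and the ones add up to
  the number of edges, \<open>card E / 2\<close>.\<close>

lemma sum_energy:
  "(\<Sum>i<k. ip V (x i) (app V (lapl E) (x i))) = excess E (gram k x) + real (card E) / 2"
proof -
  have "(\<Sum>i<k. ip V (x i) (app V (lapl E) (x i))) = (\<Sum>i<k. \<Sum>(u, v)\<in>E. (x i u - x i v)\<^sup>2) / 2"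
    by (simp add: energy sum_divide_distrib)
  also have "(\<Sum>i<k. \<Sum>(u, v)\<in>E. (x i u - x i v)\<^sup>2) = (\<Sum>p\<in>E. \<Sum>i<k. (x i (fst p) - x i (snd p))\<^sup>2)"
    unfolding split_def by (rule sum.swap)
  also have "\<dots> = (\<Sum>(u, v)\<in>E. (gram k x u u + gram k x v v - 1 - 2 * gram k x u v) + 1)"
    by (intro sum.cong refl)
      (simp add: split_def gram_def power2_eq_square algebra_simps sum.distrib sum_subtractf sum_distrib_left)
  also have "\<dots> = 2 * excess E (gram k x) + card E"
    by (simp only: split_def sum.distrib) (simp add: excess_def split_def)
  finally show ?thesis by simp
qed

lemma eigenbasis_exists_lapl: "\<exists>x \<mu>. eigenbasis V (lapl E) x \<mu>"
  by (rule eigenbasis_exists[OF finite_V]) (rule lapl_sym)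

end

locale spectrum = sgraph +
  fixes x :: "nat \<Rightarrow> 'a \<Rightarrow> real" and \<mu> :: "nat \<Rightarrow> real"
  assumes basis: "eigenbasis V (lapl E) x \<mu>"
begin

lemma x_ortho: "orthonormal V (card V) x" using basis by (simp add: eigenbasis_def)

lemma x_ip: "i < card V \<Longrightarrow> j < card V \<Longrightarrow> ip V (x i) (x j) = (if i = j then 1 else 0)"
  using x_ortho by (simp add: orthonormal_def)

lemma \<mu>_mono: "i \<le> j \<Longrightarrow> j < card V \<Longrightarrow> \<mu> j \<le> \<mu> i" using basis by (simp add: eigenbasis_def)

lemma eigen: "i < card V \<Longrightarrow> v \<in> V \<Longrightarrow> (\<Sum>u\<in>N v. x i v - x i u) = \<mu> i * x i v"
  using basis app_lapl[of v "x i"] by (simp add: eigenbasis_def)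

lemma \<mu>_energy: "i < card V \<Longrightarrow> \<mu> i = (\<Sum>(u, v)\<in>E. (x i u - x i v)\<^sup>2) / 2"
  using eigenbasis_value[OF basis] by (simp add: energy)

lemma \<mu>_nonneg: "i < card V \<Longrightarrow> 0 \<le> \<mu> i"
  using eigenbasis_value[OF basis, of i] energy_nonneg[of "x i"] by simp

text \<open>Ky Fan in terms of \<open>excess\<close>: a bound on the eigenvalues of this graph
  limits its excess at the eigenvectors of a different graph, which is how graphs are compared
  later.\<close>

lemma sum_\<mu>_ge:
  "orthonormal V k y \<Longrightarrow> excess E (gram k y) + real (card E) / 2 \<le> (\<Sum>i<k. \<mu> i)"
  using ky_fan[OF finite_V basis] by (simp add: sum_energy)

lemma sum_\<mu>:
  assumes "k \<le> card V"
  shows "(\<Sum>i<k. \<mu> i) = excess E (gram k x) + real (card E) / 2"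
proof -
  have "(\<Sum>i<k. \<mu> i) = (\<Sum>i<k. ip V (x i) (app V (lapl E) (x i)))"
    by (intro sum.cong refl) (use assms in \<open>simp add: eigenbasis_value[OF basis]\<close>)
  then show ?thesis by (simp add: sum_energy)
qed

text \<open>A vector of zero energy on a connected graph is constant. If \<mu> i vanished before the
  last index, then \<open>x i\<close> and the last eigenvector would both be constant, yet
  orthonormal.\<close>

lemma \<mu>_pos:
  assumes conn: "conn V E" and i: "Suc i < card V"
  shows "0 < \<mu> i"
proof (rule ccontr)
  assume "\<not> 0 < \<mu> i"
  let ?l = "card V - 1"
  have l: "?l < card V" "i < ?l" using i by auto
  have z: "\<mu> i = 0" "\<mu> ?l = 0"
    using \<open>\<not> 0 < \<mu> i\<close> \<mu>_mono[of i ?l] \<mu>_nonneg[of i] \<mu>_nonneg[of ?l] l i by auto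
  obtain w where w: "w \<in> V" using i by fastforce
  have const: "x j v = x j w" if j: "j < card V" "\<mu> j = 0" and v: "v \<in> V" for j v
  proof -
    have "(\<Sum>p\<in>E. (x j (fst p) - x j (snd p))\<^sup>2) = 0" using \<mu>_energy[OF j(1)] j(2) by (simp add: split_def)
    then have "\<forall>p\<in>E. x j (fst p) = x j (snd p)"
      using finite_E by (subst (asm) sum_nonneg_eq_0_iff) auto
    then show ?thesis
      using conn_closed[OF conn w, of "\<lambda>v. x j v = x j w" v] v by fastforce
  qed
  have ip: "ip V (x j) (x j') = card V * (x j w * x j' w)" if "j \<in> {i, ?l}" "j' \<in> {i, ?l}" for j j'
  proof -
    have "ip V (x j) (x j') = (\<Sum>v\<in>V. x j w * x j' w)"
      unfolding ip_def using const[of j] const[of j'] that z l i by (intro sum.cong refl) auto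
    then show ?thesis by simp
  qed
  have "card V * (x i w * x i w) = 1" "card V * (x ?l w * x ?l w) = 1" "card V * (x i w * x ?l w) = 0"
    using ip[of i i] ip[of ?l ?l] ip[of i ?l] x_ip[of i i] x_ip[of ?l ?l] x_ip[of i ?l] l i by simp_all
  then show False by (metis mult_eq_0_iff zero_neq_one)
qed

lemma x_sum_0:
  assumes "i < card V" "0 < \<mu> i"
  shows "(\<Sum>v\<in>V. x i v) = 0"
proof -
  have "\<mu> i * (\<Sum>v\<in>V. x i v) = (\<Sum>v\<in>V. \<Sum>u\<in>N v. x i v - x i u)"
    by (simp add: sum_distrib_left eigen[OF assms(1)])
  also have "\<dots> = (\<Sum>(v, u)\<in>E. x i v - x i u)" by (rule sum_E[symmetric])
  also have "\<dots> = (\<Sum>(v, u)\<in>E. x i v) - (\<Sum>(v, u)\<in>E. x i u)"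
    by (simp add: split_def sum_subtractf)
  also have "\<dots> = 0" using sum_E_swap[of "\<lambda>v u. x i v"] by simp
  finally show ?thesis using assms by simp
qed

text \<open>The rows of the Gram matrix sum to 0, because the eigenvectors are orthogonal to the
  constants; but a diagonal entry 1 uses up the row and forces all other entries to be 0.\<close>

lemma gram_diag_less_1:
  assumes k: "k \<le> card V" and pos: "\<And>i. i < k \<Longrightarrow> 0 < \<mu> i" and u: "u \<in> V"
  shows "gram k x u u < 1"
proof -
  interpret P: projection V k "gram k x"
    by (rule projection_gram[OF finite_V orthonormal_subset[OF x_ortho k]])
  have 0: "(\<Sum>v\<in>V. gram k x u v) = 0"
    unfolding gram_def by (subst sum.swap) (use x_sum_0 pos k in \<open>simp add: sum_distrib_left[symmetric]\<close>)
  show ?thesis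
  proof (rule ccontr)
    assume "\<not> ?thesis"
    then have 1: "gram k x u u = 1" using P.c_diag_le_1[OF u] by simp
    have "gram k x u v = 0" if "v \<in> V" "v \<noteq> u" for v
      using P.c_row_subset[of u "{v}"] that u 1 by simp
    then have "(\<Sum>v\<in>V. gram k x u v) = (\<Sum>v\<in>V. if v = u then 1 else 0)"
      using 1 by (intro sum.cong refl) auto
    then show False using 0 u finite_V by simp
  qed
qed

end

section \<open>Bounds from the eigenvalue equations\<close>

context spectrum
begin

text \<open>The differences \<open>x i v - x i u\<close> over the neighbours have mean
  \<open>\<mu> i * x i v / deg v\<close> by the eigenvalue equation, so this is the variance
  formula. The gap in Cauchy-Schwarz is kept since strictness depends on it.\<close>

lemma incidence_bound_gap:
  assumes i: "i < card V" and pos: "0 < \<mu> i" and v: "v \<in> V" and d: "0 < deg v"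
  shows "(\<Sum>u\<in>N v. (x i v - x i u)\<^sup>2) / \<mu> i - \<mu> i * (x i v)\<^sup>2 / deg v
    = (\<Sum>u\<in>N v. (x i v - x i u - \<mu> i * x i v / deg v)\<^sup>2) / \<mu> i"
proof -
  let ?m = "\<mu> i * x i v / deg v"
  have "(\<Sum>u\<in>N v. (x i v - x i u - ?m)\<^sup>2)
    = (\<Sum>u\<in>N v. (x i v - x i u)\<^sup>2 + (?m)\<^sup>2 - 2 * ?m * (x i v - x i u))"
    by (intro sum.cong refl) (simp add: power2_diff)
  also have "\<dots> = (\<Sum>u\<in>N v. (x i v - x i u)\<^sup>2) + deg v * ?m\<^sup>2 - 2 * ?m * (\<Sum>u\<in>N v. x i v - x i u)"
    by (simp only: sum.distrib sum_subtractf[of "\<lambda>u. _ u + _"] sum_distrib_left[symmetric] sum_constant)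
  also have "(\<Sum>u\<in>N v. x i v - x i u) = \<mu> i * x i v" by (rule eigen[OF i v])
  finally have "(\<Sum>u\<in>N v. (x i v - x i u - ?m)\<^sup>2)
    = (\<Sum>u\<in>N v. (x i v - x i u)\<^sup>2) + deg v * ?m\<^sup>2 - 2 * ?m * (\<mu> i * x i v)" .
  moreover have "A / \<mu> i - \<mu> i * (x i v)\<^sup>2 / deg v = (A + deg v * ?m\<^sup>2 - 2 * ?m * (\<mu> i * x i v)) / \<mu> i" for A
    using pos d by (simp add: field_simps power2_eq_square)
  ultimately show ?thesis by simp
qed

text \<open>Taken over all \<open>i < card V\<close>, the sum is the diagonal entry of the Laplacian
  at \<open>v\<close>.\<close>

lemma weighted_diag_le_deg:
  assumes k: "k \<le> card V" and v: "v \<in> V"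
  shows "(\<Sum>i<k. \<mu> i * (x i v)\<^sup>2) \<le> deg v"
proof -
  let ?e = "\<lambda>u. if u = v then 1 else 0 :: real"
  have "(\<Sum>i<k. \<mu> i * (x i v)\<^sup>2) \<le> (\<Sum>i<card V. \<mu> i * (x i v)\<^sup>2)"
    using k \<mu>_nonneg by (intro sum_mono2) auto
  also have "\<dots> = ip V ?e (app V (lapl E) ?e)"
    by (simp only: eigenbasis_form[OF finite_V basis] ip_point[OF finite_V v])
  also have "\<dots> = app V (lapl E) ?e v"
    unfolding ip_commute[of V ?e] by (rule ip_point[OF finite_V v])
  also have "\<dots> = (\<Sum>u\<in>N v. 1)"
    unfolding app_lapl[OF v] using not_self by (intro sum.cong refl) auto
  finally show ?thesis by simp
qed

text \<open>
  With \<open>q v = (\<Sum>i<k. \<mu> i * (x i v)\<^sup>2)\<close> one has \<open>q v \<le> deg v\<close> and, by Cauchy-Schwarz in the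
  eigenvalue equation at \<open>v\<close>, \<open>q v \<le> deg v * p v\<close> where \<open>p\<close> sums to at most \<open>2 * k\<close>.
\<close>

lemma sum_\<mu>_le_incidence:
  assumes k: "k \<le> card V" and pos: "\<And>i. i < k \<Longrightarrow> 0 < \<mu> i" and d: "\<And>v. v \<in> V \<Longrightarrow> 0 < deg v"
  shows "(\<Sum>i<k. \<mu> i) + (\<Sum>v\<in>V. \<Sum>i<k. (\<Sum>u\<in>N v. (x i v - x i u - \<mu> i * x i v / deg v)\<^sup>2) / \<mu> i)
    \<le> 2 * real k + real (card E) - real (card V)"
proof -
  let ?q = "\<lambda>v. \<Sum>i<k. \<mu> i * (x i v)\<^sup>2"
  let ?p = "\<lambda>v. \<Sum>i<k. (\<Sum>u\<in>N v. (x i v - x i u)\<^sup>2) / \<mu> i"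
  let ?g = "\<lambda>v. \<Sum>i<k. (\<Sum>u\<in>N v. (x i v - x i u - \<mu> i * x i v / deg v)\<^sup>2) / \<mu> i"
  have ic: "i < card V" if "i < k" for i using that k by simp
  \<comment> \<open>Both bounds on \<open>?q v\<close> are used: the fraction
    \<open>1 / deg v\<close> of it equals \<open>?p v - ?g v\<close>, and the rest is at most
    \<open>deg v - 1\<close>.\<close>
  have "?q v \<le> real (deg v) - 1 + ?p v - ?g v" if v: "v \<in> V" for v
  proof -
    have "?p v - ?q v / deg v = ?g v"
      unfolding sum_divide_distrib[of "\<lambda>i. \<mu> i * (x i v)\<^sup>2" "{..<k}"] sum_subtractf[symmetric]
      by (intro sum.cong refl incidence_bound_gap) (use ic pos v d in auto)
    moreover have "?q v * (1 - 1 / deg v) \<le> deg v * (1 - 1 / deg v)"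
      using weighted_diag_le_deg[OF k v] d[OF v] by (intro mult_right_mono) (auto simp: field_simps)
    moreover have "deg v * (1 - 1 / real (deg v)) = real (deg v) - 1" using d[OF v] by (simp add: field_simps)
    ultimately show ?thesis by (simp add: algebra_simps)
  qed
  then have "(\<Sum>v\<in>V. ?q v) \<le> (\<Sum>v\<in>V. real (deg v) - 1 + ?p v - ?g v)" by (rule sum_mono)
  also have "\<dots> = (\<Sum>v\<in>V. real (deg v)) - card V + (\<Sum>v\<in>V. ?p v) - (\<Sum>v\<in>V. ?g v)"
    by (simp add: sum.distrib sum_subtractf)
  also have "(\<Sum>v\<in>V. real (deg v)) = card E" by (simp add: card_E)
  also have "(\<Sum>v\<in>V. ?q v) = (\<Sum>i<k. \<mu> i * ip V (x i) (x i))"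
    by (subst sum.swap) (simp add: ip_def sum_distrib_left power2_eq_square)
  also have "\<dots> = (\<Sum>i<k. \<mu> i)" using x_ip ic by simp
  also have "(\<Sum>v\<in>V. ?p v) = (\<Sum>i<k. (\<Sum>(v, u)\<in>E. (x i v - x i u)\<^sup>2) / \<mu> i)"
    by (subst sum.swap) (simp add: sum_E sum_divide_distrib)
  also have "\<dots> = (\<Sum>i<k. 2)"
    by (intro sum.cong refl) (use \<mu>_energy ic pos in \<open>force simp: field_simps\<close>)
  finally show ?thesis by simp
qed

lemma excess_le_incidence:
  assumes k: "k \<le> card V" and pos: "\<And>i. i < k \<Longrightarrow> 0 < \<mu> i" and d: "\<And>v. v \<in> V \<Longrightarrow> 0 < deg v"
  shows "(\<Sum>i<k. \<mu> i) \<le> 2 * real k + real (card E) - real (card V)"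
proof -
  have "0 \<le> (\<Sum>v\<in>V. \<Sum>i<k. (\<Sum>u\<in>N v. (x i v - x i u - \<mu> i * x i v / deg v)\<^sup>2) / \<mu> i)"
    using pos by (intro sum_nonneg divide_nonneg_pos) auto
  then show ?thesis using sum_\<mu>_le_incidence[OF assms] by simp
qed

lemma deg_pos:
  assumes "conn V E" "2 \<le> card V" "v \<in> V"
  shows "0 < deg v"
proof -
  have "{v} \<noteq> V" using assms(2) by auto
  then obtain u where "(v, u) \<in> E" using assms unfolding conn_def by (metis empty_subsetI insert_subset insert_not_empty singletonD)
  then show ?thesis using finite_N[of v] by (auto simp: card_gt_0_iff)
qed

text \<open>In the case of equality all gaps vanish, so \<open>x i v - x i u\<close> is the same for
  all neighbours \<open>u\<close> of \<open>v\<close>. Comparing both ends of an edge,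
  \<open>x i v / deg v\<close> changes its sign along every edge; then \<open>x 0\<close> and
  \<open>x 1\<close> are parallel, which contradicts their orthogonality.\<close>

lemma incidence_bound_strict:
  assumes conn: "conn V E" and k: "2 \<le> k" "k < card V"
  shows "(\<Sum>i<k. \<mu> i) < 2 * real k + real (card E) - real (card V)"
proof -
  have pos: "0 < \<mu> i" if "i < k" for i using \<mu>_pos[OF conn] that k by simp
  have d: "0 < deg v" if "v \<in> V" for v using deg_pos[OF conn _ that] k by simp
  have k': "k \<le> card V" using k by simp
  let ?g = "\<lambda>v i. (\<Sum>u\<in>N v. (x i v - x i u - \<mu> i * x i v / deg v)\<^sup>2) / \<mu> i"
  have g0: "0 \<le> ?g v i" if "i < k" for v i
    using pos[OF that] by (intro divide_nonneg_pos sum_nonneg) auto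
  have "0 < (\<Sum>v\<in>V. \<Sum>i<k. ?g v i)"
  proof (rule ccontr)
    assume "\<not> ?thesis"
    moreover have "0 \<le> (\<Sum>v\<in>V. \<Sum>i<k. ?g v i)" using g0 by (intro sum_nonneg) auto
    ultimately have "(\<Sum>v\<in>V. \<Sum>i<k. ?g v i) = 0" by linarith
    then have "\<forall>v\<in>V. (\<Sum>i<k. ?g v i) = 0"
      using finite_V g0 by (subst (asm) sum_nonneg_eq_0_iff) (auto intro!: sum_nonneg)
    then have gz: "?g v i = 0" if "v \<in> V" "i < k" for v i
      using that g0 by (subst (asm) sum_nonneg_eq_0_iff) auto
    have st: "x i v - x i u = \<mu> i * x i v / deg v" if "(v, u) \<in> E" "i < k" for u v i
    proof -
      have "(\<Sum>u\<in>N v. (x i v - x i u - \<mu> i * x i v / deg v)\<^sup>2) = 0"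
        using gz[of v i] E_in(1)[OF that(1)] that(2) pos[of i] by simp
      then show ?thesis using that(1) finite_N by (subst (asm) sum_nonneg_eq_0_iff) auto
    qed
    have flip: "x i u / deg u = - (x i v / deg v)" if "(v, u) \<in> E" "i < k" for u v i
    proof -
      have "\<mu> i * (x i u / deg u) = \<mu> i * - (x i v / deg v)"
        using st[OF that] st[OF E_commute[OF that(1)] that(2)] by simp
      then show ?thesis using pos[OF that(2)] by (simp only: mult_cancel_left) auto
    qed
    obtain w where w: "w \<in> V" using k by fastforce
    let ?y = "\<lambda>i v. x i v / deg v"
    \<comment> \<open>The sign depends on the vertex but not on \<open>i\<close>, so it cancels in
      the product \<open>x 0 v * x 1 v\<close>.\<close>
    have "\<exists>s\<in>{1, - 1}. \<forall>i<k. ?y i v = s * ?y i w" if v: "v \<in> V" for v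
    proof (rule conn_closed[OF conn w _ _ v])
      show "\<exists>s\<in>{1, - 1}. \<forall>i<k. ?y i w = s * ?y i w" by auto
      fix u v assume "(u, v) \<in> E" "\<exists>s\<in>{1, - 1}. \<forall>i<k. ?y i u = s * ?y i w"
      then show "\<exists>s\<in>{1, - 1}. \<forall>i<k. ?y i v = s * ?y i w"
        using flip[of u v] by fastforce
    qed
    then have par: "\<exists>s\<in>{1, - 1::real}. x 0 v = deg v * (s * ?y 0 w) \<and> x 1 v = deg v * (s * ?y 1 w)"
      if v: "v \<in> V" for v
      using d[OF v] k that by (fastforce simp: field_simps)
    have "ip V (x 0) (x 1) = (\<Sum>v\<in>V. real ((deg v)\<^sup>2) * (?y 0 w * ?y 1 w))"
      unfolding ip_def using par by (intro sum.cong refl) (force simp: power2_eq_square)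
    also have "\<dots> = (\<Sum>v\<in>V. real ((deg v)\<^sup>2)) * (?y 0 w * ?y 1 w)" by (rule sum_distrib_right[symmetric])
    finally have "(\<Sum>v\<in>V. real ((deg v)\<^sup>2)) * (?y 0 w * ?y 1 w) = 0" using x_ip[of 0 1] k by simp
    moreover have "0 < (\<Sum>v\<in>V. real ((deg v)\<^sup>2))"
      using d finite_V w by (intro sum_pos) auto
    ultimately obtain j where j: "j \<in> {0, 1}" "?y j w = 0" by auto
    then have "x j v = 0" if "v \<in> V" for v using par[OF that] by auto
    then have "ip V (x j) (x j) = 0" by (simp add: ip_def)
    then show False using x_ip[of j j] j k by auto
  qed
  then show ?thesis using sum_\<mu>_le_incidence[OF k' pos d] by simp
qed

section \<open>The largest eigenvalue and stars\<close>

text \<open>Comparison with the complete graph: for a unit vector with entry sum 0 the squared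
  differences over all ordered pairs add up to \<open>2 * card V\<close>, and the pairs outside
  \<open>E\<close> make up the deficit.\<close>

lemma largest_eigenvalue:
  assumes V: "V \<noteq> {}" and pos: "0 < \<mu> 0"
  shows "\<mu> 0 \<le> card V"
    and "\<mu> 0 = card V \<Longrightarrow> u \<in> V \<Longrightarrow> v \<in> V \<Longrightarrow> (u, v) \<notin> E \<Longrightarrow> x 0 u = x 0 v"
proof -
  have n: "0 < card V" using V finite_V by (simp add: card_gt_0_iff)
  let ?f = "\<lambda>p. (x 0 (fst p) - x 0 (snd p))\<^sup>2"
  have s0: "(\<Sum>v\<in>V. x 0 v) = 0" using x_sum_0[OF n pos] .
  have s1: "(\<Sum>v\<in>V. (x 0 v)\<^sup>2) = 1" using x_ip[OF n n] by (simp add: ip_def power2_eq_square)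
  have "(\<Sum>p\<in>V \<times> V. ?f p) = (\<Sum>u\<in>V. \<Sum>v\<in>V. (x 0 u)\<^sup>2 + (x 0 v)\<^sup>2 - 2 * x 0 u * x 0 v)"
    by (simp add: sum.cartesian_product split_def power2_diff)
  also have "\<dots> = 2 * card V"
    by (simp add: sum.distrib sum_subtractf s1 sum_distrib_left[symmetric] s0)
  finally have all: "(\<Sum>p\<in>V \<times> V. ?f p) = 2 * card V" .
  have "(\<Sum>p\<in>V \<times> V. ?f p) = (\<Sum>p\<in>V \<times> V - E. ?f p) + (\<Sum>p\<in>E. ?f p)"
    using finite_V E_sub by (intro sum.subset_diff) auto
  then have eq: "2 * \<mu> 0 + (\<Sum>p\<in>V \<times> V - E. ?f p) = 2 * card V"
    using all \<mu>_energy[OF n] by (simp add: split_def)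
  moreover have "0 \<le> (\<Sum>p\<in>V \<times> V - E. ?f p)" by (intro sum_nonneg) auto
  ultimately show "\<mu> 0 \<le> card V" by simp
  assume "\<mu> 0 = card V" and uv: "u \<in> V" "v \<in> V" "(u, v) \<notin> E"
  then have "(\<Sum>p\<in>V \<times> V - E. ?f p) = 0" using eq by simp
  then have "\<forall>p\<in>V \<times> V - E. ?f p = 0" using finite_V by (subst (asm) sum_nonneg_eq_0_iff) auto
  then have "?f (u, v) = 0" using uv by blast
  then show "x 0 u = x 0 v" by simp
qed

text \<open>Vertices with different values of \<open>x 0\<close> are adjacent, so a level set of
  size p and its complement of size q span a complete bipartite graph. Its p q edges are at most the
  p + q - 1 edges of the tree, hence p = 1 or q = 1 and there are no further edges.\<close>

lemma tree_star:
  assumes conn: "conn V E" and n: "2 \<le> card V" and e: "card E = 2 * (card V - 1)" and m: "\<mu> 0 = card V"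
  shows "\<exists>z\<in>V. E = {z} \<times> (V - {z}) \<union> (V - {z}) \<times> {z}"
proof -
  have pos: "0 < \<mu> 0" using m n by simp
  have V: "V \<noteq> {}" using n by auto
  obtain a where a: "a \<in> V" using V by auto
  define A where "A = {v \<in> V. x 0 v = x 0 a}"
  have A: "A \<subseteq> V" "a \<in> A" "finite A" using a finite_V by (auto simp: A_def)
  have "A \<noteq> V"
  proof
    assume "A = V"
    then have c: "x 0 v = x 0 a" if "v \<in> V" for v using that by (auto simp: A_def)
    have "(\<Sum>v\<in>V. x 0 v) = card V * x 0 a" using c by simp
    then have "x 0 a = 0" using x_sum_0[of 0] pos n by simp
    then show False using x_ip[of 0 0] n c by (simp add: ip_def)
  qed
  then have ne: "V - A \<noteq> {}" using A by auto
  have sub: "A \<times> (V - A) \<union> (V - A) \<times> A \<subseteq> E"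
    using largest_eigenvalue(2)[OF V pos m] by (fastforce simp: A_def)
  let ?p = "card A" and ?q = "card (V - A)"
  have pq: "?p + ?q = card V" using A finite_V by (simp add: card_Diff_subset card_mono)
  have p0: "0 < ?p" "0 < ?q" using A ne finite_V by (auto simp: card_gt_0_iff)
  have cardU: "card (A \<times> (V - A) \<union> (V - A) \<times> A) = 2 * (?p * ?q)"
    using A finite_V by (subst card_Un_disjoint) auto
  then have "2 * (?p * ?q) \<le> 2 * (card V - 1)" using card_mono[OF finite_E sub] e by simp
  then have le: "?p * ?q \<le> ?p + ?q - 1" using pq by simp
  have one: "?p = 1 \<or> ?q = 1"
  proof (rule ccontr)
    assume "\<not> ?thesis"
    then obtain a b where "?p = Suc (Suc a)" "?q = Suc (Suc b)" using p0
      by (metis One_nat_def gr0_conv_Suc not_gr_zero)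
    then show False using le by simp
  qed
  then have "2 * (?p * ?q) = card E" using e pq by auto
  then have E: "A \<times> (V - A) \<union> (V - A) \<times> A = E"
    using card_subset_eq[OF finite_E sub] cardU by simp
  from one show ?thesis
  proof
    assume "?p = 1"
    then obtain z where "A = {z}" by (auto simp: card_1_singleton_iff)
    then show ?thesis using E A by blast
  next
    assume "?q = 1"
    then obtain z where z: "V - A = {z}" by (auto simp: card_1_singleton_iff)
    then have "A = V - {z}" "z \<in> V" using A by auto
    then show ?thesis using E z by blast
  qed
qed

end

section \<open>Forests over a core\<close>

text \<open>\<open>par\<close> charges every edge outside the core to one of its ends, and
  \<open>par_asym\<close> keeps the two sets of forest arcs disjoint. \<open>c_lt\<close> makes
  \<open>1 / (1 - c u u)\<close> available as the weight of a centre.\<close>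

locale forest_over_core = sgraph V E + projection V k c
  for V :: "'a set" and E :: "('a \<times> 'a) set" and k :: nat and c :: "'a \<Rightarrow> 'a \<Rightarrow> real" +
  fixes K :: "'a set" and par :: "'a \<Rightarrow> 'a"
  assumes K_sub: "K \<subseteq> V"
    and par_in: "v \<in> V - K \<Longrightarrow> par v \<in> V"
    and par_neq: "v \<in> V - K \<Longrightarrow> par v \<noteq> v"
    and par_asym: "v \<in> V - K \<Longrightarrow> par v \<in> V - K \<Longrightarrow> par (par v) \<noteq> v"
    and E_eq: "E = (E \<inter> K \<times> K) \<union> (\<lambda>v. (v, par v)) ` (V - K) \<union> (\<lambda>v. (par v, v)) ` (V - K)"
    and c_lt: "v \<in> V \<Longrightarrow> c v v < 1"
begin

definition ch :: "'a \<Rightarrow> 'a set" where "ch u = {v \<in> V - K. par v = u}"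

abbreviation "g u v \<equiv> c u u + c v v - 1 - 2 * c u v"
abbreviation "r v \<equiv> c v v"
abbreviation "dl v \<equiv> 1 - c v v"
abbreviation "NK v \<equiv> E `` {v} \<inter> K"

lemma finite_K: "finite K" using finite_subset[OF K_sub finV] .
lemma ch_sub: "ch u \<subseteq> V - K" by (auto simp: ch_def)
lemma finite_ch: "finite (ch u)" using finV ch_sub by (meson finite_Diff finite_subset)
lemma dl_pos: "v \<in> V \<Longrightarrow> 0 < dl v" using c_lt by simp

lemma sum_children: "(\<Sum>u\<in>V. \<Sum>v\<in>ch u. f v) = (\<Sum>v\<in>V - K. f v)"
  unfolding ch_def using finV par_in by (intro sum.group) auto

lemma sum_arcs: "(\<Sum>p\<in>E. f p) = (\<Sum>p\<in>E \<inter> K \<times> K. f p) + (\<Sum>v\<in>V - K. f (v, par v)) + (\<Sum>v\<in>V - K. f (par v, v))"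
proof -
  let ?A = "E \<inter> K \<times> K" and ?B = "(\<lambda>v. (v, par v)) ` (V - K)" and ?C = "(\<lambda>v. (par v, v)) ` (V - K)"
  have fin: "finite ?A" "finite ?B" "finite ?C" using finite_E finV by auto
  have d1: "?A \<inter> ?B = {}" "(?A \<union> ?B) \<inter> ?C = {}" using par_asym par_neq by (auto, metis Diff_iff)
  have "(\<Sum>p\<in>E. f p) = (\<Sum>p\<in>?A \<union> ?B \<union> ?C. f p)" by (rule arg_cong[OF E_eq])
  also have "\<dots> = (\<Sum>p\<in>?A \<union> ?B. f p) + (\<Sum>p\<in>?C. f p)"
    by (rule sum.union_disjoint) (use fin d1 in auto)
  also have "(\<Sum>p\<in>?A \<union> ?B. f p) = (\<Sum>p\<in>?A. f p) + (\<Sum>p\<in>?B. f p)"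
    by (rule sum.union_disjoint) (use fin d1 in auto)
  also have "(\<Sum>p\<in>?B. f p) = (\<Sum>v\<in>V - K. f (v, par v))" by (subst sum.reindex) (auto simp: inj_on_def)
  also have "(\<Sum>p\<in>?C. f p) = (\<Sum>v\<in>V - K. f (par v, v))" by (subst sum.reindex) (auto simp: inj_on_def)
  finally show ?thesis .
qed

lemma sum_core: "(\<Sum>(u, v)\<in>E \<inter> K \<times> K. f u v) = (\<Sum>u\<in>K. \<Sum>v\<in>NK u. f u v)"
proof -
  have "E \<inter> K \<times> K = Sigma K NK" by auto
  then show ?thesis using sum.Sigma[of K NK f] finite_K by simp
qed

lemma sum_core_swap: "(\<Sum>(u, v)\<in>E \<inter> K \<times> K. f u v) = (\<Sum>(u, v)\<in>E \<inter> K \<times> K. f v u)"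
  by (rule sum.reindex_bij_witness[of _ "\<lambda>(u, v). (v, u)" "\<lambda>(u, v). (v, u)"]) (auto intro: E_commute)

lemma excess_split:
  "excess E c = (\<Sum>(u, v)\<in>E \<inter> K \<times> K. g u v) / 2 + (\<Sum>u\<in>V. \<Sum>v\<in>ch u. g u v)"
proof -
  have "(\<Sum>u\<in>V. \<Sum>v\<in>ch u. g u v) = (\<Sum>u\<in>V. \<Sum>v\<in>ch u. g (par v) v)"
    by (intro sum.cong refl) (auto simp: ch_def)
  also have "\<dots> = (\<Sum>v\<in>V - K. g (par v) v)" by (rule sum_children)
  finally have "(\<Sum>u\<in>V. \<Sum>v\<in>ch u. g u v) = (\<Sum>v\<in>V - K. g (par v) v)" .
  moreover have "(\<Sum>v\<in>V - K. g v (par v)) = (\<Sum>v\<in>V - K. g (par v) v)"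
  proof (intro sum.cong refl)
    show "g v (par v) = g (par v) v" for v using c_sym[of v "par v"] by simp
  qed
  ultimately show ?thesis
    unfolding excess_def sum_arcs by simp
qed

text \<open>The square of \<open>c u v + dl u\<close>, divided by \<open>dl u\<close>. With this
  choice the constant cancels \<open>c u u - 1\<close> in the edge term, and the whole row sum
  \<open>r u * dl u\<close> costs only \<open>r u\<close>.\<close>

lemma children_bound:
  assumes u: "u \<in> V"
  shows "(\<Sum>v\<in>ch u. g u v) \<le> (\<Sum>v\<in>ch u. r v) + (\<Sum>v\<in>ch u. (c u v)\<^sup>2) / dl u"
proof -
  have "g u v \<le> r v + (c u v)\<^sup>2 / dl u" for v
  proof -
    have "0 \<le> (c u v + dl u)\<^sup>2 / dl u" using dl_pos[OF u] by simp
    also have "\<dots> = (c u v)\<^sup>2 / dl u + 2 * c u v + dl u"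
      using dl_pos[OF u] by (simp add: power2_sum add_divide_distrib) (simp add: power2_eq_square)
    finally show ?thesis by simp
  qed
  then have "(\<Sum>v\<in>ch u. g u v) \<le> (\<Sum>v\<in>ch u. r v + (c u v)\<^sup>2 / dl u)" by (rule sum_mono)
  then show ?thesis by (simp add: sum.distrib sum_divide_distrib)
qed

lemma children_bound_row:
  assumes u: "u \<in> V"
  shows "(\<Sum>v\<in>ch u. g u v) \<le> (\<Sum>v\<in>ch u. r v) + (if ch u = {} then 0 else r u)"
proof (cases "ch u = {}")
  case False
  have "(\<Sum>v\<in>ch u. (c u v)\<^sup>2) \<le> r u * dl u"
    by (rule c_row_subset[OF u]) (use par_neq in \<open>auto simp: ch_def\<close>)
  then have "(\<Sum>v\<in>ch u. (c u v)\<^sup>2) / dl u \<le> r u"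
    using dl_pos[OF u] by (simp add: pos_divide_le_eq)
  then show ?thesis using children_bound[OF u] False by simp
qed simp

lemma children_bound_center:
  assumes u: "u \<in> K"
  shows "(\<Sum>v\<in>ch u. g u v) \<le> (\<Sum>v\<in>ch u. r v) + r u - (\<Sum>v\<in>NK u. (c u v)\<^sup>2) / dl u"
proof -
  have uV: "u \<in> V" using u K_sub by auto
  have "(\<Sum>v\<in>ch u. (c u v)\<^sup>2) + (\<Sum>v\<in>NK u. (c u v)\<^sup>2) = (\<Sum>v\<in>ch u \<union> NK u. (c u v)\<^sup>2)"
    by (rule sum.union_disjoint[symmetric]) (use finite_ch finite_K in \<open>auto simp: ch_def\<close>)
  also have "\<dots> \<le> r u * dl u"
    by (rule c_row_subset[OF uV]) (use par_neq u K_sub not_self in \<open>auto simp: ch_def\<close>)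
  finally have "((\<Sum>v\<in>ch u. (c u v)\<^sup>2) + (\<Sum>v\<in>NK u. (c u v)\<^sup>2)) / dl u \<le> r u"
    using dl_pos[OF uV] by (simp add: pos_divide_le_eq)
  then show ?thesis using children_bound[OF uV] by (simp add: add_divide_distrib)
qed

text \<open>For a parent that does not act as a centre. Cauchy-Schwarz for each entry makes the cost
  proportional to the mass of the children, so it vanishes with that mass, unlike the flat price
  \<open>r u\<close>.\<close>

lemma children_bound_sink:
  assumes u: "u \<in> V"
  shows "(\<Sum>v\<in>ch u. g u v) \<le> (\<Sum>v\<in>ch u. r v) / dl u"
proof -
  have "(\<Sum>v\<in>ch u. (c u v)\<^sup>2) \<le> (\<Sum>v\<in>ch u. r u * r v)"
    by (intro sum_mono c_cauchy u) (auto simp: ch_def)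
  then have "(\<Sum>v\<in>ch u. (c u v)\<^sup>2) / dl u \<le> r u * (\<Sum>v\<in>ch u. r v) / dl u"
    using dl_pos[OF u] by (intro divide_right_mono) (auto simp: sum_distrib_left)
  moreover have "(\<Sum>v\<in>ch u. r v) + r u * (\<Sum>v\<in>ch u. r v) / dl u = (\<Sum>v\<in>ch u. r v) / dl u"
    using dl_pos[OF u] by (simp add: field_simps)
  ultimately show ?thesis using children_bound[OF u] by simp
qed

text \<open>
  The weight of a core edge at its two ends when only the vertices of \<open>U\<close> act as centres: a centre
  \<open>u\<close> spends its row sum \<open>\<Sum>v\<noteq>u. (c u v)\<^sup>2 = r u * dl u\<close> with weight \<open>1 / dl u\<close>.
\<close>

definition wt :: "'a set \<Rightarrow> 'a \<Rightarrow> 'a \<Rightarrow> real" where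
  "wt U u v = (if u \<in> U then if v \<in> U then 1 / 2 - 3 / 4 * dl u else 0
     else if v \<in> U then r u else 2 * r u - 1 / 2)"

text \<open>With no centre, \<open>- 2 * c u v\<close> is bounded by \<open>r u + r v\<close>; with
  one centre \<open>w\<close>, by \<open>dl w\<close> and a square over \<open>dl w\<close>; with
  two centres, by a quarter of \<open>dl u + dl v\<close> and both squares. Substituting this into
  the edge term gives the weights.\<close>

lemma core_edge_bound:
  assumes u: "u \<in> V" and v: "v \<in> V"
  shows "g u v \<le> wt U u v + wt U v u
    + (if u \<in> U then (c u v)\<^sup>2 / dl u else 0) + (if v \<in> U then (c u v)\<^sup>2 / dl v else 0)"
proof -
  have a: "0 < dl u" and b: "0 < dl v" using dl_pos u v by auto
  have one: "- 2 * c u v \<le> dl w + (c u v)\<^sup>2 / dl w" if "0 < dl w" for w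
  proof -
    have "0 \<le> (c u v + dl w)\<^sup>2 / dl w" using that by simp
    also have "\<dots> = (c u v)\<^sup>2 / dl w + 2 * c u v + dl w"
      using that by (simp add: power2_sum add_divide_distrib) (simp add: power2_eq_square)
    finally show ?thesis by simp
  qed
  \<comment> \<open>The function t^2/p + t^2/q + 2t has the minimum -pq/(p + q), and pq/(p + q) is
    at most (p + q)/4.\<close>
  have two: "- 2 * c u v \<le> (dl u + dl v) / 4 + (c u v)\<^sup>2 / dl u + (c u v)\<^sup>2 / dl v"
  proof -
    define p q t where "p = dl u" "q = dl v" "t = c u v"
    have pq: "0 < p" "0 < q" using a b by (auto simp: p_q_t_def)
    have "0 \<le> (t * (p + q) + p * q)\<^sup>2 / (p * q * (p + q))" using pq by simp
    also have "\<dots> = t\<^sup>2 / p + t\<^sup>2 / q + 2 * t + p * q / (p + q)"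
      using pq by (simp add: field_simps power2_eq_square add_nonneg_eq_0_iff)
    also have "p * q / (p + q) \<le> (p + q) / 4"
    proof -
      have "0 \<le> (p - q)\<^sup>2" by simp
      then show ?thesis using pq by (simp add: field_simps power2_eq_square)
    qed
    finally show ?thesis by (simp add: p_q_t_def)
  qed
  define A B where "A = (c u v)\<^sup>2 / dl u" and "B = (c u v)\<^sup>2 / dl v"
  have "- 2 * c u v \<le> dl u + A" "- 2 * c u v \<le> dl v + B" "- 2 * c u v \<le> (dl u + dl v) / 4 + A + B"
    using one[OF a] one[OF b] two by (simp_all only: A_def B_def)
  then show ?thesis
    unfolding A_def[symmetric] B_def[symmetric] using c_ge[OF u v] by (auto simp: wt_def field_simps)
qed

text \<open>The squares that a centre spends on its core edges are those that
  \<open>children_bound_center\<close> leaves over, so they cancel and only linear terms in the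
  diagonal remain.\<close>

lemma excess_le_centers:
  assumes U: "U \<subseteq> K"
  shows "excess E c \<le> (\<Sum>u\<in>K. \<Sum>v\<in>NK u. wt U u v) + (\<Sum>u\<in>U. r u)
    + (\<Sum>v\<in>V - K. r v) + (\<Sum>z\<in>K - U. (\<Sum>v\<in>ch z. r v) * (1 / dl z - 1))
    + (\<Sum>w\<in>V - K. if ch w = {} then 0 else r w)"
proof -
  let ?q = "\<lambda>u v. if u \<in> U then (c u v)\<^sup>2 / dl u else 0"
  have "(\<Sum>(u, v)\<in>E \<inter> K \<times> K. g u v) \<le> (\<Sum>(u, v)\<in>E \<inter> K \<times> K. (wt U u v + ?q u v) + (wt U v u + ?q v u))"
  proof (rule sum_mono, clarify)
    fix u v assume "(u, v) \<in> E" "u \<in> K" "v \<in> K"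
    then have "u \<in> V" "v \<in> V" using K_sub by auto
    then show "g u v \<le> (wt U u v + ?q u v) + (wt U v u + ?q v u)"
      using core_edge_bound[of u v U, OF \<open>u \<in> V\<close> \<open>v \<in> V\<close>] unfolding c_sym[of v u] by linarith
  qed
  also have "\<dots> = (\<Sum>(u, v)\<in>E \<inter> K \<times> K. wt U u v + ?q u v) + (\<Sum>(u, v)\<in>E \<inter> K \<times> K. wt U v u + ?q v u)"
    by (simp only: split_def sum.distrib)
  also have "(\<Sum>(u, v)\<in>E \<inter> K \<times> K. wt U v u + ?q v u) = (\<Sum>(u, v)\<in>E \<inter> K \<times> K. wt U u v + ?q u v)"
    by (rule sum_core_swap)
  finally have "(\<Sum>(u, v)\<in>E \<inter> K \<times> K. g u v) / 2 \<le> (\<Sum>(u, v)\<in>E \<inter> K \<times> K. wt U u v + ?q u v)" by simp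
  also have "\<dots> = (\<Sum>u\<in>K. \<Sum>v\<in>NK u. wt U u v) + (\<Sum>u\<in>K. \<Sum>v\<in>NK u. ?q u v)"
    unfolding sum_core by (simp only: sum.distrib)
  also have "(\<Sum>u\<in>K. \<Sum>v\<in>NK u. ?q u v) = (\<Sum>u\<in>U. (\<Sum>v\<in>NK u. (c u v)\<^sup>2) / dl u)"
    using U finite_K by (intro sum.mono_neutral_cong_right) (auto simp: sum_divide_distrib)
  finally have core: "(\<Sum>(u, v)\<in>E \<inter> K \<times> K. g u v) / 2
    \<le> (\<Sum>u\<in>K. \<Sum>v\<in>NK u. wt U u v) + (\<Sum>u\<in>U. (\<Sum>v\<in>NK u. (c u v)\<^sup>2) / dl u)" .
  have "(\<Sum>u\<in>V. \<Sum>v\<in>ch u. g u v) \<le> (\<Sum>u\<in>V. (\<Sum>v\<in>ch u. r v)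
      + (if u \<in> U then r u - (\<Sum>v\<in>NK u. (c u v)\<^sup>2) / dl u else 0)
      + (if u \<in> K - U then (\<Sum>v\<in>ch u. r v) * (1 / dl u - 1) else 0)
      + (if u \<in> V - K then if ch u = {} then 0 else r u else 0))"
  proof (rule sum_mono)
    fix u assume u: "u \<in> V"
    have "(\<Sum>v\<in>ch u. r v) * (1 / dl u - 1) = (\<Sum>v\<in>ch u. r v) / dl u - (\<Sum>v\<in>ch u. r v)"
      by (simp add: algebra_simps)
    then show "(\<Sum>v\<in>ch u. g u v) \<le> (\<Sum>v\<in>ch u. r v)
      + (if u \<in> U then r u - (\<Sum>v\<in>NK u. (c u v)\<^sup>2) / dl u else 0)
      + (if u \<in> K - U then (\<Sum>v\<in>ch u. r v) * (1 / dl u - 1) else 0)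
      + (if u \<in> V - K then if ch u = {} then 0 else r u else 0)"
      using children_bound_center[of u] children_bound_sink[OF u] children_bound_row[OF u] u U by auto
  qed
  also have "\<dots> = (\<Sum>v\<in>V - K. r v) + ((\<Sum>u\<in>U. r u) - (\<Sum>u\<in>U. (\<Sum>v\<in>NK u. (c u v)\<^sup>2) / dl u))
      + (\<Sum>z\<in>K - U. (\<Sum>v\<in>ch z. r v) * (1 / dl z - 1)) + (\<Sum>w\<in>V - K. if ch w = {} then 0 else r w)"
  proof -
    have 1: "(\<Sum>u\<in>V. if u \<in> U then f u else 0) = (\<Sum>u\<in>U. f u)" for f :: "'a \<Rightarrow> real"
      using U K_sub finV by (intro sum.mono_neutral_cong_right) auto
    have 2: "(\<Sum>u\<in>V. if u \<in> K - U then f u else 0) = (\<Sum>u\<in>K - U. f u)" for f :: "'a \<Rightarrow> real"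
      using U K_sub finV by (intro sum.mono_neutral_cong_right) auto
    have 3: "(\<Sum>u\<in>V. if u \<in> V - K then f u else 0) = (\<Sum>u\<in>V - K. f u)" for f :: "'a \<Rightarrow> real"
      using finV by (intro sum.mono_neutral_cong_right) auto
    show ?thesis
      unfolding sum.distrib 1 2 3 sum_children by (simp add: sum_subtractf)
  qed
  finally show ?thesis using core unfolding excess_split by linarith
qed

lemma sum_wt:
  assumes U: "U \<subseteq> K"
  shows "(\<Sum>u\<in>K. \<Sum>v\<in>NK u. wt U u v)
    = (\<Sum>u\<in>U. real (card (E `` {u} \<inter> U)) * (1 / 2 - 3 / 4 * dl u))
      + (\<Sum>z\<in>K - U. real (card (E `` {z} \<inter> U)) * r z + real (card (E `` {z} \<inter> (K - U))) * (2 * r z - 1 / 2))"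
proof -
  have "(\<Sum>v\<in>NK u. wt U u v) = (\<Sum>v\<in>E `` {u} \<inter> U. wt U u v) + (\<Sum>v\<in>E `` {u} \<inter> (K - U). wt U u v)" for u
  proof -
    have "NK u = (E `` {u} \<inter> U) \<union> (E `` {u} \<inter> (K - U))" using U by auto
    moreover have "finite U" using finite_subset[OF U finite_K] .
    ultimately show ?thesis using finite_K by (simp only:) (intro sum.union_disjoint, auto)
  qed
  then have "(\<Sum>u\<in>K. \<Sum>v\<in>NK u. wt U u v)
    = (\<Sum>u\<in>K. if u \<in> U then real (card (E `` {u} \<inter> U)) * (1 / 2 - 3 / 4 * dl u)
      else real (card (E `` {u} \<inter> U)) * r u + real (card (E `` {u} \<inter> (K - U))) * (2 * r u - 1 / 2))"
    by (intro sum.cong refl) (auto simp: wt_def)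
  also have "\<dots> = (\<Sum>u\<in>U. real (card (E `` {u} \<inter> U)) * (1 / 2 - 3 / 4 * dl u))
      + (\<Sum>z\<in>K - U. real (card (E `` {z} \<inter> U)) * r z + real (card (E `` {z} \<inter> (K - U))) * (2 * r z - 1 / 2))"
  proof -
    have "K = U \<union> (K - U)" using U by auto
    then show ?thesis
      by (subst (1) \<open>K = U \<union> (K - U)\<close>, subst sum.union_disjoint)
        (use finite_K finite_subset[OF U finite_K] in auto)
  qed
  finally show ?thesis .
qed

end

section \<open>Choices of centres in cores with given cyclomatic number\<close>

locale cyclic_core = forest_over_core +
  fixes cy :: nat
  assumes core_deg: "v \<in> K \<Longrightarrow> 2 \<le> card (E `` {v} \<inter> K)"
    and core_card: "card (E \<inter> K \<times> K) + 2 = 2 * (card K + cy)"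
begin

abbreviation "dK v \<equiv> card (E `` {v} \<inter> K)"

definition \<rho> :: real where "\<rho> = (\<Sum>v\<in>V - K. r v)"
text \<open>Surplus of the core degrees over 2, weighted by \<open>dl\<close>: it is 0 on a cycle
  and positive for \<open>cy = 2\<close>. If it is small, the diagonal entries at the vertices of
  core degree above 2 are near 1.\<close>

definition branching :: real where "branching = (\<Sum>v\<in>K. (real (dK v) - 2) * dl v)"

lemma \<rho>_nonneg: "0 \<le> \<rho>" unfolding \<rho>_def by (intro sum_nonneg c_diag_nonneg) auto

lemma sum_core_diag: "(\<Sum>v\<in>K. r v) = real k - \<rho>"
  using sum.subset_diff[OF K_sub finV, of r] c_trace unfolding \<rho>_def by simp

lemma sum_core_dl: "(\<Sum>v\<in>K. dl v) = real (card K) - real k + \<rho>"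
  using sum_core_diag by (simp add: sum_subtractf)

lemma sum_dK: "(\<Sum>v\<in>K. real (dK v)) = 2 * (real (card K) + real cy) - 2"
proof -
  have "(\<Sum>v\<in>K. real (dK v)) = (\<Sum>(u, v)\<in>E \<inter> K \<times> K. 1)" unfolding sum_core by simp
  also have "\<dots> = real (card (E \<inter> K \<times> K))" by (simp add: split_def)
  finally have "(\<Sum>v\<in>K. real (dK v)) + 2 = real (card (E \<inter> K \<times> K) + 2)" by simp
  then show ?thesis unfolding core_card by simp
qed

lemma sum_dK_minus_2: "(\<Sum>v\<in>K. real (dK v) - 2) = 2 * real cy - 2"
  using sum_dK by (simp add: sum_subtractf)

lemma branching_nonneg: "0 \<le> branching"
  unfolding branching_def using core_deg c_lt K_sub
  by (intro sum_nonneg mult_nonneg_nonneg) (auto simp: less_imp_le subset_iff)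

lemma branching_pos:
  assumes "2 \<le> cy"
  shows "0 < branching"
proof -
  have "\<exists>v\<in>K. 0 < real (dK v) - 2"
  proof (rule ccontr)
    assume "\<not> ?thesis"
    then have "(\<Sum>v\<in>K. real (dK v) - 2) \<le> 0" by (intro sum_nonpos) auto
    then show False using sum_dK_minus_2 assms by simp
  qed
  then obtain v where v: "v \<in> K" "0 < real (dK v) - 2" by auto
  have "0 < (real (dK v) - 2) * dl v" using v c_lt[of v] K_sub by auto
  also have "\<dots> \<le> branching"
    unfolding branching_def using v(1) core_deg c_lt K_sub finite_K
    by (intro member_le_sum[of v K "\<lambda>v. (real (dK v) - 2) * dl v"] mult_nonneg_nonneg) (auto simp: less_imp_le subset_iff)
  finally show ?thesis .
qed

text \<open>Mass of the outside vertices that have children: as centres for their children they pay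
  their diagonal entry a second time.\<close>

definition \<rho>' :: real where "\<rho>' = (\<Sum>w\<in>V - K. if ch w = {} then 0 else r w)"

lemma \<rho>'_le: "\<rho>' \<le> \<rho>"
  unfolding \<rho>_def \<rho>'_def by (intro sum_mono) (auto intro: c_diag_nonneg)

text \<open>Here \<open>U = K\<close>. An additional core vertex brings 1 from its edges and loses
  3/2 through \<open>sum_core_dl\<close>, so the bound falls by 1/2 per core vertex; large cores are
  therefore easy.\<close>

lemma all_centers:
  "excess E c \<le> real (card K) + real cy - 1 - 3 / 2 * (real (card K) - real k + \<rho>)
     - 3 / 4 * branching + real k + \<rho>'"
proof -
  have K: "K \<inter> E `` {u} = E `` {u} \<inter> K" for u by auto
  have "(\<Sum>u\<in>K. real (dK u) * (1 / 2 - 3 / 4 * dl u))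
      = (\<Sum>u\<in>K. real (dK u)) / 2 - 3 / 4 * ((\<Sum>u\<in>K. (real (dK u) - 2) * dl u) + 2 * (\<Sum>u\<in>K. dl u))"
  proof -
    have "(\<Sum>u\<in>K. real (dK u) * (1 / 2 - 3 / 4 * dl u))
      = (\<Sum>u\<in>K. real (dK u) / 2 - (3 / 4 * ((real (dK u) - 2) * dl u) + 3 / 2 * dl u))"
      by (intro sum.cong refl) (simp add: field_simps)
    also have "\<dots> = (\<Sum>u\<in>K. real (dK u)) / 2 - (3 / 4 * (\<Sum>u\<in>K. (real (dK u) - 2) * dl u) + 3 / 2 * (\<Sum>u\<in>K. dl u))"
      by (simp only: sum_subtractf[of "\<lambda>u. real (dK u) / 2"] sum.distrib[of "\<lambda>u. 3 / 4 * _ u"] sum_divide_distrib[symmetric] sum_distrib_left[symmetric])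
    finally show ?thesis by (simp add: algebra_simps)
  qed
  then have "(\<Sum>u\<in>K. real (dK u) * (1 / 2 - 3 / 4 * dl u))
      = real (card K) + real cy - 1 - 3 / 4 * branching - 3 / 2 * (real (card K) - real k + \<rho>)"
    unfolding sum_dK sum_core_dl branching_def[symmetric] by (simp add: field_simps)
  then show ?thesis
    using excess_le_centers[of K] sum_wt[of K] sum_core_diag unfolding \<rho>_def \<rho>'_def by simp
qed

text \<open>The threshold 2/3 means \<open>1 / dl z \<le> 3\<close>, so pendant mass at a core
  vertex that is not a centre is counted at most three times.\<close>

lemma sinks:
  assumes U: "U \<subseteq> K" and small: "\<And>z. z \<in> K - U \<Longrightarrow> r z \<le> 2 / 3" and leaves: "\<And>w. w \<in> V - K \<Longrightarrow> ch w = {}"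
  shows "excess E c \<le> (\<Sum>u\<in>K. \<Sum>v\<in>NK u. wt U u v) + (\<Sum>u\<in>U. r u) + 3 * \<rho>"
proof -
  have "(\<Sum>z\<in>K - U. (\<Sum>v\<in>ch z. r v) * (1 / dl z - 1)) \<le> (\<Sum>z\<in>K - U. 2 * (\<Sum>v\<in>ch z. r v))"
  proof (rule sum_mono)
    fix z assume z: "z \<in> K - U"
    have "0 \<le> (\<Sum>v\<in>ch z. r v)" by (intro sum_nonneg c_diag_nonneg) (auto simp: ch_def)
    moreover have "1 / dl z - 1 \<le> 2" using small[OF z] by (simp add: field_simps)
    ultimately show "(\<Sum>v\<in>ch z. r v) * (1 / dl z - 1) \<le> 2 * (\<Sum>v\<in>ch z. r v)"
      by (simp add: mult.commute mult_right_mono)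
  qed
  also have "\<dots> \<le> (\<Sum>z\<in>V. 2 * (\<Sum>v\<in>ch z. r v))"
    using K_sub finV by (intro sum_mono2) (auto intro!: sum_nonneg c_diag_nonneg simp: ch_def)
  also have "\<dots> = 2 * \<rho>" by (simp add: sum_distrib_left[symmetric] sum_children \<rho>_def)
  finally show ?thesis using excess_le_centers[OF U] leaves unfolding \<rho>_def[symmetric] by simp
qed

lemma card_NK_split:
  assumes "U \<subseteq> K"
  shows "dK v = card (E `` {v} \<inter> U) + card (E `` {v} \<inter> (K - U))"
proof -
  have "E `` {v} \<inter> K = (E `` {v} \<inter> U) \<union> (E `` {v} \<inter> (K - U))" using assms by auto
  moreover have "finite U" using finite_subset[OF assms finite_K] .
  ultimately show ?thesis using finite_K by (simp only:) (intro card_Un_disjoint, auto)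
qed

lemma double_count:
  assumes "finite A" "finite B"
  shows "(\<Sum>a\<in>A. card (E `` {a} \<inter> B)) = (\<Sum>b\<in>B. card (E `` {b} \<inter> A))"
proof -
  have "(\<Sum>a\<in>A. card (E `` {a} \<inter> B)) = (\<Sum>a\<in>A. \<Sum>b\<in>B. if (a, b) \<in> E then 1 else 0)"
    using assms by (intro sum.cong refl) (simp add: sum.If_cases Int_def conj_commute)
  also have "\<dots> = (\<Sum>b\<in>B. \<Sum>a\<in>A. if (b, a) \<in> E then 1 else 0)"
    by (subst sum.swap) (auto intro!: sum.cong intro: E_commute)
  also have "\<dots> = (\<Sum>b\<in>B. card (E `` {b} \<inter> A))"
    using assms by (intro sum.cong refl) (simp add: sum.If_cases Int_def conj_commute)
  finally show ?thesis .
qed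

lemma member_diag_le:
  assumes "S \<subseteq> V" "v \<in> S"
  shows "r v \<le> (\<Sum>v\<in>S. r v)"
  using assms finite_subset[OF assms(1) finV] by (intro member_le_sum) (auto intro: c_diag_nonneg)

section \<open>Three eigenvalues of bicyclic graphs\<close>

lemma bicyclic_k3_large_core:
  assumes "k = 3" "cy = 2" "5 \<le> card K"
  shows "excess E c < 6"
proof -
  have "5 \<le> real (card K)" using assms by simp
  then show ?thesis using all_centers branching_pos \<rho>'_le \<rho>_nonneg assms by (simp add: field_simps)
qed

text \<open>The core is \<open>K\<^sub>4\<close> minus an edge. Taking all four vertices as centres
  misses the bound by at most 1/2 and suffices when \<open>\<rho>\<close> or
  \<open>branching\<close> is large. Otherwise the vertex \<open>w\<close> of core degree 2 with the
  smaller diagonal entry is dropped as a centre.\<close>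

lemma bicyclic_k3_small_core:
  assumes k3: "k = 3" and cy: "cy = 2" and K4: "card K = 4"
  shows "excess E c < 6"
proof -
  have d3: "dK v \<le> 3" if "v \<in> K" for v
  proof -
    have "E `` {v} \<inter> K \<subseteq> K - {v}" using not_self by auto
    then show ?thesis using card_mono[of "K - {v}"] finite_K that K4 by fastforce
  qed
  let ?W = "{v \<in> K. dK v = 2}"
  have dd: "dK v = 2 \<or> dK v = 3" if "v \<in> K" for v using d3[OF that] core_deg[OF that] by linarith
  have "(\<Sum>v\<in>K. real (dK v) - 2) = (\<Sum>v\<in>K - ?W. 1)"
    using finite_K dd by (intro sum.mono_neutral_cong_right) fastforce+
  then have "card (K - ?W) = 2" using sum_dK_minus_2 cy by simp
  moreover have "card (K - ?W) = card K - card ?W" by (rule card_Diff_subset) (use finite_K in auto)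
  ultimately have W2: "card ?W = 2" using K4 by simp
  then obtain w1 w2 where w12: "?W = {w1, w2}" "w1 \<noteq> w2" by (auto simp: card_2_iff)
  obtain w w' where w: "?W = {w, w'}" "w \<noteq> w'" "r w \<le> r w'"
  proof (cases "r w1 \<le> r w2")
    case True then show ?thesis using that w12 by blast
  next
    case False then show ?thesis using that[of w2 w1] w12 by auto
  qed
  have wK: "w \<in> K" "w' \<in> K" "dK w = 2" "dK w' = 2" using w by auto
  let ?U = "K - {w}"
  have full: "E `` {u} \<inter> K = K - {u}" if "u \<in> K" "dK u = 3" for u
    using that K4 finite_K not_self by (intro card_subset_eq) auto
  obtain u1 u2 where u: "K - ?W = {u1, u2}" "u1 \<noteq> u2" using \<open>card (K - ?W) = 2\<close> by (auto simp: card_2_iff)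
  have uK: "u1 \<in> K" "u2 \<in> K" "dK u1 = 3" "dK u2 = 3" "u1 \<noteq> w" "u2 \<noteq> w" "u1 \<noteq> w'" "u2 \<noteq> w'"
    using u dd wK by auto
  have "K = ?W \<union> (K - ?W)" by auto
  then have Keq: "K = {w, w', u1, u2}" unfolding w(1) u(1)[unfolded w(1)] by auto
  have ww: "(w, w') \<notin> E"
  proof
    assume "(w, w') \<in> E"
    moreover have "(u1, w) \<in> E" "(u2, w) \<in> E"
      using full[OF uK(1,3)] full[OF uK(2,4)] uK wK by auto
    ultimately have "{w', u1, u2} \<subseteq> E `` {w} \<inter> K"
      using uK wK E_commute by auto
    then have "card {w', u1, u2} \<le> 2" using card_mono[of "E `` {w} \<inter> K"] finite_K wK(3) by fastforce
    then show False using uK u(2) by auto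
  qed
  \<comment> \<open>\<open>K - {w}\<close> is a triangle and \<open>w\<close> is joined to two of
    its vertices.\<close>
  have degU: "card (E `` {v} \<inter> ?U) = 2" if vK: "v \<in> K" for v
  proof -
    consider "v = w" | "v = w'" | "v = u1" | "v = u2" using vK unfolding Keq by blast
    then show ?thesis
    proof cases
      case 1
      then have "E `` {v} \<inter> ?U = E `` {w} \<inter> K" using not_self by auto
      then show ?thesis using wK by simp
    next
      case 2
      then have "E `` {v} \<inter> ?U = E `` {w'} \<inter> K" using ww E_commute by auto
      then show ?thesis using wK by simp
    next
      case 3
      then have "E `` {v} \<inter> ?U = {w', u2}" using full[OF uK(1,3)] Keq uK u(2) w(2) by blast
      then show ?thesis using uK by simp
    next
      case 4
      then have "E `` {v} \<inter> ?U = {w', u1}" using full[OF uK(2,4)] Keq uK u(2) w(2) by blast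
      then show ?thesis using uK by simp
    qed
  qed
  define R where "R = r w"
  define S where "S = (\<Sum>v\<in>ch w. r v)"
  have wV: "w \<in> V" using wK K_sub by auto
  have R: "0 \<le> R" "R < 1" using c_diag_nonneg c_lt wV by (auto simp: R_def)
  have S: "0 \<le> S" "S \<le> \<rho>"
    unfolding S_def \<rho>_def using ch_sub finV by (auto intro!: sum_nonneg sum_mono2 c_diag_nonneg simp: ch_def)
  have sumU: "(\<Sum>v\<in>?U. r v) = 3 - \<rho> - R"
    using sum_core_diag k3 sum.remove[OF finite_K wK(1), of r] by (simp add: R_def)
  have "(\<Sum>u\<in>?U. real (card (E `` {u} \<inter> ?U)) * (1 / 2 - 3 / 4 * dl u)) = (\<Sum>u\<in>?U. 1 - 3 / 2 * dl u)"
    using degU by (intro sum.cong refl) auto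
  also have "\<dots> = (\<Sum>u\<in>?U. 3 / 2 * r u - 1 / 2)" by (intro sum.cong refl) (simp add: field_simps)
  also have "\<dots> = 3 / 2 * (\<Sum>v\<in>?U. r v) - 3 / 2"
    using K4 finite_K wK by (simp only: sum_subtractf sum_distrib_left[symmetric] sum_constant) simp
  finally have c1: "(\<Sum>u\<in>?U. real (card (E `` {u} \<inter> ?U)) * (1 / 2 - 3 / 4 * dl u)) = 3 - 3 / 2 * (\<rho> + R)"
    unfolding sumU by (simp add: field_simps)
  have KU: "K - ?U = {w}" using wK by auto
  have "E `` {w} \<inter> {w} = {}" using not_self by auto
  then have "excess E c \<le> (3 - 3 / 2 * (\<rho> + R)) + 2 * R + (3 - \<rho> - R) + \<rho> + S * (1 / (1 - R) - 1) + \<rho>'"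
    using excess_le_centers[of ?U] unfolding sum_wt[OF Diff_subset] c1 sumU KU
    using degU[OF wK(1)] by (simp add: R_def S_def \<rho>_def \<rho>'_def)
  moreover define T where "T = S * (1 / (1 - R) - 1)"
  ultimately have ii: "excess E c \<le> 6 - \<rho> / 2 - R / 2 + T" using \<rho>'_le by (simp add: field_simps)
  have i: "excess E c \<le> 4 + 2 - 1 - 3 / 2 * (4 - 3 + \<rho>) - 3 / 4 * branching + 3 + \<rho>'"
    using all_centers unfolding k3 cy K4 by simp
  show ?thesis
  proof (cases "1 / 2 < \<rho> / 2 + 3 / 4 * branching")
    case True
    then show ?thesis using i \<rho>'_le by (simp add: field_simps)
  next
    case False
    have "branching = (\<Sum>v\<in>{u1, u2}. dl v)"
      unfolding branching_def using Keq wK uK u(2) w(2) finite_K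
      by (intro sum.mono_neutral_cong_right) auto
    then have br: "branching = dl u1 + dl u2" using u(2) by simp
    have "r w + r w' + r u1 + r u2 = 3 - \<rho>"
      using sum_core_diag k3 uK u(2) w(2) unfolding Keq by simp
    \<comment> \<open>The two vertices of core degree 3 carry \<open>2 - branching\<close> of the
      trace, which leaves \<open>1 + branching - \<rho>\<close> for \<open>w\<close> and
      \<open>w'\<close>, and \<open>w\<close> has the smaller share. The case assumption turns this
      into \<open>p\<close>.\<close>
    then have "2 * R \<le> 1 + branching - \<rho>" using br w(3) by (simp add: R_def)
    then have p: "\<rho> \<le> 1 - 6 / 5 * R" using False by simp
    \<comment> \<open>With no mass outside and none at \<open>w\<close>, three diagonal entries
      below 1 would have to sum to 3.\<close>
    have pos: "0 < \<rho> \<or> 0 < R"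
    proof (rule ccontr)
      assume "\<not> ?thesis"
      then have "\<rho> = 0" "r w = 0" using \<rho>_nonneg R by (auto simp: R_def)
      then have "r w' + r u1 + r u2 = 3" using \<open>r w + r w' + r u1 + r u2 = 3 - \<rho>\<close> by simp
      moreover have "r w' < 1" "r u1 < 1" "r u2 < 1" using c_lt wK uK K_sub by auto
      ultimately show False by simp
    qed
    have key: "2 * \<rho> * R < (\<rho> + R) * (1 - R)"
    proof (cases "R = 0")
      case True then show ?thesis using pos by simp
    next
      case False
      then have R0: "0 < R" using R by simp
      have "\<rho> * (3 * R - 1) < R * (1 - R)"
      proof (cases "3 * R - 1 \<le> 0")
        case True
        then have "\<rho> * (3 * R - 1) \<le> 0" using \<rho>_nonneg by (intro mult_nonneg_nonpos)
        moreover have "0 < R * (1 - R)" using R0 R by simp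
        ultimately show ?thesis by simp
      next
        case False
        then have "\<rho> * (3 * R - 1) \<le> (1 - 6 / 5 * R) * (3 * R - 1)" using p by (intro mult_right_mono) auto
        also have "\<dots> < R * (1 - R)"
        proof -
          \<comment> \<open>The difference of the two sides is ((13 R - 8)^2 + 1) / 65.\<close>
          have "0 \<le> (13 * R - 8)\<^sup>2" by simp
          then show ?thesis by (simp add: power2_eq_square field_simps)
        qed
        finally show ?thesis .
      qed
      then show ?thesis by (simp add: algebra_simps)
    qed
    have "T = S * R / (1 - R)" unfolding T_def using R by (simp add: field_simps)
    also have "\<dots> \<le> \<rho> * R / (1 - R)" using S R by (intro divide_right_mono mult_right_mono) auto
    also have "\<dots> < \<rho> / 2 + R / 2" using key R by (simp add: pos_divide_less_eq field_simps)
    finally show ?thesis using ii by (simp add: field_simps)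
  qed
qed

section \<open>Two eigenvalues, large cores with pendant vertices\<close>

text \<open>\<open>all_centers\<close> is strict except for a core of four vertices that carries the
  whole trace. In this case the pendant edges contribute nothing positive, and the 4-cycle gets a
  sharper estimate with constant weights.\<close>

lemma unicyclic_k2_large_core:
  assumes k2: "k = 2" and cy: "cy = 1" and K4: "4 \<le> card K" and leaves: "\<And>w. w \<in> V - K \<Longrightarrow> ch w = {}"
  shows "excess E c < 3"
proof -
  have \<rho>': "\<rho>' = 0" using leaves by (simp add: \<rho>'_def)
  have b: "excess E c \<le> 5 - real (card K) / 2 - 3 / 2 * \<rho>"
    using all_centers branching_nonneg k2 cy \<rho>' by (simp add: field_simps)
  show ?thesis
  proof (cases "0 < \<rho> \<or> 5 \<le> card K")
    case True then show ?thesis using b \<rho>_nonneg K4 by auto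
  next
    case False
    then have "\<rho> = 0" and K: "card K = 4" using \<rho>_nonneg K4 by auto
    then have zero: "r v = 0" if "v \<in> V - K" for v
      using that finV c_diag_nonneg unfolding \<rho>_def by (subst (asm) sum_nonneg_eq_0_iff) auto
    have "g u v \<le> 0" if "u \<in> V" "v \<in> ch u" for u v
      using that zero[of v] c_eq_0[of u v] c_diag_le_1[of u] ch_sub by fastforce
    then have ch0: "(\<Sum>u\<in>V. \<Sum>v\<in>ch u. g u v) \<le> 0" by (intro sum_nonpos) auto
    have "(\<Sum>v\<in>K. real (dK v) - 2) = 0" using sum_dK_minus_2 cy by simp
    then have d2: "dK v = 2" if "v \<in> K" for v
      using that core_deg finite_K by (subst (asm) sum_nonneg_eq_0_iff) auto
    have rs: "(\<Sum>v\<in>K. r v) = 2" using sum_core_diag k2 \<open>\<rho> = 0\<close> by simp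
    \<comment> \<open>A constant a > 0 in \<open>- 2 * c u v \<le> a + (c u v)\<^sup>2 / a\<close>
      leads to the total 4a + 1/(2a), whose minimum lies at a = 1/sqrt 8; the value 1/3 is close to
      it and gives 17/6.\<close>
    define h where "h u v = r u - 1 / 3 + 3 / 2 * (c u v)\<^sup>2" for u v
    have "(\<Sum>(u, v)\<in>E \<inter> K \<times> K. g u v) \<le> (\<Sum>(u, v)\<in>E \<inter> K \<times> K. h u v + h v u)"
    proof (rule sum_mono, clarify)
      fix u v
      have "0 \<le> 3 * (c u v + 1 / 3)\<^sup>2" by simp
      then have "- 2 * c u v \<le> 1 / 3 + 3 * (c u v)\<^sup>2" by (simp add: power2_eq_square algebra_simps)
      then show "g u v \<le> h u v + h v u"
        unfolding h_def c_sym[of v u] by linarith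
    qed
    also have "\<dots> = 2 * (\<Sum>(u, v)\<in>E \<inter> K \<times> K. h u v)"
      using sum_core_swap[of h] by (simp add: split_def sum.distrib)
    finally have "(\<Sum>(u, v)\<in>E \<inter> K \<times> K. g u v) / 2 \<le> (\<Sum>u\<in>K. \<Sum>v\<in>NK u. h u v)"
      unfolding sum_core by simp
    also have "\<dots> \<le> (\<Sum>u\<in>K. 2 * (r u - 1 / 3) + 3 / 2 * (r u - (r u)\<^sup>2))"
    proof (rule sum_mono)
      fix u assume u: "u \<in> K"
      have "(\<Sum>v\<in>NK u. (c u v)\<^sup>2) \<le> r u * dl u"
        by (rule c_row_subset) (use u K_sub not_self in auto)
      then have "(\<Sum>v\<in>NK u. (c u v)\<^sup>2) \<le> r u - (r u)\<^sup>2" by (simp add: power2_eq_square algebra_simps)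
      moreover have "(\<Sum>v\<in>NK u. h u v) = 2 * (r u - 1 / 3) + 3 / 2 * (\<Sum>v\<in>NK u. (c u v)\<^sup>2)"
        unfolding h_def by (simp only: sum.distrib sum_distrib_left[symmetric] sum_constant d2[OF u])
      ultimately show "(\<Sum>v\<in>NK u. h u v) \<le> 2 * (r u - 1 / 3) + 3 / 2 * (r u - (r u)\<^sup>2)"
        by (simp add: field_simps)
    qed
    also have "\<dots> \<le> (\<Sum>u\<in>K. 2 * (r u - 1 / 3) + 3 / 8)"
    proof (rule sum_mono)
      fix u
      have "0 \<le> (r u - 1 / 2)\<^sup>2" by simp
      then show "2 * (r u - 1 / 3) + 3 / 2 * (r u - (r u)\<^sup>2) \<le> 2 * (r u - 1 / 3) + 3 / 8"
        by (simp add: power2_eq_square algebra_simps)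
    qed
    also have "\<dots> = 17 / 6" using rs K by (simp add: sum.distrib sum_subtractf sum_distrib_left[symmetric])
    finally show ?thesis using ch0 unfolding excess_split by simp
  qed
qed

text \<open>As the trace is 2, the three core vertices other than \<open>x\<close> and
  \<open>y\<close> carry only the mass \<open>dl x + dl y - \<rho>\<close>, so with \<open>x\<close>
  and \<open>y\<close> as centres the bound exceeds 2 by small quantities only. The two alternatives
  belong to \<open>x\<close> and \<open>y\<close> being non-adjacent and adjacent.\<close>

lemma pair_centers:
  assumes K: "k = 2" "cy = 2" "card K = 5" and leaves: "\<And>w. w \<in> V - K \<Longrightarrow> ch w = {}"
    and xy: "x \<in> K" "y \<in> K" "x \<noteq> y"
    and d2: "\<And>z. z \<in> K - {x, y} \<Longrightarrow> dK z = 2"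
    and b1: "\<And>z. z \<in> K - {x, y} \<Longrightarrow> card (E `` {z} \<inter> (K - {x, y})) \<le> card (E `` {x} \<inter> {x, y})"
    and \<sigma>: "dl x + dl y - \<rho> \<le> 2 / 3"
    and tot: "dK x + dK y = 6"
  shows "excess E c \<le> 2 + (dl x + dl y) + \<rho> \<or> excess E c \<le> 2 + 5 / 4 * (dl x + dl y)"
proof -
  let ?U = "{x, y}" and ?Z = "K - {x, y}"
  have U: "?U \<subseteq> K" using xy by auto
  define e :: nat where "e = (if (x, y) \<in> E then 1 else 0)"
  have ex: "E `` {x} \<inter> ?U = (if (x, y) \<in> E then {y} else {})" "E `` {y} \<inter> ?U = (if (x, y) \<in> E then {x} else {})"
    using not_self E_commute by auto
  then have e: "card (E `` {x} \<inter> ?U) = e" "card (E `` {y} \<inter> ?U) = e" by (auto simp: e_def)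
  have Z: "finite ?Z" "card ?Z = 3" using finite_K U xy(3) K(3) by (auto simp: card_Diff_subset)
  have rZ: "(\<Sum>z\<in>?Z. r z) = dl x + dl y - \<rho>"
    using sum_core_diag K(1) sum.subset_diff[OF U finite_K, of r] xy(3) by simp
  have small: "r z \<le> 2 / 3" if "z \<in> ?Z" for z
    using member_diag_le[of ?Z z] that \<sigma> rZ K_sub by force
  let ?b = "\<lambda>z. card (E `` {z} \<inter> ?Z)" and ?a = "\<lambda>z. card (E `` {z} \<inter> ?U)"
  have ab: "?a z + ?b z = 2" if "z \<in> ?Z" for z using card_NK_split[OF U, of z] d2[OF that] by simp
  have "(\<Sum>z\<in>?Z. ?a z) = ?b x + ?b y"
    using double_count[of ?Z ?U] Z(1) xy(3) by simp
  moreover have "?b x + ?b y + 2 * e = 6" using card_NK_split[OF U, of x] card_NK_split[OF U, of y] e tot by simp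
  moreover have "(\<Sum>z\<in>?Z. ?a z) + (\<Sum>z\<in>?Z. ?b z) = (\<Sum>z\<in>?Z. 2)"
    unfolding sum.distrib[symmetric] by (intro sum.cong refl ab)
  ultimately have "(\<Sum>z\<in>?Z. ?b z) = 2 * e" using Z(2) by simp
  then have sb: "(\<Sum>z\<in>?Z. real (?b z)) = 2 * real e" by (metis of_nat_mult of_nat_numeral of_nat_sum)
  have "(\<Sum>z\<in>?Z. real (?a z) * r z + real (?b z) * (2 * r z - 1 / 2)) \<le> (\<Sum>z\<in>?Z. (2 + real e) * r z - real (?b z) / 2)"
  proof (rule sum_mono)
    fix z assume z: "z \<in> ?Z"
    have "real (?a z) = 2 - real (?b z)" using ab[OF z] by linarith
    then have "real (?a z) * r z = 2 * r z - real (?b z) * r z" by (simp only: left_diff_distrib)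
    moreover have "real (?b z) * r z \<le> real e * r z"
      using b1[OF z] e(1) z K_sub by (intro mult_right_mono c_diag_nonneg) auto
    ultimately show "real (?a z) * r z + real (?b z) * (2 * r z - 1 / 2) \<le> (2 + real e) * r z - real (?b z) / 2"
      by (simp add: algebra_simps)
  qed
  also have "\<dots> = (2 + real e) * (dl x + dl y - \<rho>) - real e"
    unfolding sum_subtractf sum_distrib_left[symmetric] sum_divide_distrib[symmetric] sb rZ by simp
  finally have zpart: "(\<Sum>z\<in>?Z. real (?a z) * r z + real (?b z) * (2 * r z - 1 / 2)) \<le> (2 + real e) * (dl x + dl y - \<rho>) - real e" .
  have upart: "(\<Sum>u\<in>?U. real (card (E `` {u} \<inter> ?U)) * (1 / 2 - 3 / 4 * dl u)) = real e * (1 - 3 / 4 * (dl x + dl y))"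
    using xy(3) e by simp (simp add: field_simps)
  have main: "excess E c \<le> real e * (1 - 3 / 4 * (dl x + dl y)) + ((2 + real e) * (dl x + dl y - \<rho>) - real e) + (r x + r y) + 3 * \<rho>"
    using sinks[OF U small leaves] xy(3) zpart unfolding sum_wt[OF U] upart by simp
  have "e = 0 \<or> e = 1" by (simp add: e_def)
  then consider "e = 0" | "e = 1" by blast
  then show ?thesis
  proof cases
    case 1
    have "excess E c \<le> 2 * (dl x + dl y - \<rho>) + (r x + r y) + 3 * \<rho>" using main unfolding 1 by simp
    then show ?thesis by (intro disjI1) simp
  next
    case 2
    have "excess E c \<le> 1 - 3 / 4 * (dl x + dl y) + (3 * (dl x + dl y - \<rho>) - 1) + (r x + r y) + 3 * \<rho>"
      using main unfolding 2 by simp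
    then show ?thesis by (intro disjI2) (simp add: field_simps)
  qed
qed

text \<open>Taking all core vertices as centres can fail only for five core vertices with small
  \<open>\<rho>\<close> and \<open>branching\<close>. Then the vertices of core degree above 2 have
  diagonal entries near 1 and become the only centres: two of degree 3, or one of degree 4, possibly
  joined by another vertex with a large entry.\<close>

lemma bicyclic_k2_large_core:
  assumes k2: "k = 2" and cy: "cy = 2" and K5: "5 \<le> card K" and leaves: "\<And>w. w \<in> V - K \<Longrightarrow> ch w = {}"
  shows "excess E c < 3"
proof -
  have \<rho>': "\<rho>' = 0" using leaves by (simp add: \<rho>'_def)
  have b: "excess E c \<le> 6 - real (card K) / 2 - 3 / 2 * \<rho> - 3 / 4 * branching"
    using all_centers k2 cy \<rho>' by (simp add: field_simps)
  show ?thesis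
  proof (cases "6 \<le> card K \<or> 1 / 2 < 3 / 2 * \<rho> + 3 / 4 * branching")
    case True
    then show ?thesis using b \<rho>_nonneg branching_pos cy K5 by auto
  next
    case False
    then have K: "card K = 5" and small: "3 / 2 * \<rho> + 3 / 4 * branching \<le> 1 / 2" using K5 by auto
    have ex: "\<exists>x\<in>K. 0 < real (dK x) - 2"
    proof (rule ccontr)
      assume "\<not> ?thesis"
      then have "(\<Sum>v\<in>K. real (dK v) - 2) \<le> 0" by (intro sum_nonpos) auto
      then show False using sum_dK_minus_2 cy by simp
    qed
    then obtain x where x: "x \<in> K" "2 < dK x" by auto
    have rest: "(\<Sum>v\<in>K - {x}. real (dK v) - 2) = 4 - real (dK x)"
      using sum_dK_minus_2 cy sum.remove[OF finite_K x(1), of "\<lambda>v. real (dK v) - 2"] by simp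
    moreover have "0 \<le> (\<Sum>v\<in>K - {x}. real (dK v) - 2)" using core_deg by (intro sum_nonneg) auto
    ultimately have "dK x = 3 \<or> dK x = 4" using x(2) by auto
    then show ?thesis
    proof
      assume d3: "dK x = 3"
      have "\<exists>y\<in>K - {x}. 0 < real (dK y) - 2"
      proof (rule ccontr)
        assume "\<not> ?thesis"
        then have "(\<Sum>v\<in>K - {x}. real (dK v) - 2) \<le> 0" by (intro sum_nonpos) (meson not_less)
        then show False using rest d3 by simp
      qed
      then obtain y where y: "y \<in> K" "y \<noteq> x" "2 < dK y" by auto
      have rest2: "(\<Sum>v\<in>K - {x} - {y}. real (dK v) - 2) = 3 - real (dK y)"
        using rest d3 y finite_K sum.remove[of "K - {x}" y "\<lambda>v. real (dK v) - 2"] by simp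
      moreover have nn: "0 \<le> (\<Sum>v\<in>K - {x} - {y}. real (dK v) - 2)" using core_deg by (intro sum_nonneg) auto
      ultimately have dy: "dK y = 3" using y by auto
      have d2: "dK z = 2" if "z \<in> K - {x, y}" for z
      proof -
        have "(\<Sum>v\<in>K - {x} - {y}. real (dK v) - 2) = 0" using rest2 dy by simp
        then have "\<forall>v\<in>K - {x} - {y}. real (dK v) - 2 = 0"
          using core_deg finite_K by (subst (asm) sum_nonneg_eq_0_iff) auto
        then show ?thesis using that by auto
      qed
      have "branching = (\<Sum>v\<in>{x, y}. dl v)"
        unfolding branching_def using x y d2 finite_K d3 dy by (intro sum.mono_neutral_cong_right) auto
      then have br: "branching = dl x + dl y" using y by simp
      let ?Z = "K - {x, y}"
      have U: "{x, y} \<subseteq> K" using x y by auto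
      \<comment> \<open>By degree counting \<open>?Z\<close> contains one edge if \<open>x\<close>
        and \<open>y\<close> are adjacent and none otherwise. Every neighbour of \<open>z\<close> in
        \<open>?Z\<close> sends an arc back, so \<open>z\<close> accounts for at most half of the
        arcs.\<close>
      have b1: "card (E `` {z} \<inter> ?Z) \<le> card (E `` {x} \<inter> {x, y})" if z: "z \<in> ?Z" for z
      proof -
        let ?b = "\<lambda>z. card (E `` {z} \<inter> ?Z)" and ?a = "\<lambda>z. card (E `` {z} \<inter> {x, y})"
        have axy: "E `` {x} \<inter> {x, y} = (if (x, y) \<in> E then {y} else {})" "E `` {y} \<inter> {x, y} = (if (x, y) \<in> E then {x} else {})"
          using not_self E_commute by auto
        then have ae: "?a y = ?a x" by simp
        have Z: "finite ?Z" "card ?Z = 3" using finite_K U y(2) K by (auto simp: card_Diff_subset)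
        have "(\<Sum>z\<in>?Z. ?a z) = ?b x + ?b y" using double_count[of ?Z "{x, y}"] Z(1) y(2) by simp
        moreover have "?b x + ?a x = 3" "?b y + ?a x = 3"
          using card_NK_split[OF U, of x] card_NK_split[OF U, of y] ae d3 dy by auto
        moreover have "(\<Sum>z\<in>?Z. ?a z) + (\<Sum>z\<in>?Z. ?b z) = (\<Sum>z\<in>?Z. 2)"
          unfolding sum.distrib[symmetric] using card_NK_split[OF U] d2 by (intro sum.cong refl) metis
        ultimately have sb: "(\<Sum>z\<in>?Z. ?b z) = 2 * ?a x" using Z(2) by simp
        have "?b z = (\<Sum>v\<in>E `` {z} \<inter> ?Z. 1)" by simp
        also have "\<dots> \<le> (\<Sum>v\<in>E `` {z} \<inter> ?Z. ?b v)"
        proof (rule sum_mono)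
          fix v assume "v \<in> E `` {z} \<inter> ?Z"
          then have "z \<in> E `` {v} \<inter> ?Z" using z E_commute by auto
          then show "1 \<le> ?b v" using Z(1) by (metis One_nat_def Suc_leI card_gt_0_iff empty_iff finite_Int)
        qed
        also have "\<dots> \<le> (\<Sum>v\<in>?Z - {z}. ?b v)" using Z(1) not_self by (intro sum_mono2) auto
        also have "\<dots> = 2 * ?a x - ?b z" using sb sum.remove[OF Z(1) z, of ?b] by simp
        finally show ?thesis by simp
      qed
      have "excess E c \<le> 2 + (dl x + dl y) + \<rho> \<or> excess E c \<le> 2 + 5 / 4 * (dl x + dl y)"
      proof (rule pair_centers[OF k2 cy K leaves])
        show "dl x + dl y - \<rho> \<le> 2 / 3" using small br \<rho>_nonneg by linarith
      qed (use x y d2 b1 d3 dy in auto)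
      then show ?thesis by (rule disjE) (use small br \<rho>_nonneg branching_pos cy in \<open>simp add: field_simps\<close>)+
    next
      assume d4: "dK x = 4"
      let ?Z = "K - {x}"
      have Z: "finite ?Z" "card ?Z = 4" using finite_K x(1) K by auto
      have d2: "dK z = 2" if "z \<in> ?Z" for z
      proof -
        have "(\<Sum>v\<in>?Z. real (dK v) - 2) = 0" using rest d4 by simp
        then have "\<forall>v\<in>?Z. real (dK v) - 2 = 0"
          using core_deg finite_K by (subst (asm) sum_nonneg_eq_0_iff) auto
        then show ?thesis using that by auto
      qed
      have Nx: "E `` {x} \<inter> K = ?Z"
        using d4 Z not_self by (intro card_subset_eq) auto
      then have zx: "(z, x) \<in> E" "(x, z) \<in> E" if "z \<in> ?Z" for z using that E_commute by auto
      have "branching = (\<Sum>v\<in>{x}. 2 * dl v)"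
        unfolding branching_def using x d2 finite_K d4 by (intro sum.mono_neutral_cong_right) auto
      then have br: "branching = 2 * dl x" by simp
      have xV: "x \<in> V" using x K_sub by auto
      have dx: "0 < dl x" using dl_pos[OF xV] .
      have dx': "dl x + \<rho> \<le> 1 / 3" using small br by (simp add: field_simps)
      have rZ: "(\<Sum>z\<in>?Z. r z) = 1 + dl x - \<rho>"
        using sum_core_diag k2 sum.remove[OF finite_K x(1), of r] by simp
      show ?thesis
      proof (cases "\<forall>z\<in>?Z. r z \<le> 2 / 3")
        case True
        have U: "{x} \<subseteq> K" using x by auto
        have ax: "E `` {x} \<inter> {x} = {}" using not_self by auto
        have a1: "card (E `` {z} \<inter> {x}) = 1" if "z \<in> ?Z" for z
        proof -
          have "E `` {z} \<inter> {x} = {x}" using zx[OF that] by auto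
          then show ?thesis by simp
        qed
        have b1: "card (E `` {z} \<inter> ?Z) = 1" if "z \<in> ?Z" for z
          using card_NK_split[OF U, of z] a1[OF that] d2[OF that] by simp
        have "(\<Sum>z\<in>?Z. real (card (E `` {z} \<inter> {x})) * r z + real (card (E `` {z} \<inter> ?Z)) * (2 * r z - 1 / 2))
          = (\<Sum>z\<in>?Z. 3 * r z - 1 / 2)"
          using a1 b1 by (intro sum.cong refl) simp
        also have "\<dots> = 3 * (1 + dl x - \<rho>) - 2"
          using Z rZ by (simp add: sum_subtractf sum_distrib_left[symmetric])
        finally have "excess E c \<le> 3 * (1 + dl x - \<rho>) - 2 + r x + 3 * \<rho>"
          using sinks[OF U _ leaves] True ax unfolding sum_wt[OF U] by simp
        then show ?thesis using dx' \<rho>_nonneg by simp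
      next
        case False
        \<comment> \<open>Now \<open>dl a < 1 / 3\<close>, so \<open>a\<close> is as good a centre
          as \<open>x\<close>; its core degree 2 and the degree 4 of \<open>x\<close> again add up
          to 6.\<close>
        then obtain a where a: "a \<in> ?Z" "2 / 3 < r a" by (auto simp: not_le)
        let ?W = "K - {x, a}"
        have b1: "card (E `` {z} \<inter> ?W) \<le> card (E `` {x} \<inter> {x, a})" if z: "z \<in> ?W" for z
        proof -
          have "E `` {x} \<inter> {x, a} = {a}" using zx a not_self by auto
          moreover have "dK z = card (E `` {z} \<inter> {x}) + card (E `` {z} \<inter> ?Z)"
            by (rule card_NK_split) (use x in auto)
          moreover have "E `` {z} \<inter> {x} = {x}" using zx z by auto
          moreover have "card (E `` {z} \<inter> ?W) \<le> card (E `` {z} \<inter> ?Z)" using Z by (intro card_mono) auto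
          ultimately show ?thesis using d2[of z] z by simp
        qed
        have "excess E c \<le> 2 + (dl x + dl a) + \<rho> \<or> excess E c \<le> 2 + 5 / 4 * (dl x + dl a)"
        proof (rule pair_centers[OF k2 cy K leaves])
          show "dl x + dl a - \<rho> \<le> 2 / 3" using dx' a(2) \<rho>_nonneg by linarith
        qed (use x a d2 b1 d4 in auto)
        then show ?thesis by (rule disjE) (use dx' a(2) \<rho>_nonneg in \<open>simp add: field_simps\<close>)+
      qed
    qed
  qed
qed

end

section \<open>Cores and bridges\<close>

context sgraph
begin

text \<open>\<open>d\<close> is the distance to \<open>K\<close> and the parent is the next vertex
  on a shortest walk there.\<close>

lemma parents_exist:
  assumes conn: "conn V E" and K: "K \<subseteq> V" "K \<noteq> {}"
  shows "\<exists>par (d :: 'a \<Rightarrow> nat). \<forall>v\<in>V - K. (v, par v) \<in> E \<and> d (par v) < d v"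
proof -
  define P where "P v n \<longleftrightarrow> (\<exists>w\<in>K. (v, w) \<in> E ^^ n)" for v n
  define d where "d v = (LEAST n. P v n)" for v
  obtain w where w: "w \<in> K" using K by auto
  have ex: "\<exists>n. P v n" if "v \<in> V" for v
  proof (rule conn_closed[OF conn _ _ _ that])
    show "w \<in> V" using w K by auto
    have "(w, w) \<in> E ^^ 0" by simp
    then show "\<exists>n. P w n" using w unfolding P_def by blast
    fix a b assume "(a, b) \<in> E" "\<exists>n. P a n"
    then obtain n z where "z \<in> K" "(a, z) \<in> E ^^ n" unfolding P_def by auto
    then have "(b, z) \<in> E ^^ Suc n" by (intro relpow_Suc_I2[OF E_commute[OF \<open>(a, b) \<in> E\<close>]])
    then show "\<exists>n. P b n" using \<open>z \<in> K\<close> unfolding P_def by blast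
  qed
  have "\<exists>u. (v, u) \<in> E \<and> d u < d v" if v: "v \<in> V - K" for v
  proof -
    have "P v (d v)" unfolding d_def using ex[of v] v by (auto intro: LeastI_ex)
    then obtain z where z: "z \<in> K" "(v, z) \<in> E ^^ d v" unfolding P_def by auto
    then obtain m where m: "d v = Suc m" using v by (cases "d v") auto
    then obtain u where u: "(v, u) \<in> E" "(u, z) \<in> E ^^ m" using z by (metis relpow_Suc_D2)
    then have "d u \<le> m" unfolding d_def using z(1) by (intro Least_le) (auto simp: P_def)
    then show ?thesis using u m by auto
  qed
  then have "\<exists>par. \<forall>v\<in>V - K. (v, par v) \<in> E \<and> d (par v) < d v" by metis
  then show ?thesis by blast
qed

text \<open>\<open>K\<close> is a nonempty set of least size that spans at least
  \<open>card K + cy - 1\<close> edges. Deleting a vertex with at most one neighbour in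
  \<open>K\<close> would keep this inequality, so minimality gives degree at least 2. Together with
  one parent edge for each outside vertex these edges already reach the total, so the inequality is
  an equality and there are no further edges.\<close>

lemma core_exists:
  assumes conn: "conn V E" and ne: "V \<noteq> {}" and card: "card E + 2 = 2 * (card V + cy)" and cy: "1 \<le> cy"
  obtains K par and d :: "'a \<Rightarrow> nat" where "K \<subseteq> V" "3 \<le> card K"
    "\<And>v. v \<in> V - K \<Longrightarrow> (v, par v) \<in> E" "\<And>v. v \<in> V - K \<Longrightarrow> d (par v) < d v"
    "E = (E \<inter> K \<times> K) \<union> (\<lambda>v. (v, par v)) ` (V - K) \<union> (\<lambda>v. (par v, v)) ` (V - K)"
    "\<And>v. v \<in> K \<Longrightarrow> 2 \<le> card (E `` {v} \<inter> K)" "card (E \<inter> K \<times> K) + 2 = 2 * (card K + cy)"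
proof -
  define P where "P K \<longleftrightarrow> K \<subseteq> V \<and> K \<noteq> {} \<and> 2 * (card K + cy) \<le> card (E \<inter> K \<times> K) + 2" for K
  have "E \<inter> V \<times> V = E" using E_sub by auto
  then have "P V" unfolding P_def using ne card by simp
  then obtain K where K: "P K" and min: "\<And>K'. P K' \<Longrightarrow> card K \<le> card K'"
    using ex_has_least_nat[of P V card] by auto
  have KV: "K \<subseteq> V" "K \<noteq> {}" and Kc: "2 * (card K + cy) \<le> card (E \<inter> K \<times> K) + 2" using K by (auto simp: P_def)
  have finK: "finite K" using finite_subset[OF KV(1) finite_V] .
  obtain par d where "\<forall>v\<in>V - K. (v, par v) \<in> E \<and> d (par v) < (d v :: nat)"
    using parents_exist[OF conn KV] by blast
  then have par: "\<And>v. v \<in> V - K \<Longrightarrow> (v, par v) \<in> E" "\<And>v. v \<in> V - K \<Longrightarrow> d (par v) < d v" by auto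
  let ?A = "E \<inter> K \<times> K" and ?B = "(\<lambda>v. (v, par v)) ` (V - K)" and ?C = "(\<lambda>v. (par v, v)) ` (V - K)"
  have fin: "finite ?A" "finite ?B" "finite ?C" using finite_E finite_V by auto
  have d1: "?A \<inter> ?B = {}" by auto
  have d2: "(?A \<union> ?B) \<inter> ?C = {}"
  proof -
    have False if "v \<in> V - K" "w \<in> V - K" "(v, par v) = (par w, w)" for v w
      using par(2)[OF that(1)] par(2)[OF that(2)] that(3) by auto
    then show ?thesis by blast
  qed
  have "card (?A \<union> ?B \<union> ?C) = card (?A \<union> ?B) + card ?C" by (rule card_Un_disjoint) (use fin d2 in auto)
  also have "card (?A \<union> ?B) = card ?A + card ?B" by (rule card_Un_disjoint) (use fin d1 in auto)
  also have "card ?B = card (V - K)" by (rule card_image) (simp add: inj_on_def)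
  also have "card ?C = card (V - K)" by (rule card_image) (simp add: inj_on_def)
  finally have cU: "card (?A \<union> ?B \<union> ?C) = card ?A + 2 * card (V - K)" by simp
  have sub: "?A \<union> ?B \<union> ?C \<subseteq> E" using par(1) E_commute by auto
  have VK: "card (V - K) + card K = card V" using KV finite_V finK by (simp add: card_Diff_subset card_mono)
  have "card ?A + 2 * card (V - K) \<le> card E" using card_mono[OF finite_E sub] cU by simp
  then have Aeq: "card ?A + 2 = 2 * (card K + cy)" using Kc card VK by simp
  then have "card (?A \<union> ?B \<union> ?C) = card E" using cU card VK by simp
  then have Eq: "E = ?A \<union> ?B \<union> ?C" using card_subset_eq[OF finite_E sub] by simp
  have deg: "2 \<le> card (N v \<inter> K)" if v: "v \<in> K" for v
  proof (rule ccontr)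
    assume "\<not> ?thesis"
    then have le: "card (N v \<inter> K) \<le> 1" by simp
    let ?K = "K - {v}" and ?Nv = "N v \<inter> K"
    have "?A \<subseteq> (E \<inter> ?K \<times> ?K) \<union> {v} \<times> ?Nv \<union> ?Nv \<times> {v}" using E_commute by auto
    then have "card ?A \<le> card ((E \<inter> ?K \<times> ?K) \<union> {v} \<times> ?Nv \<union> ?Nv \<times> {v})"
      using finite_E finK by (intro card_mono) auto
    also have "\<dots> \<le> card (E \<inter> ?K \<times> ?K) + card ({v} \<times> ?Nv) + card (?Nv \<times> {v})"
      by (meson add_le_mono1 card_Un_le order_trans)
    also have "\<dots> \<le> card (E \<inter> ?K \<times> ?K) + 2" using le by (simp add: card_cartesian_product)
    finally have A: "card ?A \<le> card (E \<inter> ?K \<times> ?K) + 2" .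
    have cK: "card ?K + 1 = card K" using v finK by (metis card_Suc_Diff1 Suc_eq_plus1)
    have "?K \<noteq> {}"
    proof
      assume "?K = {}"
      then have "K = {v}" using v by auto
      then have "?A = {}" using not_self by auto
      then have "card ?A = 0" by simp
      then show False using Aeq cy \<open>K = {v}\<close> by simp
    qed
    then have "P ?K" unfolding P_def using KV A Aeq cK by auto
    then show False using min[of ?K] cK by simp
  qed
  obtain v where v: "v \<in> K" using KV by auto
  have "card (N v \<inter> K) \<le> card (K - {v})" using finK not_self by (intro card_mono) auto
  then have K3: "3 \<le> card K" using deg[OF v] v finK card_Suc_Diff1[OF finK v] by linarith
  show ?thesis
    by (rule that[of K par d]) (use KV(1) K3 par Eq deg Aeq in blast)+
qed

lemma energy_le_card: "ip V y (app V (lapl E) y) \<le> card V * ip V y y"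
proof -
  let ?f = "\<lambda>p. (y (fst p) - y (snd p))\<^sup>2"
  have "(\<Sum>p\<in>V \<times> V. ?f p) = (\<Sum>u\<in>V. \<Sum>v\<in>V. (y u)\<^sup>2 + (y v)\<^sup>2 - 2 * y u * y v)"
    by (simp add: sum.cartesian_product split_def power2_diff)
  also have "\<dots> = 2 * (card V * ip V y y) - 2 * (\<Sum>v\<in>V. y v)\<^sup>2"
    by (simp add: sum.distrib sum_subtractf ip_def power2_eq_square[symmetric] sum_distrib_left[symmetric]
        sum_distrib_right[symmetric])
  finally have "(\<Sum>p\<in>V \<times> V. ?f p) \<le> 2 * (card V * ip V y y)" by simp
  moreover have "(\<Sum>p\<in>E. ?f p) \<le> (\<Sum>p\<in>V \<times> V. ?f p)"
    using E_sub finite_V by (intro sum_mono2) auto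
  ultimately show ?thesis by (simp add: energy split_def)
qed

lemma induced: "W \<subseteq> V \<Longrightarrow> sgraph W (E \<inter> W \<times> W)"
  using finite_subset[OF _ finite_V] E_sym E_irrefl
  by unfold_locales (auto simp: sym_def irrefl_def)

end

section \<open>Cutting a graph at a bridge\<close>

text \<open>Restricted to a part, an eigenvector of the disjoint union is 0 or an eigenvector with
  the same eigenvalue. Either the two vectors are nonzero on different parts, and each eigenvalue is
  at most the size of its part, or both live on one part and form an orthonormal pair there.\<close>

lemma two_components:
  assumes g1: "sgraph V1 E1" and g2: "sgraph V2 E2" and disj: "V1 \<inter> V2 = {}"
    and basis: "eigenbasis (V1 \<union> V2) (lapl (E1 \<union> E2)) x \<mu>" and n2: "2 \<le> card (V1 \<union> V2)"
    and b1: "\<And>y. orthonormal V1 2 y \<Longrightarrow> (\<Sum>i<2. ip V1 (y i) (app V1 (lapl E1) (y i))) \<le> b"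
    and b2: "\<And>y. orthonormal V2 2 y \<Longrightarrow> (\<Sum>i<2. ip V2 (y i) (app V2 (lapl E2) (y i))) \<le> b"
    and b: "real (card V1) + real (card V2) \<le> b"
  shows "\<mu> 0 + \<mu> 1 \<le> b"
proof -
  interpret G1: sgraph V1 E1 by (rule g1)
  interpret G2: sgraph V2 E2 by (rule g2)
  interpret G: sgraph "V1 \<union> V2" "E1 \<union> E2"
    using G1.finite_V G2.finite_V G1.E_sub G2.E_sub G1.E_sym G2.E_sym G1.E_irrefl G2.E_irrefl
    by unfold_locales (auto simp: sym_Un irrefl_def)
  interpret spectrum "V1 \<union> V2" "E1 \<union> E2" x \<mu> by unfold_locales (rule basis)
  have ip: "ip (V1 \<union> V2) f h = ip V1 f h + ip V2 f h" for f h
    unfolding ip_def using disj G1.finite_V G2.finite_V by (intro sum.union_disjoint)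
  have e1: "app V1 (lapl E1) (x i) v = \<mu> i * x i v" if "i < 2" "v \<in> V1" for i v
  proof -
    have "(E1 \<union> E2) `` {v} = E1 `` {v}" using that disj G2.E_sub by auto
    then show ?thesis using eigen[of i v] that n2 by (simp add: G1.app_lapl)
  qed
  have e2: "app V2 (lapl E2) (x i) v = \<mu> i * x i v" if "i < 2" "v \<in> V2" for i v
  proof -
    have "(E1 \<union> E2) `` {v} = E2 `` {v}" using that disj G1.E_sub by auto
    then show ?thesis using eigen[of i v] that n2 by (simp add: G2.app_lapl)
  qed
  have v1: "ip V1 (x i) (app V1 (lapl E1) (x i)) = \<mu> i * ip V1 (x i) (x i)" if "i < 2" for i
    unfolding ip_scale_right[symmetric] by (rule ip_cong) (simp_all add: e1 that)
  have v2: "ip V2 (x i) (app V2 (lapl E2) (x i)) = \<mu> i * ip V2 (x i) (x i)" if "i < 2" for i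
    unfolding ip_scale_right[symmetric] by (rule ip_cong) (simp_all add: e2 that)
  have m1: "\<mu> i \<le> card V1" if "i < 2" "ip V1 (x i) (x i) \<noteq> 0" for i
  proof -
    have "0 < ip V1 (x i) (x i)" using that(2) ip_nonneg[of V1 "x i"] by simp
    then show ?thesis using G1.energy_le_card[of "x i"] v1[OF that(1)] by simp
  qed
  have m2: "\<mu> i \<le> card V2" if "i < 2" "ip V2 (x i) (x i) \<noteq> 0" for i
  proof -
    have "0 < ip V2 (x i) (x i)" using that(2) ip_nonneg[of V2 "x i"] by simp
    then show ?thesis using G2.energy_le_card[of "x i"] v2[OF that(1)] by simp
  qed
  have xx: "ip V1 (x i) (x j) + ip V2 (x i) (x j) = (if i = j then 1 else 0)" if "i < 2" "j < 2" for i j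
    using x_ip[of i j] that n2 ip by simp
  have z1: "ip V1 (x i) h = 0" if "ip V1 (x i) (x i) = 0" for i h
    using that G1.finite_V by (simp add: ip_eq_0_iff) (simp add: ip_def)
  have z2: "ip V2 (x i) h = 0" if "ip V2 (x i) (x i) = 0" for i h
    using that G2.finite_V by (simp add: ip_eq_0_iff) (simp add: ip_def)
  have s2: "(\<Sum>i<2. f i) = f 0 + f 1" for f :: "nat \<Rightarrow> real" by (simp add: numeral_2_eq_2)
  consider "ip V1 (x 0) (x 0) \<noteq> 0" "ip V2 (x 1) (x 1) \<noteq> 0"
    | "ip V2 (x 0) (x 0) \<noteq> 0" "ip V1 (x 1) (x 1) \<noteq> 0"
    | "\<forall>i<2. ip V2 (x i) (x i) = 0" | "\<forall>i<2. ip V1 (x i) (x i) = 0"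
    using xx[of 0 0] xx[of 1 1] by (force simp: numeral_2_eq_2 less_Suc_eq)
  then show ?thesis
  proof cases
    case 1 then show ?thesis using m1[of 0] m2[of 1] b by simp
  next
    case 2 then show ?thesis using m1[of 1] m2[of 0] b by simp
  next
    case 3
    have o: "orthonormal V1 2 x" unfolding orthonormal_def using xx z2 3 by auto
    show ?thesis using b1[OF o] v1 o unfolding s2 by (simp add: orthonormal_def)
  next
    case 4
    have o: "orthonormal V2 2 x" unfolding orthonormal_def using xx z1 4 by auto
    show ?thesis using b2[OF o] v2 o unfolding s2 by (simp add: orthonormal_def)
  qed
qed

text \<open>Without the bridge the sum is at most \<open>b\<close>, and the bridge adds at most 2.
  Since \<open>card V \<le> e1 + e2 + 1\<close> and \<open>e1 \<ge> 3\<close>, the target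
  \<open>e1 + e2 + 4\<close> can be reached only through \<open>e1 + 3\<close> with
  \<open>e2 = 1\<close>; then \<open>D\<close> is a single edge and the bridge vector lies in the
  span of the two eigenvectors, which the eigenvalue equations refute.\<close>

lemma bridge_bound:
  assumes g: "sgraph V E" and card: "card E + 2 = 2 * (card V + cy)" and cy: "1 \<le> cy"
    and basis: "eigenbasis V (lapl E) x \<mu>"
    and D: "D \<subseteq> V" "v \<in> D" "p \<in> V - D" "(v, p) \<in> E" "2 \<le> card D" "3 \<le> card (V - D)"
    and only: "\<And>a b. a \<in> D \<Longrightarrow> b \<in> V - D \<Longrightarrow> (a, b) \<in> E \<Longrightarrow> a = v \<and> b = p"
    and cardD: "card (E \<inter> D \<times> D) + 2 = 2 * card D"
    and degD: "\<And>y. y \<in> D \<Longrightarrow> \<exists>z\<in>D. (y, z) \<in> E"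
    and IH: "\<And>y \<nu>. eigenbasis (V - D) (lapl (E \<inter> (V - D) \<times> (V - D))) y \<nu> \<Longrightarrow>
      \<nu> 0 + \<nu> 1 \<le> card (E \<inter> (V - D) \<times> (V - D)) / 2 + 3"
  shows "\<mu> 0 + \<mu> 1 < card E / 2 + 3"
proof -
  interpret spectrum V E x \<mu> using g basis by (simp add: spectrum_def spectrum_axioms_def)
  let ?V1 = "V - D" and ?E1 = "E \<inter> (V - D) \<times> (V - D)" and ?E2 = "E \<inter> D \<times> D"
  have g1: "sgraph ?V1 ?E1" by (rule induced) auto
  have g2: "sgraph D ?E2" by (rule induced[OF D(1)])
  interpret G1: sgraph ?V1 ?E1 by (rule g1)
  interpret G2: sgraph D ?E2 by (rule g2)
  have V: "?V1 \<union> D = V" "?V1 \<inter> D = {}" using D by auto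
  have nV: "card ?V1 + card D = card V" using D(1) finite_V G2.finite_V by (simp add: card_Diff_subset card_mono)
  have gU: "sgraph V (?E1 \<union> ?E2)"
    using finite_V E_sub D(1) E_sym E_irrefl by unfold_locales (auto simp: sym_def irrefl_def)
  interpret GU: sgraph V "?E1 \<union> ?E2" by (rule gU)
  obtain z \<zeta> where z: "eigenbasis V (lapl (?E1 \<union> ?E2)) z \<zeta>" using GU.eigenbasis_exists_lapl by auto
  have Eq: "E = (?E1 \<union> ?E2) \<union> {(v, p), (p, v)}"
  proof (intro equalityI subrelI)
    fix a b assume ab: "(a, b) \<in> E"
    then have "a \<in> V" "b \<in> V" by (auto dest: E_in)
    then show "(a, b) \<in> (?E1 \<union> ?E2) \<union> {(v, p), (p, v)}"
      using ab only[of a b] only[of b a] E_commute[OF ab] by auto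
  next
    fix a b assume "(a, b) \<in> (?E1 \<union> ?E2) \<union> {(v, p), (p, v)}"
    then show "(a, b) \<in> E" using D(4) E_commute by auto
  qed
  have dis: "(?E1 \<union> ?E2) \<inter> {(v, p), (p, v)} = {}" using D by auto
  have vp: "v \<noteq> p" using D by auto
  have cE: "card E = card ?E1 + card ?E2 + 2"
  proof -
    have "card E = card ((?E1 \<union> ?E2) \<union> {(v, p), (p, v)})" by (rule arg_cong[OF Eq])
    also have "\<dots> = card (?E1 \<union> ?E2) + card {(v, p), (p, v)}"
      by (rule card_Un_disjoint) (use finite_E dis in auto)
    also have "card (?E1 \<union> ?E2) = card ?E1 + card ?E2"
      by (rule card_Un_disjoint) (use finite_E in auto)
    finally show ?thesis using vp by simp
  qed
  have s2: "(\<Sum>i<2. f i) = f 0 + f 1" for f :: "nat \<Rightarrow> real" by (simp add: numeral_2_eq_2)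
  define e1 e2 where "e1 = real (card ?E1) / 2" and "e2 = real (card ?E2) / 2"
  have eD: "e2 = real (card D) - 1" using cardD by (simp add: e2_def field_simps)
  have ee: "card E / 2 = e1 + e2 + 1" using cE by (simp add: e1_def e2_def)
  have nE: "card E / 2 = real (card V) + cy - 1" using card by (simp add: field_simps)
  define b where "b = max (real (card V)) (max (e1 + 3) (e2 + 3))"
  have b1: "(\<Sum>i<2. ip ?V1 (y i) (app ?V1 (lapl ?E1) (y i))) \<le> b" if y: "orthonormal ?V1 2 y" for y
  proof -
    obtain y1 \<nu> where y1: "eigenbasis ?V1 (lapl ?E1) y1 \<nu>" using G1.eigenbasis_exists_lapl by auto
    show ?thesis using ky_fan[OF G1.finite_V y1 y] IH[OF y1] unfolding s2 b_def e1_def by simp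
  qed
  have b2: "(\<Sum>i<2. ip D (y i) (app D (lapl ?E2) (y i))) \<le> b" if y: "orthonormal D 2 y" for y
  proof -
    obtain y2 \<nu> where y2: "eigenbasis D (lapl ?E2) y2 \<nu>" using G2.eigenbasis_exists_lapl by auto
    interpret S2: spectrum D ?E2 y2 \<nu> using g2 y2 by (simp add: spectrum_def spectrum_axioms_def)
    have "\<nu> 0 + \<nu> 1 \<le> e2 + 3"
    \<comment> \<open>The incidence bound divides by the eigenvalues, and for
      \<open>card D = 2\<close> the second one is 0.\<close>
    proof (cases "0 < \<nu> 1")
      case True
      have pos: "0 < \<nu> i" if "i < 2" for i using True S2.\<mu>_mono[of i 1] D(5) that by (simp add: less_2_cases_iff)
      have "0 < card (?E2 `` {y})" if "y \<in> D" for y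
        using degD[OF that] that G2.finite_N[of y] by (auto simp: card_gt_0_iff)
      then have "\<nu> 0 + \<nu> 1 \<le> 2 * 2 + real (card ?E2) - real (card D)"
        using S2.excess_le_incidence[of 2] D(5) pos unfolding s2 by simp
      moreover have "real (card ?E2) = 2 * e2" by (simp add: e2_def)
      ultimately show ?thesis using eD by simp
    next
      case False
      have "\<nu> 0 = ip D (y2 0) (app D (lapl ?E2) (y2 0))" using eigenbasis_value[OF y2, of 0] D(5) by simp
      also have "\<dots> \<le> card D" using G2.energy_le_card[of "y2 0"] S2.x_ip[of 0 0] D(5) by simp
      finally show ?thesis using False eD by simp
    qed
    then show ?thesis using ky_fan[OF G2.finite_V y2 y] unfolding s2 b_def by simp
  qed
  have n2: "2 \<le> card V" using nV D by simp
  have "\<zeta> 0 + \<zeta> 1 \<le> b"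
    by (rule two_components[OF g1 g2 V(2) _ _ b1 b2])
      (use z V n2 nV in \<open>auto simp: b_def of_nat_add[symmetric] simp del: of_nat_add\<close>)
  moreover have x2: "orthonormal V 2 x" by (rule orthonormal_subset[OF x_ortho n2])
  ultimately have U: "(\<Sum>i<2. ip V (x i) (app V (lapl (?E1 \<union> ?E2)) (x i))) \<le> b"
    using ky_fan[OF finite_V z x2] unfolding s2 by simp
  define bt where "bt i = x i v - x i p" for i
  have en: "\<mu> i = (bt i)\<^sup>2 + ip V (x i) (app V (lapl (?E1 \<union> ?E2)) (x i))" if "i < 2" for i
  proof -
    have "(\<Sum>q\<in>E. (x i (fst q) - x i (snd q))\<^sup>2)
        = (\<Sum>q\<in>?E1 \<union> ?E2. (x i (fst q) - x i (snd q))\<^sup>2) + (\<Sum>q\<in>{(v, p), (p, v)}. (x i (fst q) - x i (snd q))\<^sup>2)"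
      by (subst (1) Eq, rule sum.union_disjoint) (use finite_E dis in auto)
    also have "(\<Sum>q\<in>{(v, p), (p, v)}. (x i (fst q) - x i (snd q))\<^sup>2) = 2 * (bt i)\<^sup>2"
      using vp by (simp add: bt_def power2_commute)
    finally show ?thesis using \<mu>_energy[of i] that n2 by (simp add: GU.energy split_def)
  qed
  \<comment> \<open>\<open>ip V f h\<close> is the difference of \<open>f\<close> across the bridge,
    so by Bessel the squared length 2 of \<open>h\<close> bounds the energy of both eigenvectors on
    the bridge.\<close>
  define h :: "'a \<Rightarrow> real" where "h = (\<lambda>u. if u = v then 1 else if u = p then - 1 else 0)"
  have pV: "p \<in> V" "v \<in> V" using D by auto
  have ih: "ip V f h = f v - f p" for f
  proof -
    have "ip V f h = (\<Sum>u\<in>V. (if u = v then f u else 0) - (if u = p then f u else 0))"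
      unfolding ip_def h_def using vp by (intro sum.cong refl) auto
    then show ?thesis using finite_V pV by (simp add: sum_subtractf)
  qed
  have hh: "ip V h h = 2" unfolding ih using vp by (simp add: h_def)
  have bs: "(bt 0)\<^sup>2 + (bt 1)\<^sup>2 \<le> 2"
    using bessel[OF x2, of h] hh unfolding ih s2 bt_def by simp
  have tot: "\<mu> 0 + \<mu> 1 = (bt 0)\<^sup>2 + (bt 1)\<^sup>2 + (\<Sum>i<2. ip V (x i) (app V (lapl (?E1 \<union> ?E2)) (x i)))"
    using en[of 0] en[of 1] unfolding s2 by simp
  have cy': "1 \<le> real cy" using cy by simp
  have e1': "3 \<le> e1"
    using ee nE eD nV D(6) cy' by linarith
  have e2': "1 \<le> e2" using eD D(5) by simp
  show ?thesis
  proof (rule ccontr)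
    assume neg: "\<not> ?thesis"
    then have ge: "e1 + e2 + 4 \<le> \<mu> 0 + \<mu> 1" using ee by simp
    have "b \<le> e1 + 3 \<or> b \<le> e1 + e2 + 1"
      unfolding b_def using ee nE cy' e1' by auto
    then have e21: "e2 = 1" and full: "(bt 0)\<^sup>2 + (bt 1)\<^sup>2 = 2"
      using ge tot U bs e2' by linarith+
    then have "card D = 2" using eD by simp
    then obtain w where w: "D = {v, w}" "w \<noteq> v" using D(2) by (auto simp: card_2_iff)
    have "(v, w) \<in> E" using degD[OF D(2)] w not_self by auto
    have Nw: "N w = {v}"
    proof -
      have "y = v" if wy: "(w, y) \<in> E" for y
      proof -
        have "w \<in> D" "y \<in> V" "y \<noteq> w" using w(1) E_in[OF wy] wy not_self by auto
        then have "y \<in> D" using only[OF _ _ wy] w(2) by blast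
        then show ?thesis using w(1) \<open>y \<noteq> w\<close> by blast
      qed
      then show ?thesis using E_commute[OF \<open>(v, w) \<in> E\<close>] by blast
    qed
    have Nv: "N v = {w, p}"
    proof -
      have "y = w \<or> y = p" if vy: "(v, y) \<in> E" for y
      proof -
        have "y \<in> V" "y \<noteq> v" using E_in[OF vy] vy not_self by auto
        then show ?thesis using only[OF D(2) _ vy] w(1) by blast
      qed
      then show ?thesis using \<open>(v, w) \<in> E\<close> D(4) by blast
    qed
    have wV: "w \<in> V" and wp: "w \<noteq> p" using w D by auto
    have ew: "x i v = (1 - \<mu> i) * x i w" if "i < 2" for i
      using eigen[of i w] that n2 wV Nw by (simp add: algebra_simps)
    have ev: "x i p = (2 - \<mu> i) * x i v - x i w" if "i < 2" for i
      using eigen[of i v] that n2 pV Nv wp by (simp add: algebra_simps)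
    have "ip V (\<lambda>u. h u - (\<Sum>i<2. ip V (x i) h * x i u)) (\<lambda>u. h u - (\<Sum>i<2. ip V (x i) h * x i u)) = 0"
      unfolding bessel_remainder[OF x2] hh using full by (simp add: ih s2 bt_def)
    then have hx: "h u = bt 0 * x 0 u + bt 1 * x 1 u" if "u \<in> V" for u
      using that finite_V by (simp add: ip_eq_0_iff ih s2 bt_def)
    \<comment> \<open>\<open>h = bt 0 * x 0 + bt 1 * x 1\<close> has the values 0, 1, -1 at
      \<open>w\<close>, \<open>v\<close>, \<open>p\<close>. With \<open>ew\<close> and
      \<open>ev\<close> these are three linear equations for \<open>A\<close> and \<open>B\<close>;
      they are consistent only if \<open>\<mu> 0 + \<mu> 1 = 4\<close>, whereas the assumption needs
      at least 8.\<close>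
    define A B where "A = bt 0 * x 0 w" and "B = bt 1 * x 1 w"
    have 1: "A + B = 0" using hx[OF wV] w wp by (simp add: h_def A_def B_def)
    have 2: "(1 - \<mu> 0) * A + (1 - \<mu> 1) * B = 1"
    proof -
      have "(1 - \<mu> 0) * A + (1 - \<mu> 1) * B = bt 0 * ((1 - \<mu> 0) * x 0 w) + bt 1 * ((1 - \<mu> 1) * x 1 w)"
        unfolding A_def B_def by (simp only: mult_ac)
      also have "\<dots> = bt 0 * x 0 v + bt 1 * x 1 v" using ew[of 0] ew[of 1] by simp
      finally show ?thesis using hx[OF pV(2)] by (simp add: h_def)
    qed
    have 3: "((2 - \<mu> 0) * (1 - \<mu> 0) - 1) * A + ((2 - \<mu> 1) * (1 - \<mu> 1) - 1) * B = - 1"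
    proof -
      have t: "((2 - \<mu> i) * (1 - \<mu> i) - 1) * (bt i * x i w) = bt i * x i p" if "i < 2" for i
        unfolding ev[OF that] ew[OF that] by (simp add: algebra_simps)
      have "(0::nat) < 2" "(1::nat) < 2" by simp_all
      then show ?thesis unfolding A_def B_def by (simp only: t) (use hx[OF pV(1)] vp in \<open>simp add: h_def\<close>)
    qed
    have B: "B = - A" using 1 by simp
    have 4: "(\<mu> 1 - \<mu> 0) * A = 1" using 2 unfolding B by (simp add: algebra_simps)
    have "(3 - \<mu> 0 - \<mu> 1) * ((\<mu> 1 - \<mu> 0) * A) = - 1" using 3 unfolding B by (simp add: algebra_simps)
    then have "\<mu> 0 + \<mu> 1 = 4" unfolding 4 by simp
    then show False using ge e1' e2' by simp
  qed
qed

section \<open>Cliques with pendant vertices\<close>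

text \<open>
  Here \<open>s = M - 1\<close> and \<open>\<nu> = M - card K\<close> for an eigenvalue \<open>M\<close>.  In this arrangement the subtracted
  expression on the right decreases in \<open>M\<close>, so comparing two solutions bounds their sum by
  \<open>\<nu>\<^sub>1 + \<nu>\<^sub>2 \<le> A + B + C\<close>.
\<close>

lemma secular_equation:
  fixes A B C s \<nu> S fa fb fc :: real
  assumes s: "2 < s" and \<nu>: "0 < \<nu>" and ne: "fa \<noteq> 0 \<or> fb \<noteq> 0 \<or> fc \<noteq> 0"
    and a: "(A * (1 + 1 / s) - \<nu>) * fa = S" and b: "(B * (1 + 1 / s) - \<nu>) * fb = S"
    and c: "(C * (1 + 1 / s) - \<nu>) * fc = S" and S: "S * (s - 2) = \<nu> * (fa + fb + fc)"
  shows "\<nu> * (A + B + C - \<nu>) = (A * B + B * C + C * A)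
    - ((A * B + B * C + C * A) / s\<^sup>2 + A * B * C * ((1 + 1 / s)\<^sup>2 * (s - 2) / (s * \<nu>)))"
proof -
  define p where "p = 1 + 1 / s"
  define A' B' C' where "A' = A * p - \<nu>" "B' = B * p - \<nu>" "C' = C * p - \<nu>"
  note eqs = a[folded p_def, folded A'_B'_C'_def] b[folded p_def, folded A'_B'_C'_def] c[folded p_def, folded A'_B'_C'_def]
  \<comment> \<open>For \<open>S \<noteq> 0\<close> this is the secular equation 1/A' + 1/B' + 1/C'
    = (s - 2)/\<nu> with cleared denominators. In this form it also holds for \<open>S = 0\<close>,
    where at least two of the factors vanish.\<close>
  have star: "\<nu> * (A' * B' + B' * C' + C' * A') = (s - 2) * (A' * B' * C')"
  proof (cases "S = 0")
    case True
    then have z: "fa + fb + fc = 0" using S \<nu> by simp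
    have "A' = 0 \<or> fa = 0" "B' = 0 \<or> fb = 0" "C' = 0 \<or> fc = 0" using eqs True by auto
    then have "A' = 0 \<and> B' = 0 \<or> B' = 0 \<and> C' = 0 \<or> C' = 0 \<and> A' = 0" using z ne by auto
    then show ?thesis by auto
  next
    case False
    then have nz: "A' \<noteq> 0" "B' \<noteq> 0" "C' \<noteq> 0" using eqs by auto
    then have "fa = S / A'" "fb = S / B'" "fc = S / C'" using eqs by (auto simp: field_simps)
    then have "S * (s - 2) = S * (\<nu> * (1 / A' + 1 / B' + 1 / C'))" using S by (simp add: algebra_simps)
    then have "s - 2 = \<nu> * (1 / A' + 1 / B' + 1 / C')" using False by simp
    then show ?thesis using nz by (simp add: field_simps)
  qed
  define e1 e2 e3 where "e1 = A + B + C" "e2 = A * B + B * C + C * A" "e3 = A * B * C"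
  have "(s - 2) * (A' * B' * C') - \<nu> * (A' * B' + B' * C' + C' * A')
    = e3 * p ^ 3 * (s - 2) - e2 * p\<^sup>2 * \<nu> * (s - 1) + e1 * \<nu>\<^sup>2 * (p * s) - \<nu> ^ 3 * (s + 1)"
    unfolding A'_B'_C'_def e1_e2_e3_def by (simp add: algebra_simps power2_eq_square power3_eq_cube)
  also have "p * s = s + 1" using s by (simp add: p_def field_simps)
  finally have P: "e3 * p ^ 3 * (s - 2) - e2 * p\<^sup>2 * \<nu> * (s - 1) + e1 * \<nu>\<^sup>2 * (s + 1) - \<nu> ^ 3 * (s + 1) = 0"
    using star by simp
  have "p * s = s + 1" using s by (simp add: p_def field_simps)
  then have "e3 * p ^ 3 * (s - 2) = \<nu> * (s + 1) * (e3 * (p\<^sup>2 * (s - 2) / (s * \<nu>)))"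
    using s \<nu> unfolding \<open>p * s = s + 1\<close>[symmetric] by (simp add: field_simps power2_eq_square power3_eq_cube)
  moreover have "e2 * p\<^sup>2 * \<nu> * (s - 1) = \<nu> * (s + 1) * (e2 - e2 / s\<^sup>2)"
    using s unfolding p_def by (simp add: field_simps power2_eq_square)
  ultimately have "\<nu> * (s + 1) * (e3 * (p\<^sup>2 * (s - 2) / (s * \<nu>)) - (e2 - e2 / s\<^sup>2) + e1 * \<nu> - \<nu>\<^sup>2) = 0"
    using P by (simp add: algebra_simps power2_eq_square power3_eq_cube)
  then have "e3 * (p\<^sup>2 * (s - 2) / (s * \<nu>)) - (e2 - e2 / s\<^sup>2) + e1 * \<nu> - \<nu>\<^sup>2 = 0"
    using s \<nu> by simp
  then show ?thesis
    unfolding p_def[symmetric] e1_e2_e3_def[symmetric] by (simp add: algebra_simps power2_eq_square)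
qed

text \<open>A product of three positive factors, none of which increases with the eigenvalue; the
  last one is (s - 2)/\<nu> = 1 + d/\<nu>.\<close>

lemma secular_decreasing:
  fixes s t \<nu> \<xi> :: real
  assumes s: "2 < t" "t < s" and \<nu>: "0 < \<xi>" "s - 2 = \<nu> + d" "t - 2 = \<xi> + d" and d: "0 \<le> d"
  shows "(1 + 1 / s)\<^sup>2 * (s - 2) / (s * \<nu>) \<le> (1 + 1 / t)\<^sup>2 * (t - 2) / (t * \<xi>)"
proof -
  have \<nu>\<xi>: "\<xi> < \<nu>" using s \<nu> by simp
  have "(1 + 1 / s)\<^sup>2 \<le> (1 + 1 / t)\<^sup>2" using s by (intro power_mono add_left_mono) (auto simp: frac_le)
  moreover have "1 / s \<le> 1 / t" using s by (simp add: frac_le)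
  moreover have "(s - 2) / \<nu> \<le> (t - 2) / \<xi>"
  proof -
    have "(s - 2) / \<nu> = 1 + d / \<nu>" "(t - 2) / \<xi> = 1 + d / \<xi>" using \<nu> \<nu>\<xi> by (simp_all add: field_simps)
    moreover have "d / \<nu> \<le> d / \<xi>" using d \<nu> \<nu>\<xi> by (intro divide_left_mono) auto
    ultimately show ?thesis by simp
  qed
  ultimately have "(1 + 1 / s)\<^sup>2 * (1 / s) * ((s - 2) / \<nu>) \<le> (1 + 1 / t)\<^sup>2 * (1 / t) * ((t - 2) / \<xi>)"
    using s \<nu> \<nu>\<xi> by (intro mult_mono) auto
  then show ?thesis by simp
qed

definition clique_pendant_arcs :: "'a set \<Rightarrow> 'a set \<Rightarrow> ('a \<Rightarrow> 'a) \<Rightarrow> ('a \<times> 'a) set" where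
  "clique_pendant_arcs K P par =
     {(u, v) \<in> K \<times> K. u \<noteq> v} \<union> (\<lambda>y. (y, par y)) ` P \<union> (\<lambda>y. (par y, y)) ` P"

lemma card_clique_pendant_arcs:
  assumes "finite K" "finite P" "P \<inter> K = {}" "par ` P \<subseteq> K"
  shows "card (clique_pendant_arcs K P par) = card K * (card K - 1) + 2 * card P"
proof -
  let ?A = "{(u, v) \<in> K \<times> K. u \<noteq> v}" and ?B = "(\<lambda>y. (y, par y)) ` P" and ?C = "(\<lambda>y. (par y, y)) ` P"
  have A: "?A = Sigma K (\<lambda>u. K - {u})" by auto
  have cA: "card ?A = card K * (card K - 1)" unfolding A using assms(1) by simp
  have "finite ?A" unfolding A using assms(1) by auto
  then have "card (?A \<union> ?B \<union> ?C) = card (?A \<union> ?B) + card ?C"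
    using assms by (intro card_Un_disjoint) auto
  moreover have "card (?A \<union> ?B) = card ?A + card ?B"
    using assms \<open>finite ?A\<close> by (intro card_Un_disjoint) auto
  moreover have "card ?B = card P" "card ?C = card P" by (auto intro!: card_image inj_onI)
  ultimately show ?thesis unfolding clique_pendant_arcs_def using cA by simp
qed

text \<open>Allowing pendant vertices at only three clique vertices keeps the secular equation
  cubic. \<open>P\<close> may be smaller than \<open>V - K\<close>: deleting pendant edges leaves
  isolated vertices in \<open>V\<close>.\<close>

locale clique_pendants =
  fixes V K P :: "'a set" and par :: "'a \<Rightarrow> 'a" and a b c :: 'a
  assumes finV: "finite V" and K_sub: "K \<subseteq> V" and P_sub: "P \<subseteq> V - K"
    and par_in: "par ` P \<subseteq> {a, b, c}" and abc: "a \<in> K" "b \<in> K" "c \<in> K" "a \<noteq> b" "b \<noteq> c" "a \<noteq> c"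
    and card_K: "card K = 3 \<or> card K = 4"
begin

abbreviation "E \<equiv> clique_pendant_arcs K P par"

definition pend :: "'a \<Rightarrow> 'a set" where "pend u = {y \<in> P. par y = u}"

lemma finite_K: "finite K" using finite_subset[OF K_sub finV] .
lemma finite_P: "finite P" using finite_subset[OF P_sub] finV by simp
lemma par_K: "y \<in> P \<Longrightarrow> par y \<in> K" using par_in abc by auto

sublocale sgraph V E
proof
  show "finite V" by (rule finV)
  show "E \<subseteq> V \<times> V" unfolding clique_pendant_arcs_def using K_sub P_sub par_K by auto
  show "sym E" unfolding clique_pendant_arcs_def sym_def by auto
  show "irrefl E" unfolding clique_pendant_arcs_def irrefl_def using P_sub par_K by (auto, (metis DiffE subsetD)+)
qed

lemma N_P: "y \<in> P \<Longrightarrow> E `` {y} = {par y}"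
  unfolding clique_pendant_arcs_def using P_sub par_K by auto

lemma N_K: "u \<in> K \<Longrightarrow> E `` {u} = (K - {u}) \<union> pend u"
  unfolding clique_pendant_arcs_def pend_def using P_sub by auto

lemma N_isolated: "v \<in> V - K - P \<Longrightarrow> E `` {v} = {}"
  unfolding clique_pendant_arcs_def using par_K by auto

abbreviation "\<alpha> u \<equiv> real (card (pend u))"

lemma card_P: "real (card P) = \<alpha> a + \<alpha> b + \<alpha> c"
proof -
  have "P = pend a \<union> pend b \<union> pend c" unfolding pend_def using par_in by auto
  moreover have "card (pend a \<union> pend b \<union> pend c) = card (pend a \<union> pend b) + card (pend c)"
    unfolding pend_def using finite_P abc by (intro card_Un_disjoint) auto
  moreover have "card (pend a \<union> pend b) = card (pend a) + card (pend b)"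
    unfolding pend_def using finite_P abc by (intro card_Un_disjoint) auto
  ultimately show ?thesis by simp
qed

lemma \<alpha>_outside: "u \<in> K \<Longrightarrow> u \<notin> {a, b, c} \<Longrightarrow> \<alpha> u = 0"
proof -
  assume "u \<notin> {a, b, c}"
  then have "pend u = {}" unfolding pend_def using par_in by auto
  then show ?thesis by simp
qed

definition eig :: "real \<Rightarrow> ('a \<Rightarrow> real) \<Rightarrow> bool" where
  "eig M f \<longleftrightarrow> (\<forall>v\<in>V. (\<Sum>u\<in>E `` {v}. f v - f u) = M * f v)"

text \<open>A pendant vertex at \<open>u\<close> has the value \<open>- f u / (M - 1)\<close>.
  Eliminating these vertices leaves a system on \<open>K\<close> whose equations are coupled only
  through the sum over \<open>K\<close>.\<close>

lemma eig_core:
  assumes f: "eig M f" and M: "1 < M" and u: "u \<in> K"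
  shows "(\<alpha> u * (1 + 1 / (M - 1)) - (M - real (card K))) * f u = (\<Sum>w\<in>K. f w)"
proof -
  have leaf: "f y = - f u / (M - 1)" if "y \<in> pend u" for y
  proof -
    have "y \<in> P" "par y = u" using that by (auto simp: pend_def)
    then have "f y - f u = M * f y" using f N_P[of y] P_sub unfolding eig_def by force
    then show ?thesis using M by (simp add: field_simps)
  qed
  have "M * f u = (\<Sum>w\<in>E `` {u}. f u - f w)" using f u K_sub unfolding eig_def by force
  also have "\<dots> = (\<Sum>w\<in>(K - {u}) \<union> pend u. f u - f w)" by (simp only: N_K[OF u])
  also have "\<dots> = (\<Sum>w\<in>K - {u}. f u - f w) + (\<Sum>w\<in>pend u. f u - f w)"
    using finite_K finite_P P_sub by (intro sum.union_disjoint) (auto simp: pend_def)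
  also have "(\<Sum>w\<in>K - {u}. f u - f w) = (\<Sum>w\<in>K. f u - f w)"
    using sum.remove[OF finite_K u, of "\<lambda>w. f u - f w"] by simp
  also have "\<dots> = card K * f u - (\<Sum>w\<in>K. f w)" by (simp add: sum_subtractf)
  also have "(\<Sum>w\<in>pend u. f u - f w) = (\<Sum>w\<in>pend u. f u * (1 + 1 / (M - 1)))"
    by (intro sum.cong refl) (simp add: leaf algebra_simps)
  also have "\<dots> = \<alpha> u * (f u * (1 + 1 / (M - 1)))" by simp
  finally show ?thesis by (simp add: algebra_simps)
qed

lemma eig_zero:
  assumes f: "eig M f" and M: "1 < M" and z: "\<And>u. u \<in> K \<Longrightarrow> f u = 0" and v: "v \<in> V"
  shows "f v = 0"
proof -
  have e: "(\<Sum>u\<in>E `` {v}. f v - f u) = M * f v" using f v unfolding eig_def by auto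
  consider "v \<in> K" | "v \<in> P" | "v \<in> V - K - P" using v by auto
  then show ?thesis
  proof cases
    case 1 then show ?thesis by (rule z)
  next
    case 2
    then have "f v = M * f v" using e N_P[OF 2] z[OF par_K[OF 2]] by simp
    then show ?thesis using M by simp
  next
    case 3
    then have "M * f v = 0" using e N_isolated[OF 3] by simp
    then show ?thesis using M by simp
  qed
qed

text \<open>A clique vertex outside \<open>{a, b, c}\<close> has the value
  \<open>- (\<Sum>w\<in>K. f w) / (M - card K)\<close>. Its elimination gives the same factor
  \<open>M - 1 - 2\<close> for cliques of size 3 and 4, so one equation serves both.\<close>

lemma sum_K_abc:
  assumes f: "eig M f" and M: "real (card K) < M"
  shows "(\<Sum>w\<in>K. f w) * (M - 1 - 2) = (M - real (card K)) * (f a + f b + f c)"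
proof -
  let ?S = "\<Sum>w\<in>K. f w"
  have T: "{a, b, c} \<subseteq> K" "card {a, b, c} = 3" using abc by auto
  have M1: "1 < M" using M card_K by auto
  have "- (M - real (card K)) * f u = ?S" if "u \<in> K - {a, b, c}" for u
    using eig_core[OF f M1, of u] \<alpha>_outside[of u] that by simp
  then have "(\<Sum>u\<in>K - {a, b, c}. - (M - real (card K)) * f u) = (\<Sum>u\<in>K - {a, b, c}. ?S)" by (rule sum.cong[OF refl])
  also have "\<dots> = (real (card K) - 3) * ?S" using card_Diff_subset[OF _ T(1)] T(2) card_K by auto
  finally have "- (M - real (card K)) * (\<Sum>u\<in>K - {a, b, c}. f u) = (real (card K) - 3) * ?S"
    by (simp only: sum_distrib_left)
  then have r: "(M - real (card K)) * (\<Sum>u\<in>K - {a, b, c}. f u) = - (real (card K) - 3) * ?S"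
    unfolding mult_minus_left by linarith
  have "?S = (\<Sum>u\<in>K - {a, b, c}. f u) + (\<Sum>u\<in>{a, b, c}. f u)"
    by (rule sum.subset_diff[OF T(1) finite_K])
  also have "(\<Sum>u\<in>{a, b, c}. f u) = f a + f b + f c" using abc by simp
  finally have "(M - real (card K)) * ?S = - (real (card K) - 3) * ?S + (M - real (card K)) * (f a + f b + f c)"
    using r by (simp add: algebra_simps)
  then show ?thesis using card_K by (auto simp: algebra_simps)
qed

lemma nonzero_abc:
  assumes f: "eig M f" and M: "real (card K) < M" and v: "v \<in> V" "f v \<noteq> 0"
  shows "f a \<noteq> 0 \<or> f b \<noteq> 0 \<or> f c \<noteq> 0"
proof (rule ccontr)
  assume "\<not> ?thesis"
  then have z: "f a = 0" "f b = 0" "f c = 0" by auto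
  have M1: "1 < M" "2 < M - 1" using M card_K by auto
  then have S: "(\<Sum>w\<in>K. f w) = 0" using sum_K_abc[OF f M] z by simp
  have "f u = 0" if "u \<in> K" for u
  proof (cases "u \<in> {a, b, c}")
    case False
    then show ?thesis using eig_core[OF f M1(1) that] \<alpha>_outside[OF that False] S M by simp
  qed (use z in auto)
  then show False using eig_zero[OF f M1(1) _ v(1)] v(2) by simp
qed

lemma eig_secular:
  assumes f: "eig M f" and M: "real (card K) < M" and v: "v \<in> V" "f v \<noteq> 0"
  defines "s \<equiv> M - 1" and "\<nu> \<equiv> M - real (card K)"
  shows "\<nu> * (\<alpha> a + \<alpha> b + \<alpha> c - \<nu>) = (\<alpha> a * \<alpha> b + \<alpha> b * \<alpha> c + \<alpha> c * \<alpha> a)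
    - ((\<alpha> a * \<alpha> b + \<alpha> b * \<alpha> c + \<alpha> c * \<alpha> a) / s\<^sup>2 + \<alpha> a * \<alpha> b * \<alpha> c * ((1 + 1 / s)\<^sup>2 * (s - 2) / (s * \<nu>)))"
proof -
  have M1: "1 < M" "2 < s" "0 < \<nu>" using M card_K by (auto simp: s_def \<nu>_def)
  show ?thesis
    by (rule secular_equation[OF M1(2,3) nonzero_abc[OF f M v]])
      (use eig_core[OF f M1(1)] abc sum_K_abc[OF f M] in \<open>auto simp: s_def \<nu>_def\<close>)
qed

lemma eig_combine: "eig M f \<Longrightarrow> eig M h \<Longrightarrow> eig M (\<lambda>v. p * f v - q * h v)"
  unfolding eig_def
proof
  fix v assume "\<forall>v\<in>V. (\<Sum>u\<in>E `` {v}. f v - f u) = M * f v" "\<forall>v\<in>V. (\<Sum>u\<in>E `` {v}. h v - h u) = M * h v" "v \<in> V"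
  then have "p * (\<Sum>u\<in>E `` {v}. f v - f u) - q * (\<Sum>u\<in>E `` {v}. h v - h u) = M * (p * f v - q * h v)"
    by (simp add: algebra_simps)
  then show "(\<Sum>u\<in>E `` {v}. (p * f v - q * h v) - (p * f u - q * h u)) = M * (p * f v - q * h v)"
    by (simp add: sum_distrib_left sum_subtractf[symmetric] algebra_simps)
qed

text \<open>For a double eigenvalue the two secular equations coincide and their difference says
  nothing. The plane of eigenvectors forces \<open>?B\<close> to vanish at \<open>a\<close>,
  \<open>b\<close> and \<open>c\<close>: a hub with nonzero \<open>?B\<close> carries the value 0
  throughout, and the remaining two opposite values span only a line. So the three pendant numbers
  agree.\<close>

lemma eig_double:
  assumes f: "eig M f" and h: "eig M h" and M: "real (card K) < M"
    and ind: "\<And>p q. (\<And>v. v \<in> V \<Longrightarrow> p * f v - q * h v = 0) \<Longrightarrow> p = 0 \<and> q = 0"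
  shows "2 * (M - real (card K)) < \<alpha> a + \<alpha> b + \<alpha> c" "0 < \<alpha> a" "0 < \<alpha> b"
proof -
  have M1: "1 < M" "2 < M - 1" using M card_K by auto
  let ?S = "\<lambda>f. \<Sum>w\<in>K. f w :: real"
  let ?B = "\<lambda>u. \<alpha> u * (1 + 1 / (M - 1)) - (M - real (card K))"
  \<comment> \<open>A plane of eigenvectors contains a nonzero one whose sum over \<open>K\<close>
    is 0.\<close>
  have ex: "\<exists>z v. eig M z \<and> ?S z = 0 \<and> v \<in> V \<and> z v \<noteq> 0"
  proof (cases "?S f = 0")
    case True
    have "\<not> (\<forall>v\<in>V. f v = 0)" using ind[of 1 0] by auto
    then show ?thesis using f True by auto
  next
    case False
    let ?z = "\<lambda>v. ?S h * f v - ?S f * h v"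
    have "?S ?z = 0" by (simp add: sum_subtractf sum_distrib_left[symmetric])
    moreover have "\<not> (\<forall>v\<in>V. ?z v = 0)" using ind[of "?S h" "?S f"] False by auto
    ultimately show ?thesis using eig_combine[OF f h] by blast
  qed
  then obtain z v where z: "eig M z" "?S z = 0" "v \<in> V" "z v \<noteq> 0" by auto
  obtain u where u: "u \<in> {a, b, c}" "z u \<noteq> 0" using nonzero_abc[OF z(1) M z(3,4)] by auto
  have uK: "u \<in> K" using u abc by auto
  have Bu: "?B u = 0" using eig_core[OF z(1) M1(1) uK] z(2) u(2) by simp
  have S0: "?S w = 0" if "eig M w" for w using eig_core[OF that M1(1) uK] Bu by simp
  have out: "w t = 0" if "eig M w" "t \<in> K" "?B t \<noteq> 0" for w t
    using eig_core[OF that(1) M1(1) that(2)] S0[OF that(1)] that(3) by simp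
  have sum0: "w a + w b + w c = 0" if "eig M w" for w
    using sum_K_abc[OF that M] S0[OF that] M by simp
  have Bout: "?B t \<noteq> 0" if "t \<in> K" "t \<notin> {a, b, c}" for t using \<alpha>_outside[OF that] M by simp
  have all: "?B t = 0" if t: "t \<in> {a, b, c}" for t
  proof (rule ccontr)
    assume nt: "?B t \<noteq> 0"
    have tK: "t \<in> K" using t abc by auto
    have "t = a \<or> t = b \<or> t = c" using t by auto
    then obtain p q where pq: "{a, b, c} = {t, p, q}" "\<And>w. w a + w b + w c = (w t :: real) + w p + w q"
    proof (elim disjE)
      assume "t = a" then show ?thesis using that[of b c] by auto
    next
      assume "t = b" then show ?thesis using that[of a c] by (auto simp: add_ac)
    next
      assume "t = c" then show ?thesis using that[of a b] by (auto simp: add_ac)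
    qed
    let ?w = "\<lambda>v. h p * f v - f p * h v"
    have w: "eig M ?w" by (rule eig_combine[OF f h])
    have "f t = 0" "h t = 0" using out f h tK nt by auto
    then have fq: "f q = - f p" "h q = - h p" using sum0[OF f] sum0[OF h] unfolding pq(2) by auto
    have wq: "?w x = 0" if "x \<in> K" for x
    proof (cases "x \<in> {t, p, q}")
      case True then show ?thesis using \<open>f t = 0\<close> \<open>h t = 0\<close> fq by auto
    next
      case False
      then show ?thesis using out[OF w that Bout[OF that]] pq(1) by auto
    qed
    have "?w v = 0" if "v \<in> V" for v by (rule eig_zero[OF w M1(1) wq that])
    then have hp: "h p = 0 \<and> f p = 0" by (rule ind)
    have "f x = 0" if "x \<in> K" for x
    proof (cases "x \<in> {t, p, q}")
      case True then show ?thesis using \<open>f t = 0\<close> fq hp by auto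
    next
      case False
      then show ?thesis using out[OF f that Bout[OF that]] pq(1) by auto
    qed
    then have "f v = 0" if "v \<in> V" for v using eig_zero[OF f M1(1) _ that] by blast
    then show False using ind[of 1 0] by auto
  qed
  \<comment> \<open>As \<open>M - 1 > 2\<close>, the factor is below 3/2, so three equal pendant
    numbers add up to more than \<open>2 * (M - card K)\<close>.\<close>
  let ?q = "1 + 1 / (M - 1)"
  have q: "0 < ?q" "?q < 3 / 2" using M1 by (auto simp: field_simps)
  have al: "\<alpha> t * ?q = M - real (card K)" if "t \<in> {a, b, c}" for t using all[OF that] by simp
  have pos: "0 < \<alpha> t" if "t \<in> {a, b, c}" for t
    using al[OF that] M q by (metis diff_gt_0_iff_gt zero_less_mult_pos2)
  then show "0 < \<alpha> a" "0 < \<alpha> b" by auto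
  have "\<alpha> a * ?q = \<alpha> b * ?q" "\<alpha> a * ?q = \<alpha> c * ?q" using al by auto
  then have eq: "\<alpha> b = \<alpha> a" "\<alpha> c = \<alpha> a" using q by auto
  have "\<alpha> a * ?q < \<alpha> a * (3 / 2)" using q pos by (intro mult_strict_left_mono) auto
  then show "2 * (M - real (card K)) < \<alpha> a + \<alpha> b + \<alpha> c" using al[of a] eq by simp
qed

lemma single_hub:
  assumes "\<not> 0 < \<alpha> a * \<alpha> b + \<alpha> b * \<alpha> c + \<alpha> c * \<alpha> a"
  shows "\<exists>h\<in>{a, b, c}. \<forall>y\<in>P. par y = h"
proof -
  have "0 \<le> \<alpha> a * \<alpha> b" "0 \<le> \<alpha> b * \<alpha> c" "0 \<le> \<alpha> c * \<alpha> a" by auto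
  then have z: "\<alpha> a * \<alpha> b = 0" "\<alpha> b * \<alpha> c = 0" "\<alpha> c * \<alpha> a = 0" using assms by linarith+
  have "pend u = {} \<longleftrightarrow> \<alpha> u = 0" for u
  proof -
    have "finite (pend u)" by (rule finite_subset[OF _ finite_P]) (auto simp: pend_def)
    then show ?thesis by (simp only: of_nat_eq_0_iff card_eq_0_iff) simp
  qed
  then have "pend a = {} \<and> pend b = {} \<or> pend b = {} \<and> pend c = {} \<or> pend c = {} \<and> pend a = {}"
    using z by (metis mult_eq_0_iff)
  then have "(\<forall>y\<in>P. par y = c) \<or> (\<forall>y\<in>P. par y = a) \<or> (\<forall>y\<in>P. par y = b)"
    unfolding pend_def using par_in by blast
  then show ?thesis by blast
qed

text \<open>With \<nu> i = \<mu> i - card K the claim is \<nu> 0 + \<nu> 1 \<le> e1. Two distinct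
  positive values are compared through the difference of their secular equations, equal ones through
  \<open>eig_double\<close>; if only \<nu> 0 is positive, it does not exceed e1 by itself.
  \<open>e2 = 0\<close> means that at most one clique vertex has pendant vertices.\<close>

theorem clique_pendants_sum:
  assumes basis: "eigenbasis V (lapl E) x \<mu>"
  shows "\<mu> 0 + \<mu> 1 \<le> 2 * real (card K) + real (card P)"
    and "0 < \<alpha> a * \<alpha> b + \<alpha> b * \<alpha> c + \<alpha> c * \<alpha> a \<Longrightarrow> \<mu> 0 + \<mu> 1 < 2 * real (card K) + real (card P)"
proof -
  interpret spectrum V E x \<mu> by unfold_locales (rule basis)
  define e1 e2 e3 where "e1 = \<alpha> a + \<alpha> b + \<alpha> c" "e2 = \<alpha> a * \<alpha> b + \<alpha> b * \<alpha> c + \<alpha> c * \<alpha> a" "e3 = \<alpha> a * \<alpha> b * \<alpha> c"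
  have nn: "0 \<le> e1" "0 \<le> e2" "0 \<le> e3" unfolding e1_e2_e3_def by auto
  have e13: "3 * e3 \<le> e1 * e2"
  proof -
    have "e1 * e2 - 3 * e3 = (\<alpha> a)\<^sup>2 * (\<alpha> b + \<alpha> c) + (\<alpha> b)\<^sup>2 * (\<alpha> a + \<alpha> c) + (\<alpha> c)\<^sup>2 * (\<alpha> a + \<alpha> b)"
      unfolding e1_e2_e3_def by (simp add: algebra_simps power2_eq_square)
    moreover have "\<dots> \<ge> 0" by (intro add_nonneg_nonneg mult_nonneg_nonneg) auto
    ultimately show ?thesis by linarith
  qed
  have e1pos: "0 < e1" if "0 < e2"
  proof (rule ccontr)
    assume "\<not> 0 < e1"
    then have "\<alpha> a = 0" "\<alpha> b = 0" "\<alpha> c = 0" unfolding e1_e2_e3_def by linarith+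
    then show False using that unfolding e1_e2_e3_def by simp
  qed
  have e3z: "e3 = 0" if "e2 = 0"
    using that unfolding e1_e2_e3_def by (auto simp: add_nonneg_eq_0_iff)
  have n: "3 \<le> card V" using card_mono[OF finV K_sub] card_K by auto
  have eg: "eig (\<mu> i) (x i)" if "i < 2" for i unfolding eig_def using eigen[of i] that n by auto
  have nz: "\<exists>v\<in>V. x i v \<noteq> 0" if "i < 2" for i
  proof (rule ccontr)
    assume "\<not> ?thesis"
    then have "ip V (x i) (x i) = 0" by (simp add: ip_def)
    then show False using x_ip[of i i] that n by simp
  qed
  define \<nu> where "\<nu> i = \<mu> i - card K" for i
  define s where "s i = \<mu> i - 1" for i
  define H where "H i = e2 / (s i)\<^sup>2 + e3 * ((1 + 1 / s i)\<^sup>2 * (s i - 2) / (s i * \<nu> i))" for i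
  define d where "d = real (card K) - 3"
  have d: "0 \<le> d" "\<And>i. s i - 2 = \<nu> i + d" using card_K by (auto simp: d_def s_def \<nu>_def)
  have sec: "\<nu> i * (e1 - \<nu> i) = e2 - H i" and s2: "2 < s i" if i: "i < 2" "0 < \<nu> i" for i
  proof -
    obtain v where v: "v \<in> V" "x i v \<noteq> 0" using nz[OF i(1)] by auto
    have M: "real (card K) < \<mu> i" using i(2) by (simp add: \<nu>_def)
    show "\<nu> i * (e1 - \<nu> i) = e2 - H i"
      using eig_secular[OF eg[OF i(1)] M v] unfolding H_def e1_e2_e3_def \<nu>_def s_def .
    show "2 < s i" using d i(2) by (metis add_pos_nonneg diff_gt_0_iff_gt)
  qed
  have mono: "\<nu> 1 \<le> \<nu> 0" using \<mu>_mono[of 0 1] n by (simp add: \<nu>_def)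
  have main: "\<nu> 0 + \<nu> 1 \<le> e1 \<and> (0 < e2 \<longrightarrow> \<nu> 0 + \<nu> 1 < e1)"
  proof (cases "0 < \<nu> 0")
    case False
    then show ?thesis using mono nn e1pos by auto
  next
    case p0: True
    note S0 = s2[of 0, OF _ p0, simplified] and Q0 = sec[of 0, OF _ p0, simplified]
    show ?thesis
    proof (cases "0 < \<nu> 1")
      case False
      show ?thesis
      proof (cases "e2 = 0")
        case True
        then have "\<nu> 0 * (e1 - \<nu> 0) = 0" using Q0 e3z[OF True] by (simp add: H_def)
        then have "\<nu> 0 = e1" using p0 by simp
        then show ?thesis using False True by simp
      next
        case e2: False
        then have e2p: "0 < e2" using nn by simp
        have "\<nu> 0 < e1"
        proof (rule ccontr)
          assume "\<not> \<nu> 0 < e1"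
          then have ge: "e1 \<le> \<nu> 0" by simp
          then have "\<nu> 0 * (e1 - \<nu> 0) \<le> 0" using p0 by (intro mult_nonneg_nonpos) auto
          then have "e2 \<le> H 0" using Q0 by simp
          \<comment> \<open>The two parts of \<open>H 0\<close> are at most \<open>e2 / 4\<close>,
            as \<open>s 0 > 2\<close>, and \<open>e2 / 3\<close>, by \<open>e13\<close> and \<nu> 0
            \<ge> e1.\<close>
          moreover have "H 0 < e2"
          proof -
            have "e2 / (s 0)\<^sup>2 \<le> e2 / 4"
            proof (intro divide_left_mono)
              have "2\<^sup>2 \<le> (s 0)\<^sup>2" using S0 by (intro power_mono) auto
              then show "4 \<le> (s 0)\<^sup>2" by simp
            qed (use S0 nn in auto)
            moreover have "e3 * ((1 + 1 / s 0)\<^sup>2 * (s 0 - 2) / (s 0 * \<nu> 0)) \<le> e2 / 3"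
            proof -
              have "(1 + 1 / s 0)\<^sup>2 * (s 0 - 2) / s 0 \<le> 1"
                using S0 by (simp add: field_simps power2_eq_square)
              then have "(1 + 1 / s 0)\<^sup>2 * (s 0 - 2) / s 0 / \<nu> 0 \<le> 1 / \<nu> 0"
                using p0 by (intro divide_right_mono) auto
              then have "e3 * ((1 + 1 / s 0)\<^sup>2 * (s 0 - 2) / s 0 / \<nu> 0) \<le> e3 * (1 / \<nu> 0)"
                using nn by (intro mult_left_mono)
              also have "\<dots> \<le> e3 * (1 / e1)"
                using e1pos[OF e2p] ge nn by (intro mult_left_mono) (auto simp: frac_le)
              also have "\<dots> \<le> e2 / 3" using e13 e1pos[OF e2p] by (simp add: field_simps)
              finally show ?thesis by simp
            qed
            ultimately show ?thesis using e2p unfolding H_def by linarith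
          qed
          ultimately show False by simp
        qed
        then show ?thesis using False by auto
      qed
    next
      case p1: True
      note S1 = s2[of 1, OF _ p1, simplified] and Q1 = sec[of 1, OF _ p1, simplified]
      show ?thesis
      proof (cases "\<nu> 1 < \<nu> 0")
        case True
        have st: "s 1 < s 0" using True by (simp add: s_def \<nu>_def)
        have "e3 * ((1 + 1 / s 0)\<^sup>2 * (s 0 - 2) / (s 0 * \<nu> 0)) \<le> e3 * ((1 + 1 / s 1)\<^sup>2 * (s 1 - 2) / (s 1 * \<nu> 1))"
          using S1 st p1 d nn by (intro mult_left_mono secular_decreasing[where d = d]) auto
        moreover have sq: "0 < (s 1)\<^sup>2" "(s 1)\<^sup>2 < (s 0)\<^sup>2" using S1 st by (auto intro!: power_strict_mono)
        have "e2 / (s 0)\<^sup>2 \<le> e2 / (s 1)\<^sup>2" using nn sq S0 by (intro divide_left_mono) auto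
        moreover have "e2 / (s 0)\<^sup>2 < e2 / (s 1)\<^sup>2" if "0 < e2"
          using that sq S0 by (intro divide_strict_left_mono) auto
        ultimately have "H 0 \<le> H 1" "0 < e2 \<Longrightarrow> H 0 < H 1" unfolding H_def by force+
        \<comment> \<open>Subtracting the secular equations shows that the product is
          \<open>H 1 - H 0\<close>.\<close>
        then have "0 \<le> (\<nu> 0 - \<nu> 1) * (e1 - \<nu> 0 - \<nu> 1)" "0 < e2 \<Longrightarrow> 0 < (\<nu> 0 - \<nu> 1) * (e1 - \<nu> 0 - \<nu> 1)"
          using Q0 Q1 by (auto simp: algebra_simps)
        then show ?thesis using True by (auto simp: zero_le_mult_iff zero_less_mult_iff)
      next
        case False
        then have eq: "\<mu> 1 = \<mu> 0" using mono by (simp add: \<nu>_def)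
        have M: "real (card K) < \<mu> 0" using p0 by (simp add: \<nu>_def)
        have ind: "p = 0 \<and> q = 0" if z: "\<And>v. v \<in> V \<Longrightarrow> p * x 0 v - q * x 1 v = 0" for p q
        proof -
          have "ip V (x 0) (\<lambda>v. p * x 0 v - q * x 1 v) = 0" "ip V (x 1) (\<lambda>v. p * x 0 v - q * x 1 v) = 0"
            using z by (simp_all add: ip_def)
          then show ?thesis using x_ip[of 0 0] x_ip[of 0 1] x_ip[of 1 0] x_ip[of 1 1] n
            by (simp add: ip_diff_right ip_scale_right)
        qed
        have "eig (\<mu> 0) (x 1)" using eg[of 1] eq by simp
        then have "2 * (\<mu> 0 - real (card K)) < e1"
          using eig_double(1)[OF eg[of 0] _ M ind] unfolding e1_e2_e3_def by simp
        then show ?thesis using eq by (simp add: \<nu>_def)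
      qed
    qed
  qed
  then show "\<mu> 0 + \<mu> 1 \<le> 2 * real (card K) + real (card P)" "0 < \<alpha> a * \<alpha> b + \<alpha> b * \<alpha> c + \<alpha> c * \<alpha> a \<Longrightarrow> \<mu> 0 + \<mu> 1 < 2 * real (card K) + real (card P)"
    using card_P unfolding \<nu>_def e1_e2_e3_def by simp_all
qed

end

section \<open>Pendant vertices on a 4-clique, with and without one clique edge\<close>

lemma gram_diff: "gram k x u u + gram k x v v - 2 * gram k x u v = (\<Sum>i<k. (x i u - x i v)\<^sup>2)"
  by (simp add: gram_def power2_diff sum.distrib sum_subtractf sum_distrib_left power2_eq_square algebra_simps)

lemma gram_commute: "gram k x u v = gram k x v u"
  by (simp add: gram_def mult.commute)

text \<open>
  If every vertex of \<open>K\<^sub>4\<close> carries pendant vertices, then removing one pendant edge \<open>(h, f h)\<close> at each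
  vertex does not decrease the excess, since the removed terms are at most
  \<open>2 * (c h h + c (f h) (f h)) - 1\<close> and the trace of \<open>c\<close> is 2.
\<close>

lemma excess_clique_pendant_split:
  assumes fin: "finite K" "finite P" and PK: "P \<inter> K = {}" and par: "par ` P \<subseteq> K"
    and f: "\<And>h. h \<in> K \<Longrightarrow> f h \<in> P \<and> par (f h) = h" and sym: "\<And>u v. c u v = c v u"
  shows "excess (clique_pendant_arcs K P par) c = excess (clique_pendant_arcs K (P - f ` K) par) c
    + (\<Sum>h\<in>K. c h h + c (f h) (f h) - 1 - 2 * c h (f h))"
proof -
  let ?E = "clique_pendant_arcs K P par" and ?E' = "clique_pendant_arcs K (P - f ` K) par"
  let ?B = "(\<lambda>h. (f h, h)) ` K" and ?C = "(\<lambda>h. (h, f h)) ` K"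
  let ?g = "\<lambda>(u, v). c u u + c v v - 1 - 2 * c u v"
  have fE: "finite ?E'" unfolding clique_pendant_arcs_def using fin
    by (auto intro: finite_subset[of _ "K \<times> K"])
  have "P = (P - f ` K) \<union> f ` K" using f by auto
  then have "(\<lambda>y. (y, par y)) ` P = (\<lambda>y. (y, par y)) ` (P - f ` K) \<union> (\<lambda>y. (y, par y)) ` (f ` K)"
    "(\<lambda>y. (par y, y)) ` P = (\<lambda>y. (par y, y)) ` (P - f ` K) \<union> (\<lambda>y. (par y, y)) ` (f ` K)"
    by (metis image_Un)+
  moreover have "(\<lambda>y. (y, par y)) ` (f ` K) = ?B" "(\<lambda>y. (par y, y)) ` (f ` K) = ?C"
    unfolding image_image using f by (auto intro!: image_cong)
  ultimately have E: "?E = (?E' \<union> ?B) \<union> ?C" unfolding clique_pendant_arcs_def by auto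
  have fP: "f h \<in> P" "f h \<notin> K" "par (f h) = h" if "h \<in> K" for h using f[OF that] PK by auto
  have d1: "?E' \<inter> ?B = {}"
    unfolding clique_pendant_arcs_def using fP par PK by auto
  have d2: "(?E' \<union> ?B) \<inter> ?C = {}"
  proof -
    have "y \<in> P - f ` K \<Longrightarrow> f (par y) = y \<Longrightarrow> False" for y using par by (metis DiffD1 DiffD2 image_eqI imageI subsetD)
    then show ?thesis unfolding clique_pendant_arcs_def using fP PK by auto
  qed
  have "(\<Sum>p\<in>?E. ?g p) = (\<Sum>p\<in>?E' \<union> ?B. ?g p) + (\<Sum>p\<in>?C. ?g p)"
    unfolding E by (rule sum.union_disjoint) (use fE fin d2 in auto)
  also have "(\<Sum>p\<in>?E' \<union> ?B. ?g p) = (\<Sum>p\<in>?E'. ?g p) + (\<Sum>p\<in>?B. ?g p)"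
    by (rule sum.union_disjoint) (use fE fin d1 in auto)
  also have "(\<Sum>p\<in>?C. ?g p) = (\<Sum>h\<in>K. c h h + c (f h) (f h) - 1 - 2 * c h (f h))"
    by (subst sum.reindex) (auto simp: inj_on_def)
  also have "(\<Sum>p\<in>?B. ?g p) = (\<Sum>h\<in>K. c h h + c (f h) (f h) - 1 - 2 * c h (f h))"
  proof (subst sum.reindex)
    show "inj_on (\<lambda>h. (f h, h)) K" by (auto simp: inj_on_def)
    show "sum (?g \<circ> (\<lambda>h. (f h, h))) K = (\<Sum>h\<in>K. c h h + c (f h) (f h) - 1 - 2 * c h (f h))"
    proof (rule sum.cong[OF refl])
      fix h
      show "(?g \<circ> (\<lambda>h. (f h, h))) h = c h h + c (f h) (f h) - 1 - 2 * c h (f h)"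
        using sym[of "f h" h] by simp
    qed
  qed
  finally show ?thesis unfolding excess_def by simp
qed

lemma inj_pendant_choice:
  assumes "\<And>h. h \<in> K \<Longrightarrow> f h \<in> P \<and> par (f h) = h"
  shows "inj_on f K"
  using assms by (metis inj_onI)

lemma (in projection) sum_two_sets_le:
  assumes "finite K" "K \<subseteq> V" "f ` K \<subseteq> V" "K \<inter> f ` K = {}" "inj_on f K"
  shows "(\<Sum>h\<in>K. c h h + c (f h) (f h)) \<le> real k"
proof -
  have "(\<Sum>h\<in>K. c h h + c (f h) (f h)) = (\<Sum>v\<in>K. c v v) + (\<Sum>v\<in>f ` K. c v v)"
    using assms(5) by (simp add: sum.distrib sum.reindex)
  also have "\<dots> = (\<Sum>v\<in>K \<union> f ` K. c v v)"
    using assms by (intro sum.union_disjoint[symmetric]) auto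
  also have "\<dots> \<le> real k" using assms by (intro sum_diag_le) auto
  finally show ?thesis .
qed

lemma K4_pendant_excess:
  assumes V: "finite V" "K \<subseteq> V" and K4: "card K = 4" and P: "P \<subseteq> V - K" "par ` P \<subseteq> K"
    and y: "orthonormal V 2 y"
  shows "excess (clique_pendant_arcs K P par) (gram 2 y) \<le> 2"
  using P
proof (induction "card P" arbitrary: P rule: less_induct)
  case less
  interpret projection V 2 "gram 2 y" by (rule projection_gram[OF V(1) y])
  have finK: "finite K" using finite_subset[OF V(2) V(1)] .
  have finP: "finite P" using finite_subset[OF less.prems(1)] V(1) by simp
  have PK: "P \<inter> K = {}" using less.prems by auto
  show ?case
  proof (cases "\<exists>q\<in>K. \<forall>y\<in>P. par y \<noteq> q")
    case True
    then obtain q where q: "q \<in> K" "\<forall>y\<in>P. par y \<noteq> q" by auto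
    have "card (K - {q}) = 3" using K4 q finK by simp
    then obtain a b c where abc: "K - {q} = {a, b, c}" "a \<noteq> b" "b \<noteq> c" "a \<noteq> c"
      by (auto simp: card_3_iff)
    have "par ` P \<subseteq> {a, b, c}" unfolding abc(1)[symmetric] using less.prems(2) q(2) by blast
    then interpret C: clique_pendants V K P par a b c
      using V less.prems abc K4 by unfold_locales auto
    obtain z \<zeta> where z: "eigenbasis V (lapl C.E) z \<zeta>" using C.eigenbasis_exists_lapl by auto
    interpret S: spectrum V C.E z \<zeta> by unfold_locales (rule z)
    \<comment> \<open>Ky Fan turns the eigenvalue bound \<open>8 + card P\<close> into a bound for
      the given \<open>y\<close>; the graph has \<open>6 + card P\<close> edges, which leaves
      2.\<close>
    have "excess C.E (gram 2 y) + real (card C.E) / 2 \<le> \<zeta> 0 + \<zeta> 1"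
      using S.sum_\<mu>_ge[OF y] by (simp add: numeral_2_eq_2)
    also have "\<dots> \<le> 8 + real (card P)" using C.clique_pendants_sum(1)[OF z] K4 by simp
    finally show ?thesis using card_clique_pendant_arcs[OF finK finP PK less.prems(2)] K4 by (simp add: field_simps)
  next
    case False
    then obtain f where f: "\<And>h. h \<in> K \<Longrightarrow> f h \<in> P \<and> par (f h) = h" by metis
    have sub: "f ` K \<subseteq> P" using f by auto
    have "K \<noteq> {}" using K4 by auto
    then have "card (P - f ` K) < card P" using sub finP by (intro psubset_card_mono) auto
    then have "excess (clique_pendant_arcs K (P - f ` K) par) (gram 2 y) \<le> 2"
      using less.prems by (intro less.hyps) auto
    moreover have "(\<Sum>h\<in>K. gram 2 y h h + gram 2 y (f h) (f h) - 1 - 2 * gram 2 y h (f h)) \<le> 0"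
    proof -
      have "(\<Sum>h\<in>K. gram 2 y h h + gram 2 y (f h) (f h) - 1 - 2 * gram 2 y h (f h))
        \<le> (\<Sum>h\<in>K. 2 * (gram 2 y h h + gram 2 y (f h) (f h)) - 1)"
      proof (rule sum_mono)
        fix h assume "h \<in> K"
        then have "h \<in> V" "f h \<in> V" using f less.prems V by auto
        then show "gram 2 y h h + gram 2 y (f h) (f h) - 1 - 2 * gram 2 y h (f h)
            \<le> 2 * (gram 2 y h h + gram 2 y (f h) (f h)) - 1" using c_ge[of h "f h"] by simp
      qed
      also have "\<dots> = 2 * (\<Sum>h\<in>K. gram 2 y h h + gram 2 y (f h) (f h)) - 4"
        using K4 by (simp add: sum_subtractf sum_distrib_left)
      also have "(\<Sum>h\<in>K. gram 2 y h h + gram 2 y (f h) (f h)) \<le> real 2"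
        using finK V(2) sub PK less.prems inj_pendant_choice[OF f] by (intro sum_two_sets_le) auto
      finally show ?thesis by simp
    qed
    ultimately show ?thesis
      using excess_clique_pendant_split[OF finK finP PK less.prems(2) f, of "gram 2 y"] gram_commute by fastforce
  qed
qed

text \<open>Adding the missing clique edge changes the excess by \<open>D - 1\<close> with
  \<open>D \<ge> 0\<close>, so the bound 2 for the clique gives 3 here. Equality forces
  \<open>x i w1 = x i w2\<close> and excess 2 for the clique. This excludes pendant vertices at all
  four clique vertices and leaves a single hub. A hub at \<open>w1\<close> or \<open>w2\<close>
  would confine both eigenvectors to the line of functions supported on \<open>u1\<close>,
  \<open>u2\<close> with opposite values.\<close>

lemma diamond_pendants:
  assumes g: "sgraph V E" and basis: "eigenbasis V (lapl E) x \<mu>"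
    and K: "K = {u1, u2, w1, w2}" "card K = 4" "K \<subseteq> V" and par: "par ` (V - K) \<subseteq> K"
    and E: "E = clique_pendant_arcs K (V - K) par - {(w1, w2), (w2, w1)}"
    and pos: "0 < \<mu> 1"
  shows "\<mu> 0 + \<mu> 1 \<le> 8 + real (card (V - K))"
    and "\<mu> 0 + \<mu> 1 = 8 + real (card (V - K)) \<Longrightarrow> (\<forall>y\<in>V - K. par y = u1) \<or> (\<forall>y\<in>V - K. par y = u2)"
proof -
  interpret spectrum V E x \<mu> using g basis by (simp add: spectrum_def spectrum_axioms_def)
  let ?P = "V - K" and ?C = "clique_pendant_arcs K (V - K) par"
  have dist: "u1 \<noteq> u2" "u1 \<noteq> w1" "u1 \<noteq> w2" "u2 \<noteq> w1" "u2 \<noteq> w2" "w1 \<noteq> w2"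
    using K by (auto simp: card_insert_if split: if_splits)
  have finK: "finite K" using K(1) by simp
  have n: "card V = 4 + card ?P" using card_Diff_subset[OF finK K(3)] card_mono[OF finite_V K(3)] K(2) by simp
  have x2: "orthonormal V 2 x" by (rule orthonormal_subset[OF x_ortho]) (use n in simp)
  interpret projection V 2 "gram 2 x" by (rule projection_gram[OF finite_V x2])
  have s2: "(\<Sum>i<2. f i) = f 0 + f 1" for f :: "nat \<Rightarrow> real" by (simp add: numeral_2_eq_2)
  define D where "D = (x 0 w1 - x 0 w2)\<^sup>2 + (x 1 w1 - x 1 w2)\<^sup>2"
  have D: "gram 2 x w1 w1 + gram 2 x w2 w2 - 2 * gram 2 x w1 w2 = D" unfolding gram_diff s2 D_def ..
  have wC: "{(w1, w2), (w2, w1)} \<subseteq> ?C" unfolding clique_pendant_arcs_def using K(1) dist by auto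
  have finC: "finite ?C" using finite_E E by (metis finite_Diff2 finite.emptyI finite.insertI)
  have "(\<Sum>(u, v)\<in>?C. gram 2 x u u + gram 2 x v v - 1 - 2 * gram 2 x u v)
    = (\<Sum>(u, v)\<in>E. gram 2 x u u + gram 2 x v v - 1 - 2 * gram 2 x u v)
      + (\<Sum>(u, v)\<in>{(w1, w2), (w2, w1)}. gram 2 x u u + gram 2 x v v - 1 - 2 * gram 2 x u v)"
    unfolding E by (rule sum.subset_diff[OF wC finC])
  then have exC: "excess ?C (gram 2 x) = excess E (gram 2 x) + (D - 1)"
    using dist D gram_commute[of 2 x w2 w1] unfolding excess_def by simp
  have cardC: "card ?C = 12 + 2 * card ?P"
    using card_clique_pendant_arcs[OF finK _ _ par] finite_V K(2) by auto
  have "card ?C = card E + 2"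
    using card_Diff_subset[OF _ wC] card_mono[OF finC wC] dist E by auto
  then have cE: "real (card E) / 2 = 5 + real (card ?P)" using cardC by simp
  have m: "\<mu> 0 + \<mu> 1 = excess E (gram 2 x) + real (card E) / 2"
    using sum_\<mu>[of 2] n unfolding s2 by simp
  have le2: "excess ?C (gram 2 x) \<le> 2"
    by (rule K4_pendant_excess[OF finite_V K(3,2) _ par x2]) auto
  have D0: "0 \<le> D" by (simp add: D_def)
  show "\<mu> 0 + \<mu> 1 \<le> 8 + real (card ?P)" using m exC le2 D0 cE by simp
  assume eq: "\<mu> 0 + \<mu> 1 = 8 + real (card ?P)"
  then have D1: "D = 0" and C2: "excess ?C (gram 2 x) = 2" using m exC le2 D0 cE by simp_all
  have ww: "x i w1 = x i w2" if "i < 2" for i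
  proof -
    have "(x 0 w1 - x 0 w2)\<^sup>2 = 0" "(x 1 w1 - x 1 w2)\<^sup>2 = 0"
      using D1 unfolding D_def by (simp_all add: add_nonneg_eq_0_iff)
    then show ?thesis using that by (auto simp: less_2_cases_iff)
  qed
  have top: "\<mu> 0 \<le> card V"
  proof (rule largest_eigenvalue(1))
    show "V \<noteq> {}" using K by auto
    show "0 < \<mu> 0" using pos \<mu>_mono[of 0 1] n by simp
  qed
  \<comment> \<open>The sum is \<open>card V + 4\<close> and \<open>\<mu> 0 \<le> card V\<close>, so
    \<open>\<mu> 1 \<ge> 4\<close>; this keeps factors such as \<open>1 - \<mu> i\<close> and
    \<open>2 - \<mu> i\<close> away from 0.\<close>
  then have mu4: "4 \<le> \<mu> i" if "i < 2" for i
    using eq n \<mu>_mono[of 0 1] that by (auto simp: less_2_cases_iff)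
  have NP: "E `` {y} = {par y}" if "y \<in> ?P" for y
  proof -
    have y: "y \<notin> K" "y \<noteq> w1" "y \<noteq> w2" using that K(1) by auto
    have "par y' \<noteq> y" if "y' \<in> ?P" for y' using that par y(1) by blast
    then show ?thesis unfolding E clique_pendant_arcs_def using that y by blast
  qed
  have leaf: "x i y - x i (par y) = \<mu> i * x i y" if "y \<in> ?P" "i < 2" for i y
    using eigen[of i y] NP[OF that(1)] that n by simp
  have Nw: "E `` {w} = {u1, u2} \<union> {y \<in> ?P. par y = w}" if "w \<in> {w1, w2}" for w
  proof -
    have w: "w \<in> K" "w1 \<in> K" "w2 \<in> K" using that K(1) by auto
    have "(w, z) \<in> E \<longleftrightarrow> z \<in> K \<and> z \<noteq> w \<and> (w, z) \<noteq> (w1, w2) \<and> (w, z) \<noteq> (w2, w1) \<or> z \<in> ?P \<and> par z = w" for z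
      unfolding E clique_pendant_arcs_def using w by auto
    moreover have "z \<in> K \<and> z \<noteq> w \<and> (w, z) \<noteq> (w1, w2) \<and> (w, z) \<noteq> (w2, w1) \<longleftrightarrow> z \<in> {u1, u2}" for z
      unfolding K(1) using that dist by blast
    ultimately show ?thesis by blast
  qed
  have core: "2 * x i w - x i u1 - x i u2 + (\<Sum>y | y \<in> ?P \<and> par y = w. x i w - x i y) = \<mu> i * x i w"
    if "w \<in> {w1, w2}" "i < 2" for w i
  proof -
    have "w \<in> V" "i < card V" using that K(1,3) n by auto
    then have "\<mu> i * x i w = (\<Sum>u\<in>E `` {w}. x i w - x i u)" by (rule eigen[symmetric, rotated])
    also have "\<dots> = (\<Sum>u\<in>{u1, u2} \<union> {y \<in> ?P. par y = w}. x i w - x i u)" unfolding Nw[OF that(1)] ..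
    also have "\<dots> = (\<Sum>u\<in>{u1, u2}. x i w - x i u) + (\<Sum>u\<in>{y \<in> ?P. par y = w}. x i w - x i u)"
    proof (rule sum.union_disjoint)
      show "finite {y \<in> ?P. par y = w}" using finite_V by simp
      show "{u1, u2} \<inter> {y \<in> ?P. par y = w} = {}" using K(1) by blast
    qed simp
    finally show ?thesis using dist by (simp add: algebra_simps)
  qed
  show "(\<forall>y\<in>?P. par y = u1) \<or> (\<forall>y\<in>?P. par y = u2)"
  proof (cases "\<forall>h\<in>K. \<exists>y\<in>?P. par y = h")
    case True
    then obtain f where f: "\<And>h. h \<in> K \<Longrightarrow> f h \<in> ?P \<and> par (f h) = h" by metis
    have "excess (clique_pendant_arcs K (?P - f ` K) par) (gram 2 x) \<le> 2"
      by (rule K4_pendant_excess[OF finite_V K(3,2) _ _ x2]) (use par in auto)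
    moreover have "excess ?C (gram 2 x) = excess (clique_pendant_arcs K (?P - f ` K) par) (gram 2 x)
        + (\<Sum>h\<in>K. gram 2 x h h + gram 2 x (f h) (f h) - 1 - 2 * gram 2 x h (f h))"
      by (rule excess_clique_pendant_split[OF finK _ _ par f]) (use finite_V in \<open>auto intro: gram_commute\<close>)
    ultimately have "0 \<le> (\<Sum>h\<in>K. gram 2 x h h + gram 2 x (f h) (f h) - 1 - 2 * gram 2 x h (f h))"
      using C2 by simp
    \<comment> \<open>The squares are what \<open>c_ge\<close> discards. With trace 2 there is no
      room for them, so \<open>x i\<close> takes opposite values at \<open>h\<close> and at its
      pendant vertex \<open>f h\<close>.\<close>
    also have "\<dots> = (\<Sum>h\<in>K. 2 * (gram 2 x h h + gram 2 x (f h) (f h)) - (\<Sum>i<2. (x i h + x i (f h))\<^sup>2) - 1)"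
      by (intro sum.cong refl) (simp add: gram_def s2 power2_eq_square algebra_simps)
    also have "\<dots> = 2 * (\<Sum>h\<in>K. gram 2 x h h + gram 2 x (f h) (f h)) - (\<Sum>h\<in>K. \<Sum>i<2. (x i h + x i (f h))\<^sup>2) - 4"
      using K(2) by (simp add: sum_subtractf sum_distrib_left)
    finally have "(\<Sum>h\<in>K. \<Sum>i<2. (x i h + x i (f h))\<^sup>2) + 4 \<le> 2 * (\<Sum>h\<in>K. gram 2 x h h + gram 2 x (f h) (f h))"
      by simp
    moreover have "(\<Sum>h\<in>K. gram 2 x h h + gram 2 x (f h) (f h)) \<le> real 2"
      using finK K(3) f inj_pendant_choice[OF f] by (intro sum_two_sets_le) auto
    moreover have nn: "0 \<le> (\<Sum>h\<in>K. \<Sum>i<2. (x i h + x i (f h))\<^sup>2)" by (intro sum_nonneg) auto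
    ultimately have z: "(\<Sum>h\<in>K. \<Sum>i<2. (x i h + x i (f h))\<^sup>2) = 0"
      and full: "2 \<le> (\<Sum>h\<in>K. gram 2 x h h + gram 2 x (f h) (f h))" by simp_all
    have "\<forall>h\<in>K. (\<Sum>i<2. (x i h + x i (f h))\<^sup>2) = 0"
      using z finK by (subst (asm) sum_nonneg_eq_0_iff) (auto intro!: sum_nonneg)
    then have "x i h + x i (f h) = 0" if "h \<in> K" "i < 2" for h i
      using that by (auto simp: s2 less_2_cases_iff add_nonneg_eq_0_iff)
    then have opp: "x i h = - x i (f h)" if "h \<in> K" "i < 2" for h i using that by (simp add: eq_neg_iff_add_eq_0)
    have zf: "x i (f h) = 0" if "h \<in> K" "i < 2" for h i
    proof -
      have "(2 - \<mu> i) * x i (f h) = 0" using leaf[of "f h" i] f[OF that(1)] opp[OF that] that by (simp add: algebra_simps)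
      then show ?thesis using mu4[OF that(2)] by simp
    qed
    then have "x i h = 0" if "h \<in> K" "i < 2" for h i using opp that by simp
    then have "(\<Sum>h\<in>K. gram 2 x h h + gram 2 x (f h) (f h)) = 0" using zf by (simp add: gram_def)
    then show ?thesis using full by simp
  next
    case False
    then obtain q where q: "q \<in> K" "\<forall>y\<in>?P. par y \<noteq> q" by auto
    have "card (K - {q}) = 3" using K(2) q finK by simp
    then obtain a b c where abc: "K - {q} = {a, b, c}" "a \<noteq> b" "b \<noteq> c" "a \<noteq> c"
      by (auto simp: card_3_iff)
    have "par ` ?P \<subseteq> {a, b, c}" unfolding abc(1)[symmetric] using par q(2) by blast
    then interpret C: clique_pendants V K ?P par a b c
      using finite_V K(2,3) abc by unfold_locales auto
    obtain z \<zeta> where z: "eigenbasis V (lapl ?C) z \<zeta>" using C.eigenbasis_exists_lapl by auto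
    interpret S: spectrum V ?C z \<zeta> by unfold_locales (rule z)
    have "excess ?C (gram 2 x) + real (card ?C) / 2 \<le> \<zeta> 0 + \<zeta> 1" using S.sum_\<mu>_ge[OF x2] unfolding s2 .
    then have "8 + real (card ?P) \<le> \<zeta> 0 + \<zeta> 1" using C2 cardC by (simp add: field_simps)
    then have "\<not> 0 < C.\<alpha> a * C.\<alpha> b + C.\<alpha> b * C.\<alpha> c + C.\<alpha> c * C.\<alpha> a"
      using C.clique_pendants_sum(2)[OF z] K(2) by auto
    then obtain h where "h \<in> {a, b, c}" "\<forall>y\<in>?P. par y = h" using C.single_hub by blast
    then have h: "h \<in> K" "\<forall>y\<in>?P. par y = h" using abc(1) by blast+
    show ?thesis
    proof (cases "h \<in> {u1, u2} \<or> ?P = {}")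
      case True then show ?thesis using h by auto
    next
      case False
      then have hw: "h \<in> {w1, w2}" and Pne: "?P \<noteq> {}" using h K(1) by auto
      define h' where "h' = (if h = w1 then w2 else w1)"
      have h': "h' \<in> {w1, w2}" "h' \<noteq> h" using hw dist by (auto simp: h'_def)
      have hh: "x i h' = x i h" if "i < 2" for i using hw ww[OF that] by (auto simp: h'_def)
      have set1: "{y. y \<in> ?P \<and> par y = h} = ?P" and set2: "{y. y \<in> ?P \<and> par y = h'} = {}"
        using h h' by auto
      have p0: "0 < real (card ?P)" using Pne finite_V by (simp add: card_gt_0_iff)
      \<comment> \<open>\<open>w1\<close> and \<open>w2\<close> have equal values and the same core
        neighbours, so the pendant part of the equation at \<open>h\<close> vanishes. By the leaf
        equations it also equals \<open>- \<mu> i * card ?P * x i h\<close>.\<close>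
      have xh: "x i h = 0" if i: "i < 2" for i
      proof -
        have "(\<Sum>y\<in>?P. x i h - x i y) = 0"
          using core[OF hw i] core[OF h'(1) i] unfolding set1 set2 hh[OF i] by simp
        then have sy: "(\<Sum>y\<in>?P. x i y) = card ?P * x i h" by (simp add: sum_subtractf)
        have "(\<Sum>y\<in>?P. x i h - x i y) = (\<Sum>y\<in>?P. - \<mu> i * x i y)"
          using leaf[OF _ i] h(2) by (intro sum.cong refl) force
        also have "\<dots> = - \<mu> i * (\<Sum>y\<in>?P. x i y)" by (simp only: sum_distrib_left)
        finally have "\<mu> i * (card ?P * x i h) = 0" using \<open>(\<Sum>y\<in>?P. x i h - x i y) = 0\<close> sy by simp
        then show ?thesis using mu4[OF i] p0 by simp
      qed
      have xy: "x i y = 0" if "y \<in> ?P" "i < 2" for y i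
      proof -
        have "(1 - \<mu> i) * x i y = 0" using leaf[OF that] h(2) that(1) xh[OF that(2)] by (simp add: algebra_simps)
        then show ?thesis using mu4[OF that(2)] by simp
      qed
      have xu: "x i u2 = - x i u1" if "i < 2" for i
        using core[OF h'(1) that] hh[OF that] xh[OF that] unfolding set2 by simp
      have ipx: "ip V (x i) (x j) = 2 * (x i u1 * x j u1)" if "i < 2" "j < 2" for i j
      proof -
        have "ip V (x i) (x j) = (\<Sum>v\<in>{u1, u2}. x i v * x j v)"
          unfolding ip_def
        proof (rule sum.mono_neutral_right)
          show "finite V" by (rule finite_V)
          show "{u1, u2} \<subseteq> V" using K by auto
          show "\<forall>v\<in>V - {u1, u2}. x i v * x j v = 0"
          proof
            fix v assume "v \<in> V - {u1, u2}"
            then have "v \<in> ?P \<or> v = h \<or> v = h'" using K(1) hw h' by auto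
            then show "x i v * x j v = 0" using xy[of v i] xh[of i] hh[of i] that by auto
          qed
        qed
        then show ?thesis using dist xu that by simp
      qed
      have "2 * (x 0 u1 * x 0 u1) = 1" "2 * (x 1 u1 * x 1 u1) = 1" "2 * (x 0 u1 * x 1 u1) = 0"
        using ipx[of 0 0] ipx[of 1 1] ipx[of 0 1] x_ip[of 0 0] x_ip[of 1 1] x_ip[of 0 1] n by simp_all
      then show ?thesis by auto
    qed
  qed
qed

section \<open>The case of two eigenvalues\<close>

definition two_center_arcs :: "'a set \<Rightarrow> 'a \<Rightarrow> 'a \<Rightarrow> 'a set \<Rightarrow> ('a \<times> 'a) set" where
  "two_center_arcs V u v T = (let A = {u} \<times> (V - {u}) \<union> {v} \<times> T in A \<union> A\<inverse>)"

text \<open>For t = 0, 1, 2 these are the star, G(n-3,1) and G(n-4,2), so one predicate with t = c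
  serves all three equality cases. In a star \<open>v\<close> is an arbitrary leaf.\<close>

definition extremal :: "'a set \<Rightarrow> ('a \<times> 'a) set \<Rightarrow> nat \<Rightarrow> bool" where
  "extremal V E t \<longleftrightarrow>
     (\<exists>u v T. u \<in> V \<and> v \<in> V \<and> u \<noteq> v \<and> T \<subseteq> V - {u, v} \<and> card T = t \<and> E = two_center_arcs V u v T)"

lemma mem_two_center_arcs:
  "(a, b) \<in> two_center_arcs V u v T \<longleftrightarrow>
     a = u \<and> b \<in> V \<and> b \<noteq> u \<or> a = v \<and> b \<in> T \<or> b = u \<and> a \<in> V \<and> a \<noteq> u \<or> b = v \<and> a \<in> T"
  unfolding two_center_arcs_def Let_def by auto

lemma mem_clique_pendant_arcs:
  "(a, b) \<in> clique_pendant_arcs K P par \<longleftrightarrow>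
     a \<in> K \<and> b \<in> K \<and> a \<noteq> b \<or> a \<in> P \<and> b = par a \<or> b \<in> P \<and> a = par b"
  unfolding clique_pendant_arcs_def by auto

lemma triangle_two_center:
  assumes K: "K = {h, v, t}" and h: "h \<noteq> v" "h \<noteq> t" "v \<noteq> t" and sub: "K \<subseteq> V" and par: "\<forall>y\<in>V - K. par y = h"
  shows "clique_pendant_arcs K (V - K) par = two_center_arcs V h v {t}"
proof -
  have "(a, b) \<in> clique_pendant_arcs K (V - K) par \<longleftrightarrow> (a, b) \<in> two_center_arcs V h v {t}" for a b
  proof -
    have par: "y \<in> V \<Longrightarrow> y \<notin> K \<Longrightarrow> par y = h" for y using par by blast
    have K': "y \<in> K \<longleftrightarrow> y = h \<or> y = v \<or> y = t" for y using K by blast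
    have V: "h \<in> V" "v \<in> V" "t \<in> V" using K sub by auto
    show ?thesis unfolding mem_clique_pendant_arcs mem_two_center_arcs Diff_iff
      using par[of a] par[of b] K'[of a] K'[of b] V h by (cases "a \<in> K"; cases "b \<in> K") auto
  qed
  then show ?thesis by auto
qed

lemma diamond_two_center:
  assumes K: "K = {h, v, s, t}" and h: "card K = 4" and sub: "K \<subseteq> V" and par: "\<forall>y\<in>V - K. par y = h"
  shows "clique_pendant_arcs K (V - K) par - {(s, t), (t, s)} = two_center_arcs V h v {s, t}"
proof -
  have h: "h \<noteq> v" "h \<noteq> s" "h \<noteq> t" "v \<noteq> s" "v \<noteq> t" "s \<noteq> t"
    using h unfolding K by (auto simp: card_insert_if split: if_splits)
  have "(a, b) \<in> clique_pendant_arcs K (V - K) par - {(s, t), (t, s)} \<longleftrightarrow> (a, b) \<in> two_center_arcs V h v {s, t}" for a b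
  proof -
    have par: "y \<in> V \<Longrightarrow> y \<notin> K \<Longrightarrow> par y = h" for y using par by blast
    have K': "y \<in> K \<longleftrightarrow> y = h \<or> y = v \<or> y = s \<or> y = t" for y using K by blast
    have V: "h \<in> V" "v \<in> V" "t \<in> V" "s \<in> V" using K sub by auto
    show ?thesis unfolding Diff_iff mem_clique_pendant_arcs mem_two_center_arcs
      using par[of a] par[of b] K'[of a] K'[of b] V h by (cases "a \<in> K"; cases "b \<in> K") auto
  qed
  then show ?thesis by auto
qed

text \<open>The deepest outside vertex with children and those children form a star \<open>D\<close>
  attached by a single edge. Deleting it preserves connectedness and the cyclomatic number, so the
  induction hypothesis covers the rest.\<close>

lemma (in sgraph) bridge_case:
  assumes conn: "conn V E" and card: "card E + 2 = 2 * (card V + cy)" and cy: "1 \<le> cy"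
    and basis: "eigenbasis V (lapl E) x \<mu>"
    and K: "K \<subseteq> V" "3 \<le> card K"
    and par: "\<And>v. v \<in> V - K \<Longrightarrow> (v, par v) \<in> E" "\<And>v. v \<in> V - K \<Longrightarrow> d (par v) < (d v :: nat)"
    and E_eq: "E = (E \<inter> K \<times> K) \<union> (\<lambda>v. (v, par v)) ` (V - K) \<union> (\<lambda>v. (par v, v)) ` (V - K)"
    and inner: "\<exists>w\<in>V - K. par w \<notin> K"
    and IH: "\<And>W y \<nu>. W \<subset> V \<Longrightarrow> W \<noteq> {} \<Longrightarrow> conn W (E \<inter> W \<times> W) \<Longrightarrow> card (E \<inter> W \<times> W) + 2 = 2 * (card W + cy) \<Longrightarrow>
      eigenbasis W (lapl (E \<inter> W \<times> W)) y \<nu> \<Longrightarrow> \<nu> 0 + \<nu> 1 \<le> card (E \<inter> W \<times> W) / 2 + 3"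
  shows "\<mu> 0 + \<mu> 1 < card E / 2 + 3"
proof -
  let ?Q = "\<lambda>v. v \<in> V - K \<and> (\<exists>w\<in>V - K. par w = v)"
  have parV: "par w \<in> V" if "w \<in> V - K" for w using par(1)[OF that] E_in by blast
  obtain v0 where "?Q v0" using inner parV by blast
  moreover have "\<forall>v. ?Q v \<longrightarrow> d v < Suc (Max (d ` V))" using finite_V by (auto simp: less_Suc_eq_le)
  ultimately obtain v where v: "?Q v" and vmax: "\<And>u. ?Q u \<Longrightarrow> d u \<le> d v"
    using ex_has_greatest_nat[of ?Q v0 d] by blast
  \<comment> \<open>As \<open>v\<close> has maximal depth among the vertices with children, its children are leaves and \<open>D\<close> is a star.\<close>
  define C where "C = {y \<in> V - K. par y = v}"
  define D where "D = insert v C"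
  let ?W = "V - D" and ?p = "par v"
  have vV: "v \<in> V" "v \<notin> K" using v by auto
  have leafC: "par w \<noteq> y" if "y \<in> C" "w \<in> V - K" for y w
  proof
    assume "par w = y"
    then have "?Q y" using that by (auto simp: C_def)
    then have "d y \<le> d v" by (rule vmax)
    then show False using par(2)[of y] that(1) by (auto simp: C_def)
  qed
  have CV: "C \<subseteq> V - K" "v \<notin> C" using par(2)[of v] by (auto simp: C_def)
  have C0: "C \<noteq> {}" "finite C" using v finite_V by (auto simp: C_def)
  have DV: "D \<subseteq> V" "D \<inter> K = {}" using CV vV by (auto simp: D_def)
  have p: "?p \<in> V - D"
    using parV[of v] par(2)[of v] par(2)[of "par v"] vV by (auto simp: D_def C_def)
  have mem: "(a, b) \<in> E \<longleftrightarrow> (a \<in> K \<and> b \<in> K \<and> (a, b) \<in> E) \<or> (a \<in> V - K \<and> b = par a) \<or> (b \<in> V - K \<and> a = par b)" for a b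
    by (subst E_eq) auto
  have cardDC: "card D = card C + 1" using C0 CV by (simp add: D_def)
  have nV: "card V = card ?W + card D" using card_Diff_subset[of D V] DV finite_V finite_subset[OF DV(1)] card_mono[of V D] by simp
  have only: "a = v \<and> b = ?p" if ab: "a \<in> D" "b \<in> ?W" "(a, b) \<in> E" for a b
  proof -
    from ab DV consider "b = par a" "a \<in> V - K" | "b \<in> V - K" "a = par b" using mem[of a b] by auto
    then show ?thesis
    proof cases
      case 1 then show ?thesis using ab by (auto simp: D_def C_def)
    next
      case 2 then show ?thesis using ab leafC[of a b] by (auto simp: D_def C_def)
    qed
  qed
  have EC: "E \<inter> D \<times> D = {v} \<times> C \<union> C \<times> {v}"
  proof -
    have "(a, b) \<in> E \<and> a \<in> D \<and> b \<in> D \<longleftrightarrow> (a = v \<and> b \<in> C) \<or> (a \<in> C \<and> b = v)" for a b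
    proof
      assume ab: "(a, b) \<in> E \<and> a \<in> D \<and> b \<in> D"
      then have "a \<notin> K" using DV by auto
      then consider "b = par a" "a \<in> V - K" | "b \<in> V - K" "a = par b" using mem[of a b] ab by auto
      then show "(a = v \<and> b \<in> C) \<or> (a \<in> C \<and> b = v)"
      proof cases
        case 1 then show ?thesis using ab p leafC[of b a] by (auto simp: D_def)
      next
        case 2 then show ?thesis using ab p leafC[of a b] by (auto simp: D_def)
      qed
    next
      assume "(a = v \<and> b \<in> C) \<or> (a \<in> C \<and> b = v)"
      then show "(a, b) \<in> E \<and> a \<in> D \<and> b \<in> D"
        using par(1) E_commute by (auto simp: D_def C_def)
    qed
    then show ?thesis by auto
  qed
  have cardED: "card (E \<inter> D \<times> D) = 2 * card C"
    unfolding EC using C0 CV by (subst card_Un_disjoint) (auto simp: card_cartesian_product)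
  have vp: "(v, ?p) \<in> E" using par(1)[of v] vV by auto
  have E_split: "E = (E \<inter> D \<times> D) \<union> (E \<inter> ?W \<times> ?W) \<union> {(v, ?p), (?p, v)}"
  proof -
    have "E \<subseteq> (E \<inter> D \<times> D) \<union> (E \<inter> ?W \<times> ?W) \<union> {(v, ?p), (?p, v)}"
    proof (rule subrelI)
      fix a b assume ab: "(a, b) \<in> E"
      show "(a, b) \<in> (E \<inter> D \<times> D) \<union> (E \<inter> ?W \<times> ?W) \<union> {(v, ?p), (?p, v)}"
        using only[of a b] only[of b a] E_commute[OF ab] E_in[OF ab] ab
        by (cases "a \<in> D"; cases "b \<in> D") simp_all
    qed
    then show ?thesis using vp E_commute[OF vp] by blast
  qed
  have "card E = card ((E \<inter> D \<times> D) \<union> (E \<inter> ?W \<times> ?W)) + card {(v, ?p), (?p, v)}"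
    by (subst E_split, rule card_Un_disjoint) (use finite_E p D_def in auto)
  also have "card ((E \<inter> D \<times> D) \<union> (E \<inter> ?W \<times> ?W)) = card (E \<inter> D \<times> D) + card (E \<inter> ?W \<times> ?W)"
    by (rule card_Un_disjoint) (use finite_E in auto)
  also have "card {(v, ?p), (?p, v)} = 2" using p by (auto simp: D_def card_insert_if)
  finally have cE: "card E = 2 * card C + card (E \<inter> ?W \<times> ?W) + 2" using cardED by simp
  have connW: "conn ?W (E \<inter> ?W \<times> ?W)"
    unfolding conn_def
  proof (intro allI impI)
    fix S assume S: "S \<subseteq> ?W" "S \<noteq> {}" "S \<noteq> ?W"
    show "\<exists>a\<in>S. \<exists>b\<in>?W - S. (a, b) \<in> E \<inter> ?W \<times> ?W"
    proof (cases "?p \<in> S")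
      case True
      have "S \<union> D \<subseteq> V" "S \<union> D \<noteq> {}" "S \<union> D \<noteq> V" using S DV by auto
      then obtain a b where ab: "a \<in> S \<union> D" "b \<in> V - (S \<union> D)" "(a, b) \<in> E"
        using conn[unfolded conn_def, rule_format, of "S \<union> D"] by blast
      then have "a \<notin> D" using only[of a b] True by blast
      then show ?thesis using ab S by blast
    next
      case False
      have "S \<subseteq> V" "S \<noteq> V" using S DV vV by (auto simp: D_def)
      then obtain a b where ab: "a \<in> S" "b \<in> V - S" "(a, b) \<in> E"
        using conn[unfolded conn_def, rule_format, of S] S(2) by blast
      then have "b \<notin> D" using only[of b a] False E_commute[OF ab(3)] S(1) by blast
      then show ?thesis using ab S(1) by blast
    qed
  qed
  show ?thesis
  proof (rule bridge_bound[OF sgraph_axioms card cy basis DV(1) _ p vp _ _ only])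
    show "v \<in> D" by (simp add: D_def)
    show "2 \<le> card D" using cardDC C0 by (simp add: Suc_le_eq card_gt_0_iff)
    have "card K \<le> card ?W" using DV K finite_V by (intro card_mono) auto
    then show "3 \<le> card ?W" using K(2) by simp
    show "card (E \<inter> D \<times> D) + 2 = 2 * card D" using cardED cardDC by simp
    show "\<exists>z\<in>D. (y, z) \<in> E" if "y \<in> D" for y
    proof (cases "y = v")
      case True
      obtain z where "z \<in> C" using C0 by auto
      then have "(v, z) \<in> E" "z \<in> D" using par(1)[of z] E_commute by (auto simp: C_def D_def)
      then show ?thesis using True by auto
    next
      case False
      then have "y \<in> C" using that by (simp add: D_def)
      then have "(y, v) \<in> E" using par(1)[of y] by (auto simp: C_def)
      then show ?thesis by (auto simp: D_def)
    qed
    show "\<nu> 0 + \<nu> 1 \<le> card (E \<inter> ?W \<times> ?W) / 2 + 3" if "eigenbasis ?W (lapl (E \<inter> ?W \<times> ?W)) y \<nu>" for y \<nu>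
    proof (rule IH[OF _ _ connW _ that])
      show "?W \<subset> V" using vV by (auto simp: D_def)
      show "?W \<noteq> {}" using p by auto
      show "card (E \<inter> ?W \<times> ?W) + 2 = 2 * (card ?W + cy)" using card cE nV cardDC by simp
    qed
  qed
qed

text \<open>A core that is not large is determined by counting arcs: for \<open>cy = 1\<close> three
  vertices span all 6 arcs, a triangle; for \<open>cy = 2\<close> three vertices cannot hold the
  required 8 arcs, and four lack just one edge of the clique.\<close>

lemma (in sgraph) pendant_case:
  assumes conn: "conn V E" and card: "card E + 2 = 2 * (card V + cy)" and cy: "cy = 1 \<or> cy = 2"
    and basis: "eigenbasis V (lapl E) x \<mu>"
    and K: "K \<subseteq> V" "3 \<le> card K" and par: "\<And>v. v \<in> V - K \<Longrightarrow> par v \<in> K"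
    and E_eq: "E = (E \<inter> K \<times> K) \<union> (\<lambda>v. (v, par v)) ` (V - K) \<union> (\<lambda>v. (par v, v)) ` (V - K)"
    and core: "\<And>v. v \<in> K \<Longrightarrow> 2 \<le> card (E `` {v} \<inter> K)" "card (E \<inter> K \<times> K) + 2 = 2 * (card K + cy)"
  shows "\<mu> 0 + \<mu> 1 \<le> card E / 2 + 3 \<and> (\<mu> 0 + \<mu> 1 = card E / 2 + 3 \<longrightarrow> extremal V E cy)"
proof -
  interpret spectrum V E x \<mu> using sgraph_axioms basis by (simp add: spectrum_def spectrum_axioms_def)
  have finK: "finite K" using finite_subset[OF K(1) finite_V] .
  have n: "3 \<le> card V" using K card_mono[OF finite_V K(1)] by simp
  have x2: "orthonormal V 2 x" by (rule orthonormal_subset[OF x_ortho]) (use n in simp)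
  have pos: "0 < \<mu> i" if "i < 2" for i using \<mu>_pos[OF conn, of i] n that by simp
  have lt: "gram 2 x u u < 1" if "u \<in> V" for u using gram_diag_less_1[of 2 u] n pos that by simp
  interpret P: projection V 2 "gram 2 x" by (rule projection_gram[OF finite_V x2])
  interpret cyclic_core V E 2 "gram 2 x" K par cy
  proof unfold_locales
    show "E = (E \<inter> K \<times> K) \<union> (\<lambda>v. (v, par v)) ` (V - K) \<union> (\<lambda>v. (par v, v)) ` (V - K)" by (rule E_eq)
    show "par v \<noteq> v" "par v \<in> V" if "v \<in> V - K" for v using that par[OF that] K(1) by auto
    show "par (par v) \<noteq> v" if "v \<in> V - K" "par v \<in> V - K" for v using that par[of v] by blast
  qed (use K(1) lt core in auto)
  have leaves: "ch w = {}" if "w \<in> V - K" for w using that par by (auto simp: ch_def)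
  have m: "\<mu> 0 + \<mu> 1 = excess E (gram 2 x) + real (card E) / 2"
    using sum_\<mu>[of 2] n by (simp add: numeral_2_eq_2)
  let ?F = "{(u, v) \<in> K \<times> K. u \<noteq> v}" and ?P = "V - K"
  have F: "?F = Sigma K (\<lambda>u. K - {u})" by auto
  have finF: "finite ?F" unfolding F using finK by simp
  have cF: "card ?F = card K * (card K - 1)" unfolding F using finK by simp
  have EF: "E \<inter> K \<times> K \<subseteq> ?F" using not_self by auto
  have parK: "par ` ?P \<subseteq> K" using par by auto
  have nP: "card V = card K + card ?P" using card_Diff_subset[OF finK K(1)] card_mono[OF finite_V K(1)] by simp
  show ?thesis
  proof (cases "cy = 1")
    case cy1: True
    show ?thesis
    proof (cases "4 \<le> card K")
      case True
      then show ?thesis using unicyclic_k2_large_core[OF refl cy1 True leaves] m by simp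
    next
      case False
      then have K3: "card K = 3" using K(2) by simp
      then have "E \<inter> K \<times> K = ?F" using core(2) cy1 cF by (intro card_subset_eq[OF finF EF]) simp
      then have EC: "E = clique_pendant_arcs K ?P par" using E_eq unfolding clique_pendant_arcs_def by simp
      obtain a b c where abc: "K = {a, b, c}" "a \<noteq> b" "b \<noteq> c" "a \<noteq> c" using K3 by (auto simp: card_3_iff)
      interpret C: clique_pendants V K ?P par a b c
        using finite_V K(1) parK abc K3 by unfold_locales auto
      have basis': "eigenbasis V (lapl C.E) x \<mu>" using basis unfolding EC .
      have cE: "real (card E) / 2 + 3 = 6 + real (card ?P)" using card nP K3 cy1 by simp
      have le: "\<mu> 0 + \<mu> 1 \<le> 6 + real (card ?P)" using C.clique_pendants_sum(1)[OF basis'] K3 by simp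
      moreover have "extremal V E cy" if "\<mu> 0 + \<mu> 1 = 6 + real (card ?P)"
      proof -
        have "\<not> 0 < C.\<alpha> a * C.\<alpha> b + C.\<alpha> b * C.\<alpha> c + C.\<alpha> c * C.\<alpha> a"
          using C.clique_pendants_sum(2)[OF basis'] K3 that by auto
        then obtain h where h: "h \<in> {a, b, c}" "\<forall>y\<in>?P. par y = h" using C.single_hub by blast
        then obtain v t where vt: "K = {h, v, t}" "h \<noteq> v" "h \<noteq> t" "v \<noteq> t"
          using abc by (metis empty_iff insert_commute insert_iff)
        have "E = two_center_arcs V h v {t}" unfolding EC by (rule triangle_two_center[OF vt K(1) h(2)])
        moreover have "h \<in> V" "v \<in> V" "{t} \<subseteq> V - {h, v}" using vt K(1) by auto
        ultimately show ?thesis unfolding extremal_def cy1 using vt(2)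
          by (intro exI[of _ h] exI[of _ v] exI[of _ "{t}"]) simp
      qed
      ultimately show ?thesis unfolding cE by simp
    qed
  next
    case False
    then have cy2: "cy = 2" using cy by simp
    show ?thesis
    proof (cases "5 \<le> card K")
      case True
      then show ?thesis using bicyclic_k2_large_core[OF refl cy2 True leaves] m by simp
    next
      case False
      have K4: "card K = 4"
      proof (rule ccontr)
        assume "card K \<noteq> 4"
        then have "card K = 3" using K(2) False by simp
        then show False using card_mono[OF finF EF] cF core(2) cy2 by simp
      qed
      let ?R = "?F - E \<inter> K \<times> K"
      have cR: "card ?R = 2" using card_Diff_subset[OF finite_subset[OF EF finF] EF] cF core(2) cy2 K4 by simp
      then have "?R \<noteq> {}" by (intro notI) (simp only: card.empty)
      then obtain q where "q \<in> ?R" by (meson ex_in_conv)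
      then have "(fst q, snd q) \<in> ?R" by (simp only: prod.collapse)
      then obtain w1 w2 where w: "(w1, w2) \<in> ?R" by (rule that)
      then have w': "(w2, w1) \<in> ?R" "w1 \<noteq> w2" "w1 \<in> K" "w2 \<in> K" using E_commute by auto
      have R: "?R = {(w1, w2), (w2, w1)}"
        using w w' cR finF by (intro card_subset_eq[symmetric]) auto
      have "card (K - {w1, w2}) = 2" using K4 w' finK by simp
      then obtain u1 u2 where u: "K - {w1, w2} = {u1, u2}" "u1 \<noteq> u2" by (auto simp: card_2_iff)
      have Ku: "K = {u1, u2, w1, w2}" using u w' by blast
      have EC: "E = clique_pendant_arcs K ?P par - {(w1, w2), (w2, w1)}"
      proof -
        have "E \<inter> K \<times> K = ?F - {(w1, w2), (w2, w1)}"
          unfolding R[symmetric] by (rule double_diff[OF EF subset_refl, symmetric])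
        moreover have "clique_pendant_arcs K ?P par - {(w1, w2), (w2, w1)} =
            (?F - {(w1, w2), (w2, w1)}) \<union> (\<lambda>v. (v, par v)) ` ?P \<union> (\<lambda>v. (par v, v)) ` ?P"
          unfolding clique_pendant_arcs_def using w'(3,4) by auto
        ultimately show ?thesis using E_eq by simp
      qed
      have cE: "real (card E) / 2 + 3 = 8 + real (card ?P)" using card nP K4 cy2 by simp
      have le: "\<mu> 0 + \<mu> 1 \<le> 8 + real (card ?P)"
        by (rule diamond_pendants(1)[OF sgraph_axioms basis Ku K4 K(1) parK EC pos]) simp
      moreover have "extremal V E cy" if eq: "\<mu> 0 + \<mu> 1 = 8 + real (card ?P)"
      proof -
        have ex: "extremal V E cy" if h: "\<forall>y\<in>?P. par y = h" and hv: "K = {h, v, w1, w2}" for h v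
        proof -
          have dist: "h \<noteq> v" "h \<noteq> w1" "h \<noteq> w2" "v \<noteq> w1" "v \<noteq> w2" "w1 \<noteq> w2"
            using K4 unfolding hv by (auto simp: card_insert_if split: if_splits)
          have "E = two_center_arcs V h v {w1, w2}"
            using EC diamond_two_center[OF hv K4 K(1) h] by simp
          moreover have "h \<in> V" "v \<in> V" "{w1, w2} \<subseteq> V - {h, v}" using hv K(1) dist by auto
          ultimately show ?thesis unfolding extremal_def cy2 using dist
            by (intro exI[of _ h] exI[of _ v] exI[of _ "{w1, w2}"]) simp
        qed
        have "(\<forall>y\<in>?P. par y = u1) \<or> (\<forall>y\<in>?P. par y = u2)"
          by (rule diamond_pendants(2)[OF sgraph_axioms basis Ku K4 K(1) parK EC pos eq]) simp
        then show ?thesis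
        proof
          assume "\<forall>y\<in>?P. par y = u1" then show ?thesis by (rule ex[OF _ Ku])
        next
          assume "\<forall>y\<in>?P. par y = u2" then show ?thesis
            by (rule ex) (simp only: Ku insert_commute[of u1 u2])
        qed
      qed
      ultimately show ?thesis unfolding cE by simp
    qed
  qed
qed

theorem cyclic_k2:
  assumes "sgraph V E" "conn V E" "V \<noteq> {}" "card E + 2 = 2 * (card V + cy)" "cy = 1 \<or> cy = 2"
    "eigenbasis V (lapl E) x \<mu>"
  shows "\<mu> 0 + \<mu> 1 \<le> card E / 2 + 3 \<and> (\<mu> 0 + \<mu> 1 = card E / 2 + 3 \<longrightarrow> extremal V E cy)"
  using assms
proof (induction "card V" arbitrary: V E x \<mu> rule: less_induct)
  case less
  interpret sgraph V E by (rule less.prems)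
  have cy1: "1 \<le> cy" using less.prems by auto
  obtain K par and d :: "'a \<Rightarrow> nat" where K: "K \<subseteq> V" "3 \<le> card K"
    and par: "\<And>v. v \<in> V - K \<Longrightarrow> (v, par v) \<in> E" "\<And>v. v \<in> V - K \<Longrightarrow> d (par v) < d v"
    and E_eq: "E = (E \<inter> K \<times> K) \<union> (\<lambda>v. (v, par v)) ` (V - K) \<union> (\<lambda>v. (par v, v)) ` (V - K)"
    and core: "\<And>v. v \<in> K \<Longrightarrow> 2 \<le> card (E `` {v} \<inter> K)" "card (E \<inter> K \<times> K) + 2 = 2 * (card K + cy)"
    by (rule core_exists[OF less.prems(2-4) cy1]) (rule that; assumption)
  show ?case
  proof (cases "\<exists>w\<in>V - K. par w \<notin> K")
    case True
    have "\<mu> 0 + \<mu> 1 < card E / 2 + 3"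
    proof (rule bridge_case[where par = par and d = d and K = K, OF less.prems(2,4) cy1 less.prems(6) K par E_eq True])
      fix W y \<nu> assume W: "W \<subset> V" "W \<noteq> {}" "conn W (E \<inter> W \<times> W)"
        "card (E \<inter> W \<times> W) + 2 = 2 * (card W + cy)" "eigenbasis W (lapl (E \<inter> W \<times> W)) y \<nu>"
      have "card W < card V" by (rule psubset_card_mono[OF finite_V W(1)])
      then show "\<nu> 0 + \<nu> 1 \<le> card (E \<inter> W \<times> W) / 2 + 3"
        by (rule conjunct1[OF less.hyps[OF _ induced[OF psubset_imp_subset[OF W(1)]] W(3,2,4) less.prems(5) W(5)]])
    qed
    then show ?thesis by simp
  next
    case False
    then show ?thesis
      by (intro pendant_case[OF less.prems(2,4,5,6) K _ E_eq core]) auto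
  qed
qed

section \<open>Extremal graphs and isomorphism\<close>

text \<open>Through Ky Fan a few explicit orthogonal eigenvectors bound the eigenvalue sum from
  below, whatever the rest of the spectrum is.\<close>

lemma eigenvectors_sum_le:
  assumes V: "finite V" and basis: "eigenbasis V a x \<mu>"
    and pos: "\<And>i. i < k \<Longrightarrow> 0 < ip V (f i) (f i)"
    and ort: "\<And>i j. i < k \<Longrightarrow> j < k \<Longrightarrow> i \<noteq> j \<Longrightarrow> ip V (f i) (f j) = 0"
    and eig: "\<And>i v. i < k \<Longrightarrow> v \<in> V \<Longrightarrow> app V a (f i) v = l i * f i v"
  shows "(\<Sum>i<k. l i) \<le> (\<Sum>i<k. \<mu> i)"
proof -
  define y where "y i = (\<lambda>v. 1 / sqrt (ip V (f i) (f i)) * f i v)" for i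
  have "ip V (y i) (y j) = (if i = j then 1 else 0)" if "i < k" "j < k" for i j
    using pos[OF that(1)] pos[OF that(2)] ort[OF that] unfolding y_def ip_scale_left ip_scale_right
    by (simp add: real_sqrt_mult_self flip: real_sqrt_mult)
  then have y: "orthonormal V k y" by (simp add: orthonormal_def)
  have "ip V (y i) (app V a (y i)) = l i" if i: "i < k" for i
  proof -
    have "ip V (y i) (app V a (y i)) = ip V (y i) (\<lambda>v. l i * y i v)"
      by (rule ip_cong[OF refl]) (simp only: y_def app_scale, simp add: eig[OF i])
    also have "\<dots> = l i" using y i by (simp add: ip_scale_right orthonormal_def)
    finally show ?thesis .
  qed
  then show ?thesis using ky_fan[OF V basis y] by simp
qed

text \<open>\<open>f\<close> is the eigenvector of the dominating vertex \<open>u\<close>, with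
  eigenvalue \<open>card V\<close>. \<open>g\<close> lives on \<open>v\<close> and \<open>T\<close>
  and has sum 0, which balances the equation at \<open>u\<close>; its eigenvalue is t + 2, and it is
  nonzero for \<open>t \<ge> 1\<close>. The matching upper bounds are known already.\<close>

lemma (in sgraph) extremal_sum_ge:
  fixes x :: "nat \<Rightarrow> 'a \<Rightarrow> real" and \<mu> :: "nat \<Rightarrow> real"
  assumes ex: "extremal V E t" and basis: "eigenbasis V (lapl E) x \<mu>"
  shows "card V \<le> \<mu> 0" and "1 \<le> t \<Longrightarrow> card V + real t + 2 \<le> \<mu> 0 + \<mu> 1"
proof -
  obtain u v T where uv: "u \<in> V" "v \<in> V" "u \<noteq> v" and T: "T \<subseteq> V - {u, v}" "card T = t"
    and E: "E = two_center_arcs V u v T" using ex unfolding extremal_def by blast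
  have finT: "finite T" using finite_subset[OF T(1)] finite_V by simp
  define f where "f w = (if w = u then real (card V) - 1 else - 1)" for w
  define g where "g w = (if w = v then real t else if w \<in> T then - 1 else 0)" for w
  have n: "2 \<le> card V" using card_mono[OF finite_V, of "{u, v}"] uv by simp
  have Nu: "E `` {u} = V - {u}" using T(1) uv unfolding E two_center_arcs_def Let_def by auto
  have Nv: "E `` {v} = insert u T" using T(1) uv unfolding E two_center_arcs_def Let_def by auto
  have NT: "E `` {w} = {u, v}" if "w \<in> T" for w
    using T(1) uv that unfolding E two_center_arcs_def Let_def by auto
  have NP: "E `` {w} = {u}" if "w \<in> V - {u, v} - T" for w
    using T(1) uv that unfolding E two_center_arcs_def Let_def by auto
  have cu: "card (V - {u}) = card V - 1" using uv by simp
  have sumf: "(\<Sum>w\<in>V - {u}. f w) = - (real (card V) - 1)"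
    using cu n by (simp add: f_def of_nat_diff)
  have sg: "(\<Sum>w\<in>V. g w * h w) = real t * h v - (\<Sum>w\<in>T. h w)" for h
  proof -
    have "(\<Sum>w\<in>V. g w * h w) = (\<Sum>w\<in>insert v T. g w * h w)"
      using T(1) uv finite_V by (intro sum.mono_neutral_right) (auto simp: g_def)
    also have "\<dots> = real t * h v + (\<Sum>w\<in>T. g w * h w)"
      using finT T(1) by (subst sum.insert) (auto simp: g_def)
    also have "(\<Sum>w\<in>T. g w * h w) = (\<Sum>w\<in>T. - h w)"
      using T(1) by (intro sum.cong refl) (auto simp: g_def)
    finally show ?thesis by (simp add: sum_negf)
  qed
  have eigf: "app V (lapl E) f w = card V * f w" if w: "w \<in> V" for w
  proof -
    consider "w = u" | "w = v" | "w \<in> T" | "w \<in> V - {u, v} - T" using w by blast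
    then show ?thesis
    proof cases
      case 1
      have "(\<Sum>z\<in>V - {u}. f u - f z) = (\<Sum>z\<in>V - {u}. real (card V))"
        by (intro sum.cong refl) (auto simp: f_def)
      then show ?thesis using 1 cu n unfolding app_lapl[OF w] unfolding 1 Nu by (simp add: f_def of_nat_diff)
    next
      case 2
      have "(\<Sum>z\<in>T. f v - f z) = 0" using T(1) uv by (intro sum.neutral) (auto simp: f_def)
      then show ?thesis using T(1) finT uv unfolding app_lapl[OF w] unfolding 2 Nv
        by (subst sum.insert) (auto simp: f_def)
    next
      case 3
      then have "w \<noteq> u" using T(1) by auto
      then show ?thesis using uv unfolding app_lapl[OF w] NT[OF 3] by (simp add: f_def)
    next
      case 4
      then have "w \<noteq> u" by auto
      then show ?thesis unfolding app_lapl[OF w] NP[OF 4] by (simp add: f_def)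
    qed
  qed
  have eigg: "app V (lapl E) g w = (real t + 2) * g w" if w: "w \<in> V" for w
  proof -
    consider "w = u" | "w = v" | "w \<in> T" | "w \<in> V - {u, v} - T" using w by blast
    then show ?thesis
    proof cases
      case 1
      have gu: "g u = 0" using T(1) uv by (auto simp: g_def)
      have "(\<Sum>z\<in>V. g z) = 0" using sg[of "\<lambda>_. 1"] T(2) by simp
      then have "(\<Sum>z\<in>V - {u}. g z) = 0" using sum.remove[OF finite_V uv(1), of g] gu by simp
      then show ?thesis unfolding app_lapl[OF w] unfolding 1 Nu gu by (simp add: sum_negf)
    next
      case 2
      have gT: "(\<Sum>z\<in>T. g v - g z) = (\<Sum>z\<in>T. real t + 1)"
        using T(1) by (intro sum.cong refl) (auto simp: g_def)
      have gu: "g u = 0" "g v = real t" using T(1) uv by (auto simp: g_def)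
      have "u \<notin> T" using T(1) by auto
      then show ?thesis using finT gT gu T(2) unfolding app_lapl[OF w] unfolding 2 Nv by (simp add: algebra_simps)
    next
      case 3
      then have "g w = - 1" "g u = 0" "g v = real t" using T(1) uv by (auto simp: g_def)
      then show ?thesis using uv unfolding app_lapl[OF w] NT[OF 3] by simp
    next
      case 4
      then have "g w = 0" "g u = 0" using T(1) uv by (auto simp: g_def)
      then show ?thesis unfolding app_lapl[OF w] NP[OF 4] by simp
    qed
  qed
  have posf: "0 < ip V f f"
    using ip_nonneg[of V f] ip_eq_0_iff[OF finite_V, of f] uv by (force simp: f_def less_le)
  have "(\<Sum>i<1::nat. real (card V)) \<le> (\<Sum>i<1. \<mu> i)"
    by (rule eigenvectors_sum_le[OF finite_V basis, of _ "\<lambda>_. f"]) (use posf eigf in auto)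
  then show "card V \<le> \<mu> 0" by simp
  assume t: "1 \<le> t"
  have posg: "0 < ip V g g"
    using ip_nonneg[of V g] ip_eq_0_iff[OF finite_V, of g] uv t by (force simp: g_def less_le)
  have fg: "ip V f g = 0" "ip V g f = 0"
  proof -
    have "(\<Sum>w\<in>T. f w) = - real t"
    proof -
      have "(\<Sum>w\<in>T. f w) = (\<Sum>w\<in>T. - 1)" using T(1) by (intro sum.cong refl) (auto simp: f_def)
      then show ?thesis using T(2) by simp
    qed
    then show "ip V g f = 0" unfolding ip_def sg using uv by (simp add: f_def)
    then show "ip V f g = 0" by (simp add: ip_def mult.commute)
  qed
  have "(\<Sum>i<2::nat. if i = 0 then real (card V) else real t + 2) \<le> (\<Sum>i<2. \<mu> i)"
    by (rule eigenvectors_sum_le[OF finite_V basis, of _ "\<lambda>i. if i = 0 then f else g"])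
      (use posf posg fg eigf eigg in \<open>auto simp: less_2_cases_iff\<close>)
  then show "card V + real t + 2 \<le> \<mu> 0 + \<mu> 1" by (simp add: numeral_2_eq_2)
qed

lemma two_center_arcs_image:
  assumes f: "inj_on f V" and uv: "u \<in> V" "v \<in> V" "T \<subseteq> V"
  shows "map_prod f f ` two_center_arcs V u v T = two_center_arcs (f ` V) (f u) (f v) (f ` T)"
proof -
  have d: "f ` (V - {u}) = f ` V - {f u}" using inj_on_image_set_diff[OF f, of V "{u}"] uv by simp
  have prod: "map_prod f f ` (A \<times> B) = f ` A \<times> f ` B" for A B by (simp add: map_prod_surj_on)
  have conv: "map_prod f f ` A\<inverse> = (map_prod f f ` A)\<inverse>" for A by force
  show ?thesis unfolding two_center_arcs_def Let_def
    by (simp only: image_Un conv prod d image_insert image_empty)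
qed

lemma extremal_image:
  assumes f: "inj_on f V" and ex: "extremal V E t"
  shows "extremal (f ` V) (map_prod f f ` E) t"
proof -
  obtain u v T where uv: "u \<in> V" "v \<in> V" "u \<noteq> v" and T: "T \<subseteq> V - {u, v}" "card T = t"
    and E: "E = two_center_arcs V u v T" using ex unfolding extremal_def by blast
  have TV: "T \<subseteq> V" using T by auto
  have "map_prod f f ` E = two_center_arcs (f ` V) (f u) (f v) (f ` T)"
    unfolding E by (rule two_center_arcs_image[OF f uv(1,2) TV])
  moreover have "f ` T \<subseteq> f ` V - {f u, f v}"
    using T(1) inj_onD[OF f] uv by blast
  moreover have "card (f ` T) = t" using card_image[OF inj_on_subset[OF f TV]] T(2) by simp
  moreover have "f u \<noteq> f v" using inj_onD[OF f] uv by blast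
  ultimately show ?thesis unfolding extremal_def using uv by blast
qed

text \<open>\<open>extremal\<close> is invariant under injective renaming and determines the graph
  up to isomorphism: the blocks \<open>{u, v}\<close>, \<open>T\<close> and the rest are mapped to
  consecutive intervals.\<close>

lemma ex_iso_extremal_iff:
  assumes V: "finite V" "card V = n" and E: "E \<subseteq> V \<times> V" and t: "t + 2 \<le> n"
  shows "(\<exists>f. inj_on f V \<and> {..<n} = f ` V \<and> two_center_arcs {..<n} 0 1 {2..<t + 2} = map_prod f f ` E)
    \<longleftrightarrow> extremal V E t"
proof
  assume "\<exists>f. inj_on f V \<and> {..<n} = f ` V \<and> two_center_arcs {..<n} 0 1 {2..<t + 2} = map_prod f f ` E"
  then obtain f where f: "inj_on f V" "{..<n} = f ` V"
    and fE: "two_center_arcs {..<n} 0 1 {2..<t + 2} = map_prod f f ` E" by blast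
  let ?g = "the_inv_into V f"
  have "extremal {..<n} (two_center_arcs {..<n} 0 1 {2..<t + 2}) t"
    unfolding extremal_def
    by (intro exI[of _ 0] exI[of _ 1] exI[of _ "{2..<t + 2}"]) (use t in auto)
  moreover have "inj_on ?g {..<n}" unfolding f(2) by (rule inj_on_the_inv_into[OF f(1)])
  ultimately have "extremal (?g ` {..<n}) (map_prod ?g ?g ` map_prod f f ` E) t"
    unfolding fE[symmetric] by (intro extremal_image)
  moreover have "?g ` {..<n} = V" unfolding f(2) using f(1) by (force simp: image_iff the_inv_into_f_f)
  moreover have "map_prod ?g ?g ` map_prod f f ` E = (\<lambda>p. p) ` E"
    unfolding image_image by (rule image_cong[OF refl]) (use E f(1) in \<open>auto simp: the_inv_into_f_f\<close>)
  ultimately show "extremal V E t" by simp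
next
  assume "extremal V E t"
  then obtain u v T where uv: "u \<in> V" "v \<in> V" "u \<noteq> v" and T: "T \<subseteq> V - {u, v}" "card T = t"
    and E: "E = two_center_arcs V u v T" unfolding extremal_def by blast
  have fin: "finite T" "finite (V - {u, v} - T)" using finite_subset[OF T(1)] V by auto
  have c2: "card (V - {u, v}) = n - 2" using uv V by (simp add: card_Diff_subset)
  have "card (V - {u, v} - T) = n - 2 - t" using card_Diff_subset[OF fin(1) T(1)] c2 T(2) by simp
  then obtain h where h: "bij_betw h (V - {u, v} - T) {t + 2..<n}"
    using finite_same_card_bij[OF fin(2), of "{t + 2..<n}"] by auto
  obtain g where g: "bij_betw g T {2..<t + 2}"
    using finite_same_card_bij[OF fin(1), of "{2..<t + 2}"] T(2) by auto
  define f where "f w = (if w = u then 0 else if w = v then 1 else if w \<in> T then g w else h w)" for w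
  have fu: "f u = 0" "f v = 1" using uv by (auto simp: f_def)
  have fT: "bij_betw f T {2..<t + 2}"
    using g by (rule bij_betw_cong[THEN iffD1, rotated]) (use T(1) in \<open>auto simp: f_def\<close>)
  have fR: "bij_betw f (V - {u, v} - T) {t + 2..<n}"
    using h by (rule bij_betw_cong[THEN iffD1, rotated]) (auto simp: f_def)
  have "bij_betw f {u, v} {0, 1}" using fu uv by (auto simp: bij_betw_def)
  then have "bij_betw f ({u, v} \<union> T) ({0, 1} \<union> {2..<t + 2})" using fT by (rule bij_betw_combine) auto
  then have "bij_betw f ({u, v} \<union> T \<union> (V - {u, v} - T)) ({0, 1} \<union> {2..<t + 2} \<union> {t + 2..<n})"
    using fR by (rule bij_betw_combine) auto
  moreover have "{u, v} \<union> T \<union> (V - {u, v} - T) = V" using uv T(1) by auto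
  moreover have "{0, 1} \<union> {2..<t + 2} \<union> {t + 2..<n} = {..<n}" using t by auto
  ultimately have "bij_betw f V {..<n}" by (simp only:)
  then have f: "inj_on f V" "f ` V = {..<n}" unfolding bij_betw_def by blast+
  have fE: "map_prod f f ` E = two_center_arcs {..<n} 0 1 {2..<t + 2}"
    unfolding E using two_center_arcs_image[OF f(1) uv(1,2), of T] T(1) fu f(2) fT by (auto simp: bij_betw_def)
  then show "\<exists>f. inj_on f V \<and> {..<n} = f ` V \<and> two_center_arcs {..<n} 0 1 {2..<t + 2} = map_prod f f ` E"
    by (intro exI[of _ f] conjI f(1) f(2)[symmetric] fE[symmetric])
qed

section \<open>From digraph isomorphism to arc sets\<close>

text \<open>A digraph isomorphism has a separate arc map, but as head and tail are the projections
  of a pair, the vertex map determines it.\<close>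

lemma digraph_iso_with_proj:
  assumes "pair_wf_digraph G"
  shows "digraph_iso (with_proj G) (with_proj H) \<longleftrightarrow>
    (\<exists>f. inj_on f (pverts G) \<and> pverts H = f ` pverts G \<and> parcs H = map_prod f f ` parcs G)"
proof
  interpret pair_wf_digraph G by (rule assms)
  assume "digraph_iso (with_proj G) (with_proj H)"
  then obtain i where i: "pre_digraph.digraph_isomorphism (with_proj G) i" "with_proj H = app_iso i (with_proj G)"
    unfolding digraph_iso_def by blast
  have H: "pverts H = iso_verts i ` pverts G" "parcs H = iso_arcs i ` parcs G" "iso_tail i = fst" "iso_head i = snd"
    using arg_cong[OF i(2), of verts] arg_cong[OF i(2), of arcs] arg_cong[OF i(2), of tail] arg_cong[OF i(2), of head]
    by simp_all
  have "iso_arcs i a = map_prod (iso_verts i) (iso_verts i) a" if "a \<in> parcs G" for a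
    using i(1) that H(3,4) unfolding pre_digraph.digraph_isomorphism_def by (simp add: prod_eq_iff)
  then have "parcs H = map_prod (iso_verts i) (iso_verts i) ` parcs G" unfolding H(2) by (rule image_cong[OF refl])
  moreover have "inj_on (iso_verts i) (pverts G)" using i(1) unfolding pre_digraph.digraph_isomorphism_def by simp
  ultimately show "\<exists>f. inj_on f (pverts G) \<and> pverts H = f ` pverts G \<and> parcs H = map_prod f f ` parcs G"
    using H(1) by blast
next
  interpret pair_wf_digraph G by (rule assms)
  assume "\<exists>f. inj_on f (pverts G) \<and> pverts H = f ` pverts G \<and> parcs H = map_prod f f ` parcs G"
  then obtain f where f: "inj_on f (pverts G)" "pverts H = f ` pverts G" "parcs H = map_prod f f ` parcs G" by blast
  let ?i = "\<lparr>iso_verts = f, iso_arcs = map_prod f f, iso_head = snd, iso_tail = fst\<rparr>"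
  have "inj_on (map_prod f f) (pverts G \<times> pverts G)" using f(1) by (intro map_prod_inj_on)
  then have "inj_on (map_prod f f) (parcs G)" by (rule inj_on_subset) (auto dest: in_arcsD1 in_arcsD2)
  then have "pre_digraph.digraph_isomorphism (with_proj G) ?i"
    unfolding pre_digraph.digraph_isomorphism_def using f(1) wf_digraph_axioms by simp
  moreover have "with_proj H = app_iso ?i (with_proj G)" unfolding with_proj_def app_iso_def using f by simp
  ultimately show "digraph_iso (with_proj G) (with_proj H)" unfolding digraph_iso_def by blast
qed

text \<open>The empty set is written \<open>{2..<0 + 2}\<close> so that the star appears as the
  member t = 0 of the family.\<close>

lemma star_graph_arcs: "2 \<le> n \<Longrightarrow> parcs (star_graph n) = two_center_arcs {..<n} 0 1 {2..<0 + 2}"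
  unfolding star_graph_def two_center_arcs_def Let_def by auto

lemma G_graph_arcs:
  assumes "t + 2 \<le> n"
  shows "parcs (G_graph (n - (t + 2)) t) = two_center_arcs {..<n} 0 1 {2..<t + 2}"
proof -
  have 1: "{..<n} - {0} = insert 1 ({2..<t + 2} \<union> {t + 2..<n})" using assms by auto
  have 2: "n - (t + 2) + t + 2 = n" using assms by simp
  show ?thesis unfolding G_graph_def two_center_arcs_def Let_def 1 2 by auto
qed

context pair_graph
begin

lemma sgraph: "sgraph (pverts G) (parcs G)"
proof
  show "finite (pverts G)" by (rule pair_finite_verts)
  show "parcs G \<subseteq> pverts G \<times> pverts G" by (auto dest: in_arcsD1 in_arcsD2)
  show "sym (parcs G)" using pair_sym_arcs by (simp add: symmetric_def)
  show "irrefl (parcs G)" using pair_no_loops by (fastforce simp: irrefl_def)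
qed

lemma conn:
  assumes "Digraph_Component.connected (with_proj G)"
  shows "conn (pverts G) (parcs G)" "pverts G \<noteq> {}"
proof -
  have sc: "strongly_connected (with_proj G)" using symmetric_connected_imp_strongly_connected[OF pair_sym_arcs assms] .
  then show "pverts G \<noteq> {}" by (simp add: strongly_connected_def)
  show "conn (pverts G) (parcs G)" unfolding conn_def
  proof (intro allI impI)
    fix S assume S: "S \<subseteq> pverts G" "S \<noteq> {}" "S \<noteq> pverts G"
    then obtain a b where ab: "a \<in> S" "b \<in> pverts G" "b \<notin> S" by blast
    then have "a \<in> pverts G" using S by blast
    then have "(a, b) \<in> rtrancl_on (pverts G) (parcs G)"
      using sc ab by (simp add: strongly_connected_def reachable_def)
    then have "(\<exists>u\<in>S. \<exists>v\<in>pverts G - S. (u, v) \<in> parcs G) \<or> b \<in> S"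
    proof (induction rule: rtrancl_on_induct)
      case base then show ?case using ab by blast
    next
      case (step y z) then show ?case by blast
    qed
    then show "\<exists>u\<in>S. \<exists>v\<in>pverts G - S. (u, v) \<in> parcs G" using ab by blast
  qed
qed

lemma card_parcs: "card (parcs G) = 2 * num_edges G"
proof -
  interpret sgraph "pverts G" "parcs G" by (rule sgraph)
  let ?g = "\<lambda>(u, v). {u, v}" and ?X = "{{u, v} | u v. (u, v) \<in> parcs G}"
  have X: "?X = ?g ` parcs G" by force
  have fX: "finite ?X" unfolding X using finite_E by simp
  have "card {p \<in> parcs G. ?g p = e} = 2" if e: "e \<in> ?X" for e
  proof -
    obtain u v where uv: "(u, v) \<in> parcs G" "e = {u, v}" using e by blast
    then have "{p \<in> parcs G. ?g p = e} = {(u, v), (v, u)}"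
      using E_commute by (auto simp: doubleton_eq_iff)
    moreover have "u \<noteq> v" using uv(1) not_self by auto
    ultimately show ?thesis by simp
  qed
  then have "(\<Sum>e\<in>?X. card {p \<in> parcs G. ?g p = e}) = 2 * num_edges G" by (simp add: num_edges_def)
  moreover have "(\<Sum>e\<in>?X. \<Sum>p\<in>{p \<in> parcs G. ?g p = e}. 1 :: nat) = (\<Sum>p\<in>parcs G. 1)"
    by (rule sum.group[OF finite_E fX]) (simp add: X)
  ultimately show ?thesis by simp
qed

end

section \<open>Assembly of all cases\<close>

lemma (in sgraph) bicyclic_k3:
  assumes conn: "conn V E" and ne: "V \<noteq> {}" and card: "card E + 2 = 2 * (card V + 2)"
    and basis: "eigenbasis V (lapl E) x \<mu>" and n: "4 \<le> card V"
  shows "(\<Sum>i<3. \<mu> i) < card E / 2 + 6"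
proof -
  interpret spectrum V E x \<mu> using sgraph_axioms basis by (simp add: spectrum_def spectrum_axioms_def)
  obtain K par and d :: "'a \<Rightarrow> nat" where K: "K \<subseteq> V" "3 \<le> card K"
    and par: "\<And>v. v \<in> V - K \<Longrightarrow> (v, par v) \<in> E" "\<And>v. v \<in> V - K \<Longrightarrow> d (par v) < d v"
    and E_eq: "E = (E \<inter> K \<times> K) \<union> (\<lambda>v. (v, par v)) ` (V - K) \<union> (\<lambda>v. (par v, v)) ` (V - K)"
    and core: "\<And>v. v \<in> K \<Longrightarrow> 2 \<le> card (E `` {v} \<inter> K)" "card (E \<inter> K \<times> K) + 2 = 2 * (card K + 2)"
    by (rule core_exists[OF conn ne card one_le_numeral]) (rule that; assumption)
  have x3: "orthonormal V 3 x" by (rule orthonormal_subset[OF x_ortho]) (use n in simp)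
  have pos: "0 < \<mu> i" if "i < 3" for i using \<mu>_pos[OF conn, of i] n that by simp
  have lt: "gram 3 x u u < 1" if "u \<in> V" for u using gram_diag_less_1[of 3 u] n pos that by simp
  interpret P: projection V 3 "gram 3 x" by (rule projection_gram[OF finite_V x3])
  interpret cyclic_core V E 3 "gram 3 x" K par 2
  proof unfold_locales
    show "E = (E \<inter> K \<times> K) \<union> (\<lambda>v. (v, par v)) ` (V - K) \<union> (\<lambda>v. (par v, v)) ` (V - K)" by (rule E_eq)
    show "par v \<noteq> v" "par v \<in> V" if "v \<in> V - K" for v using par[OF that] E_in by auto
    show "par (par v) \<noteq> v" if "v \<in> V - K" "par v \<in> V - K" for v using par(2)[OF that(1)] par(2)[OF that(2)] by auto
  qed (use K(1) lt core in auto)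
  let ?F = "{(u, v) \<in> K \<times> K. u \<noteq> v}"
  have F: "?F = Sigma K (\<lambda>u. K - {u})" by auto
  have finF: "finite ?F" unfolding F using finite_K by simp
  have cF: "card ?F = card K * (card K - 1)" unfolding F using finite_K by simp
  have "E \<inter> K \<times> K \<subseteq> ?F" using not_self by auto
  from card_mono[OF finF this] have "card K \<noteq> 3" unfolding cF using core(2) by auto
  then have "card K = 4 \<or> 5 \<le> card K" using K(2) by auto
  then have "excess E (gram 3 x) < 6" using bicyclic_k3_large_core bicyclic_k3_small_core by auto
  then show ?thesis using sum_\<mu>[of 3] n by simp
qed


lemma real_choose_two: "real ((k + 1) choose 2) = real k * (real k + 1) / 2"
  by (induction k) (simp_all add: numeral_2_eq_2 field_simps)

lemma (in sgraph) extremal_0_star: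
  assumes "z \<in> V" "E = {z} \<times> (V - {z}) \<union> (V - {z}) \<times> {z}" "2 \<le> card V"
  shows "extremal V E 0"
proof -
  have "card (V - {z}) \<noteq> 0" using assms by simp
  then have "V - {z} \<noteq> {}" by (intro notI) (simp only: card.empty)
  then obtain v where "v \<in> V - {z}" by (meson ex_in_conv)
  moreover have "E = two_center_arcs V z v {}" unfolding assms(2) two_center_arcs_def Let_def by auto
  ultimately show ?thesis unfolding extremal_def using assms(1)
    by (intro exI[of _ z] exI[of _ v] exI[of _ "{}"]) auto
qed

theorem (in spectrum) sum_\<mu>_bound:
  assumes conn: "conn V E" and c: "c \<in> {0, 1, 2}" and e: "card E = 2 * e" "e + 1 = card V + c"
    and k: "1 \<le> k" "k < card V"
  shows "(\<Sum>i<k. \<mu> i) \<le> real e + real k * (real k + 1) / 2"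
    and "(\<Sum>i<k. \<mu> i) = real e + real k * (real k + 1) / 2 \<longleftrightarrow>
      (c = 0 \<and> k = 1 \<or> c \<in> {1, 2} \<and> k = 2) \<and> extremal V E c"
proof -
  let ?S = "\<Sum>i<k. \<mu> i" and ?R = "real e + real k * (real k + 1) / 2"
  let ?A = "c = 0 \<and> k = 1 \<or> c \<in> {1, 2} \<and> k = 2"
  have ne: "V \<noteq> {}" using k by auto
  have re: "real e = real (card V) + real c - 1" using arg_cong[OF e(2), of real] by simp
  have "?S \<le> ?R \<and> (?S = ?R \<longleftrightarrow> ?A \<and> extremal V E c)"
  proof (cases "k = 1")
    case k1: True
    have pos: "0 < \<mu> 0" using \<mu>_pos[OF conn, of 0] k k1 by simp
    have S: "?S = \<mu> 0" and R: "?R = real (card V) + real c" using k1 re by simp_all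
    have le: "\<mu> 0 \<le> card V" by (rule largest_eigenvalue(1)[OF ne pos])
    show ?thesis
    proof (cases "c = 0")
      case True
      have "extremal V E 0" if "\<mu> 0 = card V"
      proof -
        have "card E = 2 * (card V - 1)" using e True by simp
        from tree_star[OF conn _ this that] obtain z where "z \<in> V" "E = {z} \<times> (V - {z}) \<union> (V - {z}) \<times> {z}"
          using k k1 by fastforce
        then show ?thesis by (rule extremal_0_star) (use k k1 in simp)
      qed
      moreover have "\<mu> 0 = card V" if "extremal V E 0"
        using extremal_sum_ge(1)[OF that basis] le by simp
      ultimately show ?thesis unfolding S R using le True k1 by auto
    next
      case False
      then show ?thesis unfolding S R using le k1 by auto
    qed
  next
    case False
    then have k2: "2 \<le> k" using k by simp
    show ?thesis
    proof (cases "k = 2 \<and> 1 \<le> c")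
      case True
      have c12: "c = 1 \<or> c = 2" using True c by auto
      have S: "?S = \<mu> 0 + \<mu> 1" and R: "?R = card E / 2 + 3" and R': "?R = card V + real c + 2"
        using True re e(1) by (simp_all add: numeral_2_eq_2 field_simps)
      have "card E + 2 = 2 * (card V + c)" using e by simp
      then have "\<mu> 0 + \<mu> 1 \<le> card E / 2 + 3 \<and> (\<mu> 0 + \<mu> 1 = card E / 2 + 3 \<longrightarrow> extremal V E c)"
        by (rule cyclic_k2[OF sgraph_axioms conn ne _ c12 basis])
      moreover have "?R \<le> \<mu> 0 + \<mu> 1" if "extremal V E c"
        using extremal_sum_ge(2)[OF that basis] True unfolding R' by simp
      ultimately show ?thesis unfolding S using R True c12 by auto
    next
      case kc: False
      have "?S < ?R"
      proof (cases "c = 2 \<and> k = 3")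
        case True
        have "card E + 2 = 2 * (card V + 2)" "4 \<le> card V" using e True k by auto
        then have "(\<Sum>i<3. \<mu> i) < card E / 2 + 6" using bicyclic_k3[OF conn ne _ basis] by blast
        then show ?thesis using True unfolding e(1) by simp
      next
        case False
        have "?S < 2 * real k + real (card E) - real (card V)" by (rule incidence_bound_strict[OF conn k2 k(2)])
        \<comment> \<open>Doubled and rearranged, this is 2c \<le> (k - 1)(k - 2).\<close>
        moreover have "2 * real k + real c - 1 \<le> real k * (real k + 1) / 2"
        proof -
          have "c = 0 \<or> c = 1 \<and> 3 \<le> k \<or> c = 2 \<and> 4 \<le> k" using c kc k2 False by auto
          then consider "c = 0" | "c = 1" "3 \<le> real k" | "c = 2" "4 \<le> real k" by fastforce
          then show ?thesis
          proof cases
            case 1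
            have "0 \<le> (real k - 1) * (real k - 2)" using k2 by simp
            then show ?thesis using 1 by (simp add: algebra_simps)
          next
            case 2
            then have "0 \<le> real k * (real k - 3)" by simp
            then show ?thesis using 2 by (simp add: algebra_simps)
          next
            case 3
            then have "1 * 4 \<le> (real k - 3) * real k" by (intro mult_mono) auto
            then show ?thesis using 3 by (simp add: algebra_simps)
          qed
        qed
        ultimately show ?thesis using re e(1) by simp
      qed
      moreover have "\<not> ?A" using kc k2 by auto
      ultimately show ?thesis by auto
    qed
  qed
  then show "?S \<le> ?R" "?S = ?R \<longleftrightarrow> ?A \<and> extremal V E c" by blast+
qed

lemma (in sgraph) card_E_le: "card E \<le> card V * (card V - 1)"
proof -
  have "deg v \<le> card V - 1" if "v \<in> V" for v
  proof -
    have "N v \<subseteq> V - {v}" using E_in not_self by auto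
    then show ?thesis using card_mono[of "V - {v}"] finite_V that by fastforce
  qed
  then show ?thesis unfolding card_E using sum_bounded_above[of V deg "card V - 1"] by simp
qed

theorem theorem3p5:
  fixes G :: "'a pair_pre_digraph" and c n k :: nat
  assumes "c \<in> {0, 1, 2}"
    and "c_cyclic c G"
    and "n = card (pverts G)"
    and "k \<in> {1..n - 1}"
  shows "laplacian_sum k G \<le> real (num_edges G) + real ((k + 1) choose 2) \<and>
    (laplacian_sum k G = real (num_edges G) + real ((k + 1) choose 2) \<longleftrightarrow>
      (c = 0 \<and> k = 1 \<and> digraph_iso (with_proj G) (with_proj (star_graph n))) \<or>
      (c = 1 \<and> k = 2 \<and> digraph_iso (with_proj G) (with_proj (G_graph (n - 3) 1))) \<or>
      (c = 2 \<and> k = 2 \<and> digraph_iso (with_proj G) (with_proj (G_graph (n - 4) 2))))"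
proof -
  have G: "pair_graph G" and con: "Digraph_Component.connected (with_proj G)"
    and e: "num_edges G + 1 = card (pverts G) + c" using assms(2) by (auto simp: c_cyclic_def)
  interpret G: pair_graph G by (rule G)
  interpret sgraph "pverts G" "parcs G" by (rule G.sgraph)
  obtain x \<mu> where basis: "eigenbasis (pverts G) (lapl (parcs G)) x \<mu>" using eigenbasis_exists_lapl by blast
  interpret spectrum "pverts G" "parcs G" x \<mu> by unfold_locales (rule basis)
  have k: "1 \<le> k" "k < card (pverts G)" using assms(3,4) by auto
  have S: "laplacian_sum k G = (\<Sum>i<k. \<mu> i)"
    by (rule laplacian_sum_eigenbasis[OF G _ basis]) (use k in simp)
  have iso: "digraph_iso (with_proj G) (with_proj H) \<longleftrightarrow> extremal (pverts G) (parcs G) t"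
    if "pverts H = {..<n}" "parcs H = two_center_arcs {..<n} 0 1 {2..<t + 2}" "t + 2 \<le> n" for H t
    unfolding digraph_iso_with_proj[OF G.pair_wf_digraph_axioms] that(1,2)
    by (rule ex_iso_extremal_iff[OF finite_V assms(3)[symmetric] E_sub that(3)])
  \<comment> \<open>This keeps \<open>n - 4\<close> from being truncated: a bicyclic graph on three
    vertices would need four edges.\<close>
  have n4: "4 \<le> n" if "c = 2" "k = 2"
  proof (rule ccontr)
    assume "\<not> 4 \<le> n"
    then have "n = 3" using k that assms(3) by simp
    then show False using card_E_le G.card_parcs e that assms(3) by simp
  qed
  have star: "digraph_iso (with_proj G) (with_proj (star_graph n)) \<longleftrightarrow> extremal (pverts G) (parcs G) 0"
    by (rule iso[OF _ star_graph_arcs]) (use k assms(3) in \<open>simp_all add: star_graph_def Let_def\<close>)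
  have Gt: "digraph_iso (with_proj G) (with_proj (G_graph (n - (t + 2)) t)) \<longleftrightarrow> extremal (pverts G) (parcs G) t"
    if "t + 2 \<le> n" for t
    by (rule iso[OF _ G_graph_arcs[OF that] that]) (use that in \<open>simp add: G_graph_def Let_def\<close>)
  have G1: "digraph_iso (with_proj G) (with_proj (G_graph (n - 3) 1)) \<longleftrightarrow> extremal (pverts G) (parcs G) 1" if "3 \<le> n"
    using Gt[of 1] that by (simp add: numeral_3_eq_3)
  have G2: "digraph_iso (with_proj G) (with_proj (G_graph (n - 4) 2)) \<longleftrightarrow> extremal (pverts G) (parcs G) 2" if "4 \<le> n"
    using Gt[of 2] that by simp
  have iff: "(c = 0 \<and> k = 1 \<and> digraph_iso (with_proj G) (with_proj (star_graph n))) \<or>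
      (c = 1 \<and> k = 2 \<and> digraph_iso (with_proj G) (with_proj (G_graph (n - 3) 1))) \<or>
      (c = 2 \<and> k = 2 \<and> digraph_iso (with_proj G) (with_proj (G_graph (n - 4) 2))) \<longleftrightarrow>
      (c = 0 \<and> k = 1 \<or> c \<in> {1, 2} \<and> k = 2) \<and> extremal (pverts G) (parcs G) c"
    using star G1 G2 n4 k(2) assms(3) by (cases "k = 2") auto
  show ?thesis
    unfolding S real_choose_two iff
    using sum_\<mu>_bound[OF G.conn(1)[OF con] assms(1) G.card_parcs e k] by blast
qed

end
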